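(* For every extreme point $C$ of $\mathrm{Cor}(n,m)$, the behavior $\mathbf{p}_C$ is a Gram-Lorentz behavior and $$\mathcal{D}(\mathbf{p}_C)\ge\sqrt{2}^{\,\lfloor\mathrm{rank}(C)/2\rfloor}.$$
   Context: $\mathrm{Cor}(n,m)$ is the (convex) set of matrices $C=(c_{xy})\in[-1,1]^{n\times m}$ for which there exist $d\ge1$, Hermitian $d\times d$ matrices $M_1,\dots,M_n,N_1,\dots,N_m$ with eigenvalues in $[-1,1]$ and a Hermitian psd trace-one matrix $\rho$ on $\mathbb{C}^d\otimes\mathbb{C}^d$ with $c_{xy}=\mathrm{Tr}((M_x\otimes N_y)\rho)$ for all $x,y$. For $C\in\mathrm{Cor}(n,m)$, $\mathbf{p}_C$ is the behavior in the $(n,m,2,2)$-scenario with outcomes $a,b\in\{\pm1\}$ given by $p_C(ab|xy)=\frac{1+ab\,c_{xy}}{4}$. A quantum behavior $\mathbf{p}$ has a $d$-dimensional representation if there exist a Hermitian psd trace-one $\rho$ on $\mathbb{C}^d\otimes\mathbb{C}^d$ and, for each $x$, psd $d\times d$ matrices $\{M_{a|x}\}_a$ summing to $I_d$ and, for each $y$, psd $d\times d$ matrices $\{N_{b|y}\}_b$ summing to $I_d$, with $p(ab|xy)=\mathrm{Tr}((M_{a|x}\otimes N_{b|y})\rho)$; $\mathcal{D}(\mathbf{p})$ is the least such $d$. For a behavior $\mathbf{p}$ in an $(m_A,m_B,o_A,o_B)$-scenario let $N:=m_Ao_A+m_Bo_B$ and $\mathcal{A}(\mathbf{p})$ the set of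 real symmetric $N\times N$ matrices $R$ indexed by $([m_A]\times[o_A])\cup([m_B]\times[o_B])$ with $\sum_{a,a'}R_{xa,x'a'}=1$, $\sum_{a,b}R_{xa,yb}=1$, $\sum_{b,b'}R_{yb,y'b'}=1$ for all $x,x',y,y'$, and $R_{xa,yb}=p(ab|xy)$. A matrix is Gram-Lorentz if it is the Gram matrix of vectors in some Lorentz cone $\mathcal{L}_k:=\{(c,x)\in\mathbb{R}\times\mathbb{R}^{k-1}:c\ge\|x\|\}$; a quantum behavior $\mathbf{p}$ is Gram-Lorentz if some Gram-Lorentz matrix lies in $\mathcal{A}(\mathbf{p})$. *)

theory Defs
  imports "HOL-Analysis.Analysis" "Jordan_Normal_Form.Schur_Decomposition" "Jordan_Normal_Form.DL_Rank"
begin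

definition mtrace :: "complex mat \<Rightarrow> complex" where
  "mtrace A = (\<Sum>i<dim_row A. A $$ (i, i))"

definition herm :: "nat \<Rightarrow> complex mat \<Rightarrow> bool" where
  "herm d A \<longleftrightarrow> A \<in> carrier_mat d d \<and> mat_adjoint A = A"

definition psd :: "nat \<Rightarrow> complex mat \<Rightarrow> bool" where
  "psd d A \<longleftrightarrow> herm d A \<and> (\<forall>v \<in> carrier_vec d. 0 \<le> Re ((A *\<^sub>v v) \<bullet>c v))"

text \<open>Kronecker (tensor) product of two d x d matrices: a d^2 x d^2 matrix on
  C^d \<otimes> C^d, with basis vector e_i \<otimes> e_j at index i*d+j.\<close>
definition kron :: "nat \<Rightarrow> complex mat \<Rightarrow> complex mat \<Rightarrow> complex mat" where
  "kron d A B = mat (d * d) (d * d)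
     (\<lambda>(i, j). A $$ (i div d, j div d) * B $$ (i mod d, j mod d))"

definition state :: "nat \<Rightarrow> complex mat \<Rightarrow> bool" where
  "state d \<rho> \<longleftrightarrow> psd (d * d) \<rho> \<and> mtrace \<rho> = 1"

definition observable :: "nat \<Rightarrow> complex mat \<Rightarrow> bool" where
  "observable d M \<longleftrightarrow> herm d M \<and>
     (\<forall>k. eigenvalue M k \<longrightarrow> k \<in> complex_of_real ` {-1..1})"

definition Cor :: "nat \<Rightarrow> nat \<Rightarrow> real mat set" where
  "Cor n m = {C. C \<in> carrier_mat n m \<and>
     (\<forall>x<n. \<forall>y<m. C $$ (x, y) \<in> {-1..1}) \<and>
     (\<exists>d \<ge> 1. \<exists>M N \<rho>. (\<forall>x<n. observable d (M x)) \<and> (\<forall>y<m. observable d (N y)) \<and>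
        state d \<rho> \<and>
        (\<forall>x<n. \<forall>y<m. complex_of_real (C $$ (x, y)) = mtrace (kron d (M x) (N y) * \<rho>)))}"

definition extreme_point_mat :: "real mat set \<Rightarrow> real mat \<Rightarrow> bool" where
  "extreme_point_mat S C \<longleftrightarrow> C \<in> S \<and>
     (\<forall>A \<in> S. \<forall>B \<in> S. \<forall>t::real. 0 < t \<and> t < 1 \<and> C = t \<cdot>\<^sub>m A + (1 - t) \<cdot>\<^sub>m B \<longrightarrow> A = C \<and> B = C)"

definition mat_rank :: "real mat \<Rightarrow> nat" where
  "mat_rank C = vec_space.rank (dim_row C) C"

text \<open>A behaviour in the (mA,mB,oA,oB)-scenario: p a b x y = p(ab|xy), with
  x < mA, y < mB, a < oA, b < oB (inputs and outputs indexed from 0).\<close>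
type_synonym behavior = "nat \<Rightarrow> nat \<Rightarrow> nat \<Rightarrow> nat \<Rightarrow> real"

text \<open>Outcomes \<plusminus>1 are encoded as 0 \<mapsto> +1, 1 \<mapsto> -1.\<close>
definition pm :: "nat \<Rightarrow> real" where
  "pm a = (if a = 0 then 1 else -1)"

definition pC :: "real mat \<Rightarrow> behavior" where
  "pC C = (\<lambda>a b x y. (1 + pm a * pm b * C $$ (x, y)) / 4)"

definition has_rep :: "nat \<Rightarrow> nat \<Rightarrow> nat \<Rightarrow> nat \<Rightarrow> nat \<Rightarrow> behavior \<Rightarrow> bool" where
  "has_rep mA mB oA oB d p \<longleftrightarrow>
     (\<exists>\<rho> M N. state d \<rho> \<and>
        (\<forall>x<mA. (\<forall>a<oA. psd d (M a x)) \<and> (\<forall>i<d. \<forall>j<d. (\<Sum>a<oA. M a x $$ (i, j)) = 1\<^sub>m d $$ (i, j))) \<and>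
        (\<forall>y<mB. (\<forall>b<oB. psd d (N b y)) \<and> (\<forall>i<d. \<forall>j<d. (\<Sum>b<oB. N b y $$ (i, j)) = 1\<^sub>m d $$ (i, j))) \<and>
        (\<forall>x<mA. \<forall>y<mB. \<forall>a<oA. \<forall>b<oB.
           complex_of_real (p a b x y) = mtrace (kron d (M a x) (N b y) * \<rho>)))"

definition quantum_behavior :: "nat \<Rightarrow> nat \<Rightarrow> nat \<Rightarrow> nat \<Rightarrow> behavior \<Rightarrow> bool" where
  "quantum_behavior mA mB oA oB p \<longleftrightarrow> (\<exists>d. has_rep mA mB oA oB d p)"

definition Dmin :: "nat \<Rightarrow> nat \<Rightarrow> nat \<Rightarrow> nat \<Rightarrow> behavior \<Rightarrow> nat" where
  "Dmin mA mB oA oB p = (LEAST d. has_rep mA mB oA oB d p)"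

text \<open>Index set ([mA] x [oA]) \<union> ([mB] x [oB]) as a disjoint union:
  Inl (x,a) for Alice, Inr (y,b) for Bob.\<close>
type_synonym idx = "(nat \<times> nat) + (nat \<times> nat)"

definition index_set :: "nat \<Rightarrow> nat \<Rightarrow> nat \<Rightarrow> nat \<Rightarrow> idx set" where
  "index_set mA mB oA oB = Inl ` ({..<mA} \<times> {..<oA}) \<union> Inr ` ({..<mB} \<times> {..<oB})"

definition Aset :: "nat \<Rightarrow> nat \<Rightarrow> nat \<Rightarrow> nat \<Rightarrow> behavior \<Rightarrow> (idx \<Rightarrow> idx \<Rightarrow> real) set" where
  "Aset mA mB oA oB p = {R.
     (\<forall>i \<in> index_set mA mB oA oB. \<forall>j \<in> index_set mA mB oA oB. R i j = R j i) \<and>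
     (\<forall>x<mA. \<forall>x'<mA. (\<Sum>a<oA. \<Sum>a'<oA. R (Inl (x, a)) (Inl (x', a'))) = 1) \<and>
     (\<forall>x<mA. \<forall>y<mB. (\<Sum>a<oA. \<Sum>b<oB. R (Inl (x, a)) (Inr (y, b))) = 1) \<and>
     (\<forall>y<mB. \<forall>y'<mB. (\<Sum>b<oB. \<Sum>b'<oB. R (Inr (y, b)) (Inr (y', b'))) = 1) \<and>
     (\<forall>x<mA. \<forall>y<mB. \<forall>a<oA. \<forall>b<oB. R (Inl (x, a)) (Inr (y, b)) = p a b x y)}"

text \<open>Lorentz cone L_k = {(c, x) \<in> R \<times> R^(k-1). c \<ge> |x|}, vectors given by
  their coordinates 0..k-1.\<close>
definition in_lorentz :: "nat \<Rightarrow> (nat \<Rightarrow> real) \<Rightarrow> bool" where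
  "in_lorentz k v \<longleftrightarrow> sqrt (\<Sum>l\<in>{1..<k}. (v l)\<^sup>2) \<le> v 0"

definition gram_lorentz :: "idx set \<Rightarrow> (idx \<Rightarrow> idx \<Rightarrow> real) \<Rightarrow> bool" where
  "gram_lorentz I R \<longleftrightarrow> (\<exists>k \<ge> 1. \<exists>v :: idx \<Rightarrow> nat \<Rightarrow> real.
     (\<forall>i \<in> I. in_lorentz k (v i)) \<and>
     (\<forall>i \<in> I. \<forall>j \<in> I. R i j = (\<Sum>l<k. v i l * v j l)))"

definition gram_lorentz_behavior :: "nat \<Rightarrow> nat \<Rightarrow> nat \<Rightarrow> nat \<Rightarrow> behavior \<Rightarrow> bool" where
  "gram_lorentz_behavior mA mB oA oB p \<longleftrightarrow> quantum_behavior mA mB oA oB p \<and>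
     (\<exists>R \<in> Aset mA mB oA oB p. gram_lorentz (index_set mA mB oA oB) R)"

end

theory Submission
  imports Defs "HOL-Library.Poly_Mapping"
begin

text \<open>By Tsirelson's theorem the quantum correlations are the matrices of inner products of vectors in
  a real unit ball; a Clifford algebra and a maximally entangled state turn vectors into a quantum
  realization with uniform marginals, and the vectors (1, u)/2, (1, -u)/2 show that the behavior is Gram-Lorentz.

  If C is extreme and is realized by operators M(x), N(y) on a purified state P, then all vectors M(x)P, N(y)P have
  length 1 and both families span the same space, of some dimension r at least rank(C). Every quadratic form vanishing
  on all of these vectors is zero, since adding a small multiple of it to the inner product would perturb C in both
  directions. Applied to the form measuring the failure of the Clifford relations at P, this gives r
  combinations of the M(x) that satisfy these relations on the cyclic space of P under
  operators commuting with all M(x). That space lies in C^d tensor C^d and is nonzero, so its dimension, at most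
  d^2, is at least 2^(r div 2).\<close>

section \<open>Finitely supported vectors as an inner product space\<close>

text \<open>The dimension of a realization is a variable, so all vectors live in one type of
  finitely supported complex functions. Its inner product is the real part of the Hermitian one:
  correlations become inner products of real vectors at once, and the complex structure survives as
  a skew operator J with J J = -1.

  Two obstacles shape the lower bound. Away from the state the operators are arbitrary, so the
  Clifford relations can be expected only at P, not of the matrices. But Alice's combinations move P
  exactly as certain combinations of Bob's do, and these commute with Alice's; this carries the
  relations over to a whole invariant space. Moreover the state may be mixed, and its purification
  has an auxiliary index of uncontrolled range. Both parties act alike on every value of that index,
  so P may be replaced by one nonzero slice of it, which has d^2 complex coordinates. A Clifford
  module for r generators has complex dimension at least 2^(r div 2); comparing this with d^2 rather
  than d is where the square root in the bound comes from.\<close>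

instantiation poly_mapping :: (type, real_inner) real_inner
begin

lift_definition scaleR_poly_mapping :: "real \<Rightarrow> ('a \<Rightarrow>\<^sub>0 'b) \<Rightarrow> 'a \<Rightarrow>\<^sub>0 'b"
  is "\<lambda>r f k. r *\<^sub>R f k"
  by (erule finite_subset[rotated]) auto

definition inner_poly_mapping :: "('a \<Rightarrow>\<^sub>0 'b) \<Rightarrow> ('a \<Rightarrow>\<^sub>0 'b) \<Rightarrow> real" where
  "inner_poly_mapping f g = (\<Sum>k\<in>Poly_Mapping.keys f. inner (Poly_Mapping.lookup f k) (Poly_Mapping.lookup g k))"

definition norm_poly_mapping :: "('a \<Rightarrow>\<^sub>0 'b) \<Rightarrow> real" where
  "norm_poly_mapping f = sqrt (inner f f)"

definition dist_poly_mapping :: "('a \<Rightarrow>\<^sub>0 'b) \<Rightarrow> ('a \<Rightarrow>\<^sub>0 'b) \<Rightarrow> real" where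
  "dist_poly_mapping f g = norm (f - g)"

definition sgn_poly_mapping :: "('a \<Rightarrow>\<^sub>0 'b) \<Rightarrow> 'a \<Rightarrow>\<^sub>0 'b" where
  "sgn_poly_mapping f = inverse (norm f) *\<^sub>R f"

definition uniformity_poly_mapping :: "(('a \<Rightarrow>\<^sub>0 'b) \<times> ('a \<Rightarrow>\<^sub>0 'b)) filter" where
  "uniformity_poly_mapping = (INF e\<in>{0<..}. principal {(x, y). dist x y < e})"

definition open_poly_mapping :: "('a \<Rightarrow>\<^sub>0 'b) set \<Rightarrow> bool" where
  "open_poly_mapping U \<longleftrightarrow> (\<forall>x\<in>U. eventually (\<lambda>(x', y). x' = x \<longrightarrow> y \<in> U) uniformity)"

text \<open>The definition sums over the support of the first argument; over a common finite
  superset, symmetry and additivity hold termwise.\<close>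

lemma inner_poly_mapping_eq_sum:
  fixes f g :: "'a \<Rightarrow>\<^sub>0 'b"
  assumes "finite S" "Poly_Mapping.keys f \<subseteq> S"
  shows "inner f g = (\<Sum>k\<in>S. inner (Poly_Mapping.lookup f k) (Poly_Mapping.lookup g k))"
  unfolding inner_poly_mapping_def
  by (rule sum.mono_neutral_left) (use assms in \<open>auto simp: in_keys_iff\<close>)

instance
proof
  fix r s :: real and x y z :: "'a \<Rightarrow>\<^sub>0 'b"
  show "r *\<^sub>R (x + y) = r *\<^sub>R x + r *\<^sub>R y"
    by (rule poly_mapping_eqI) (simp add: scaleR_poly_mapping.rep_eq lookup_add scaleR_add_right)
  show "(r + s) *\<^sub>R x = r *\<^sub>R x + s *\<^sub>R x"
    by (rule poly_mapping_eqI) (simp add: scaleR_poly_mapping.rep_eq lookup_add scaleR_add_left)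
  show "r *\<^sub>R s *\<^sub>R x = (r * s) *\<^sub>R x"
    by (rule poly_mapping_eqI) (simp add: scaleR_poly_mapping.rep_eq)
  show "1 *\<^sub>R x = x"
    by (rule poly_mapping_eqI) (simp add: scaleR_poly_mapping.rep_eq)
  let ?S = "Poly_Mapping.keys x \<union> Poly_Mapping.keys y \<union> Poly_Mapping.keys z"
  have S: "finite ?S" "Poly_Mapping.keys (x + y) \<subseteq> ?S" "Poly_Mapping.keys (r *\<^sub>R x) \<subseteq> ?S"
    using Poly_Mapping.keys_add[of x y] by (auto simp: in_keys_iff scaleR_poly_mapping.rep_eq)
  note E = inner_poly_mapping_eq_sum[of ?S]
  show "inner x y = inner y x"
    using S by (subst (1 2) E) (auto simp: inner_commute)
  show "inner (x + y) z = inner x z + inner y z"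
    using S by (subst (1 2 3) E) (auto simp: inner_add_left lookup_add sum.distrib)
  show "inner (r *\<^sub>R x) y = r * inner x y"
    using S by (subst (1 2) E) (auto simp: scaleR_poly_mapping.rep_eq sum_distrib_left)
  show "0 \<le> inner x x"
    unfolding inner_poly_mapping_def by (simp add: sum_nonneg)
  show "(inner x x = 0) = (x = 0)"
    unfolding inner_poly_mapping_def
    by (subst sum_nonneg_eq_0_iff) (auto intro!: poly_mapping_eqI simp: in_keys_iff)
qed (fact norm_poly_mapping_def dist_poly_mapping_def sgn_poly_mapping_def
      uniformity_poly_mapping_def open_poly_mapping_def)+

end

section \<open>Gram-Schmidt bases and coordinates\<close>

lemma orthonormal_family_exists:
  fixes u :: "nat \<Rightarrow> 'a::real_inner"
  shows "\<exists>(r::nat) g. (\<forall>i<r. g i \<in> span (u ` {..<n})) \<and>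
           (\<forall>i<r. \<forall>j<r. inner (g i) (g j) = (if i = j then 1 else 0)) \<and>
           (\<forall>x<n. u x = (\<Sum>i<r. inner (u x) (g i) *\<^sub>R g i))"
proof (induction n)
  case 0
  show ?case by (rule exI[of _ "0::nat"]) auto
next
  case (Suc n)
  then obtain r :: nat and g where "\<forall>i<r. g i \<in> span (u ` {..<n})"
    "\<forall>i<r. \<forall>j<r. inner (g i) (g j) = (if i = j then 1 else 0)"
    "\<forall>x<n. u x = (\<Sum>i<r. inner (u x) (g i) *\<^sub>R g i)"
    by (elim exE conjE) (rule that; assumption)
  then have g: "\<And>i. i < r \<Longrightarrow> g i \<in> span (u ` {..<n})"
    and o: "\<And>i j. i < r \<Longrightarrow> j < r \<Longrightarrow> inner (g i) (g j) = (if i = j then 1 else 0)"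
    and e: "\<And>x. x < n \<Longrightarrow> u x = (\<Sum>i<r. inner (u x) (g i) *\<^sub>R g i)"
    by auto
  have span_mono': "span (u ` {..<n}) \<subseteq> span (u ` {..<Suc n})"
    by (intro span_mono image_mono) auto
  define w where "w = u n - (\<Sum>i<r. inner (u n) (g i) *\<^sub>R g i)"
  show ?case
  proof (cases "w = 0")
    case True
    then have "\<forall>x<Suc n. u x = (\<Sum>i<r. inner (u x) (g i) *\<^sub>R g i)"
      using e by (auto simp: w_def less_Suc_eq)
    moreover have "\<forall>i<r. g i \<in> span (u ` {..<Suc n})" using g span_mono' by blast
    moreover have "\<forall>i<r. \<forall>j<r. inner (g i) (g j) = (if i = j then 1 else 0)" by (intro allI impI o)
    ultimately show ?thesis by (intro exI[of _ r] exI[of _ g] conjI)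
  next
    case False
    define g' where "g' = (\<lambda>i. if i = r then (1 / norm w) *\<^sub>R w else g i)"
    have gw: "inner (g i) w = 0" if "i < r" for i
      using that by (simp add: w_def inner_diff_right inner_sum_right o if_distrib cong: if_cong)
        (simp add: inner_commute)
    have uw: "inner (u x) w = 0" if "x < n" for x
      by (subst e[OF that]) (simp add: inner_sum_left gw)
    have un: "u n = w + (\<Sum>i<r. inner (u n) (g i) *\<^sub>R g i)" by (simp add: w_def)
    have unw: "inner (u n) w = (norm w)\<^sup>2"
      by (subst un) (simp add: inner_add_left inner_sum_left gw power2_norm_eq_inner)
    have "w \<in> span (u ` {..<Suc n})"
      unfolding w_def
      by (intro span_diff span_sum span_scale) (use g span_mono' in \<open>auto intro: span_base\<close>)
    then have 1: "\<forall>i<Suc r. g' i \<in> span (u ` {..<Suc n})"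
      using g span_mono' by (auto simp: g'_def less_Suc_eq intro: span_scale)
    have 2: "\<forall>i<Suc r. \<forall>j<Suc r. inner (g' i) (g' j) = (if i = j then 1 else 0)"
      using False by (auto simp: g'_def less_Suc_eq o gw inner_commute[of w] divide_simps
          power2_norm_eq_inner[symmetric] power2_eq_square)
    have 3: "\<forall>x<Suc n. u x = (\<Sum>i<Suc r. inner (u x) (g' i) *\<^sub>R g' i)"
    proof (intro allI impI)
      fix x assume "x < Suc n"
      have "(\<Sum>i<Suc r. inner (u x) (g' i) *\<^sub>R g' i) =
          (\<Sum>i<r. inner (u x) (g i) *\<^sub>R g i) + (inner (u x) w / (norm w)\<^sup>2) *\<^sub>R w"
        by (simp add: g'_def power2_eq_square)
      also have "\<dots> = u x"
      proof (cases "x = n")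
        case True
        then show ?thesis using False un unw by (simp add: add.commute)
      next
        case False
        then show ?thesis using \<open>x < Suc n\<close> e[of x] uw[of x] by simp
      qed
      finally show "u x = (\<Sum>i<Suc r. inner (u x) (g' i) *\<^sub>R g' i)" ..
    qed
    show ?thesis using 1 2 3 by (intro exI[of _ "Suc r"] exI[of _ g'] conjI)
  qed
qed

text \<open>Bessel's inequality with its defect kept: it bounds the coordinates, and when they
  already have full length it places v in the span.\<close>

lemma norm_eq_orthonormal_expansion:
  fixes v :: "'a::real_inner" and r :: nat
  assumes "\<forall>i<r. \<forall>j<r. inner (g i) (g j) = (if i = j then 1 else 0)"
  shows "inner v v = (\<Sum>i<r. (inner v (g i))\<^sup>2) +
           (norm (v - (\<Sum>i<r. inner v (g i) *\<^sub>R g i)))\<^sup>2"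
proof -
  let ?p = "\<Sum>i<r. inner v (g i) *\<^sub>R g i"
  have 1: "inner v ?p = (\<Sum>i<r. (inner v (g i))\<^sup>2)"
    by (simp add: inner_sum_right power2_eq_square)
  have "inner ?p (g j) = inner v (g j)" if "j < r" for j
  proof -
    have "inner ?p (g j) = (\<Sum>i<r. if i = j then inner v (g j) else 0)"
      unfolding inner_sum_left by (rule sum.cong) (use assms that in auto)
    then show ?thesis using that by simp
  qed
  then have 2: "inner ?p ?p = (\<Sum>i<r. (inner v (g i))\<^sup>2)"
    by (simp only: inner_sum_right inner_scaleR_right) (simp add: power2_eq_square)
  show ?thesis
    unfolding power2_norm_eq_inner using 1 2 by (simp add: inner_diff inner_commute)
qed

text \<open>Coefficients are indexed by x rather than by vectors, so repetitions among the
  \<open>u x\<close> do no harm.\<close>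

lemma span_image_lessThan_sum:
  fixes u :: "nat \<Rightarrow> 'a::real_vector"
  assumes "v \<in> span (u ` {..<n})"
  shows "\<exists>b. v = (\<Sum>x<n. b x *\<^sub>R u x)"
  using assms
proof (induction rule: span_induct_alt)
  case base
  show ?case by (rule exI[of _ "\<lambda>_. 0"]) simp
next
  case (step c x y)
  then obtain b k where "y = (\<Sum>x<n. b x *\<^sub>R u x)" "x = u k" "k < n" by auto
  then have "c *\<^sub>R x + y = (\<Sum>x<n. (b x + (if x = k then c else 0)) *\<^sub>R u x)"
    by (simp add: scaleR_add_left sum.distrib if_distrib[of "\<lambda>a. a *\<^sub>R _"] cong: if_cong)
  then show ?case by (rule exI[of _ "\<lambda>x. b x + (if x = k then c else 0)"])
qed

section \<open>Gram factorization\<close>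

text \<open>Elimination by pivots. Subtracting the rank-one matrix \<open>G x p * G p y / g\<close>
  leaves a positive semidefinite Schur complement that vanishes at position p and has no new nonzero
  diagonal entry, so the number of nonzero diagonal entries drops. With zero diagonal, positivity
  forces the whole matrix to vanish.\<close>

lemma psd_gram_factorization:
  fixes G :: "nat \<Rightarrow> nat \<Rightarrow> complex"
  assumes "\<And>x y. x < n \<Longrightarrow> y < n \<Longrightarrow> G y x = cnj (G x y)"
    and "\<And>z. 0 \<le> Re (\<Sum>x<n. \<Sum>y<n. z x * G x y * cnj (z y))"
  shows "\<exists>(r::nat) U. \<forall>x<n. \<forall>y<n. G x y = (\<Sum>i<r. U x i * cnj (U y i))"
  using assms
proof (induction "card {x. x < n \<and> G x x \<noteq> 0}" arbitrary: G rule: less_induct)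
  case less
  note herm = less.prems(1) and psd = less.prems(2)
  define S where "S = (\<lambda>z w. \<Sum>x<n. \<Sum>y<n. z x * G x y * cnj (w y))"
  define e where "e = (\<lambda>p (a::complex) x. if x = (p::nat) then a else 0)"
  have S_add: "S (\<lambda>x. z x + w x) (\<lambda>x. z x + w x) = S z z + S z w + S w z + S w w" for z w
    by (simp add: S_def sum.distrib distrib_left distrib_right add_ac)
  have S_e: "S z (e p a) = cnj a * (\<Sum>x<n. z x * G x p)" if "p < n" for z p a
  proof -
    have "(\<Sum>y<n. z x * G x y * cnj (e p a y)) = cnj a * (z x * G x p)" for x
    proof -
      have "(\<Sum>y<n. z x * G x y * cnj (e p a y)) = (\<Sum>y<n. if y = p then cnj a * (z x * G x p) else 0)"
        by (rule sum.cong) (auto simp: e_def)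
      then show ?thesis using that by simp
    qed
    then show ?thesis by (simp add: S_def sum_distrib_left)
  qed
  have S_cnj: "S w z = cnj (S z w)" for z w
  proof -
    have "cnj (S z w) = (\<Sum>x<n. \<Sum>y<n. w y * G y x * cnj (z x))"
      unfolding S_def by (simp, intro sum.cong refl) (simp add: herm[symmetric])
    also have "\<dots> = S w z" unfolding S_def by (rule sum.swap)
    finally show ?thesis ..
  qed
  have S_ee: "S (e p a) (e p b) = a * cnj b * G p p" if "p < n" for p a b
    using that by (simp add: S_e) (simp add: e_def if_distrib[of "\<lambda>z. z * _"] cong: if_cong)
  \<comment> \<open>The form at z with a added in coordinate p, as a quadratic in a. Suitable
    choices of a give the vanishing of off-diagonal entries and the positivity after
    elimination.\<close>
  have expand: "0 \<le> Re (S z z) + 2 * Re (cnj a * (\<Sum>x<n. z x * G x p)) + (cmod a)\<^sup>2 * Re (G p p)"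
    if "p < n" for z p a
  proof -
    have "0 \<le> Re (S (\<lambda>x. z x + e p a x) (\<lambda>x. z x + e p a x))"
      using psd[of "\<lambda>x. z x + e p a x"] unfolding S_def .
    also have "\<dots> = Re (S z z) + 2 * Re (S z (e p a)) + Re (S (e p a) (e p a))"
      unfolding S_add by (simp add: S_cnj[of "e p a" z])
    also have "S (e p a) (e p a) = of_real ((cmod a)\<^sup>2) * G p p"
      unfolding S_ee[OF that] complex_norm_square ..
    also have "S z (e p a) = cnj a * (\<Sum>x<n. z x * G x p)" by (rule S_e[OF that])
    finally show ?thesis by simp
  qed
  have diag: "Im (G p p) = 0" "0 \<le> Re (G p p)" if "p < n" for p
  proof -
    show "Im (G p p) = 0" using arg_cong[OF herm[OF that that], of Im] by simp
    have "0 \<le> Re (S (e p 1) (e p 1))" using psd[of "e p 1"] unfolding S_def .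
    then show "0 \<le> Re (G p p)" by (simp add: S_ee[OF that])
  qed
  have offdiag: "G x p = 0" if "x < n" "p < n" "G x x = 0" "G p p = 0" for x p
  proof -
    have eq: "(\<Sum>y<n. e x 1 y * G y p) = G x p"
      using that by (simp add: e_def if_distrib[of "\<lambda>z. z * _"] cong: if_cong)
    \<comment> \<open>With both diagonal entries zero only the cross term is left, and this choice
      of a makes it -2 |G x p|^2.\<close>
    have "0 \<le> Re (S (e x 1) (e x 1)) + 2 * Re (cnj (- G x p) * G x p) + (cmod (- G x p))\<^sup>2 * Re (G p p)"
      using expand[OF that(2), of "e x 1" "- G x p"] unfolding eq .
    then have "0 \<le> - (2 * Re (cnj (G x p) * G x p))" by (simp add: S_ee[OF that(1)] that)
    also have "cnj (G x p) * G x p = complex_of_real ((cmod (G x p))\<^sup>2)"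
      unfolding complex_norm_square by (rule mult.commute)
    finally show ?thesis by simp
  qed
  show ?case
  proof (cases "\<exists>p<n. G p p \<noteq> 0")
    case False
    then show ?thesis using offdiag by (intro exI[of _ "0::nat"]) simp
  next
    case True
    then obtain p where p: "p < n" "G p p \<noteq> 0" by blast
    define g where "g = Re (G p p)"
    have Gpp: "G p p = of_real g" using diag(1)[OF p(1)] unfolding g_def by (simp add: complex_eq_iff)
    have g: "g > 0"
    proof -
      have "g \<noteq> 0" using p(2) unfolding Gpp by simp
      then show ?thesis using diag(2)[OF p(1)] unfolding g_def by simp
    qed
    define G' where "G' = (\<lambda>x y. G x y - G x p * G p y / of_real g)"
    have herm': "G' y x = cnj (G' x y)" if "x < n" "y < n" for x y
      using herm[OF that] herm[OF that(1) p(1)] herm[OF p(1) that(2)]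
      by (simp add: G'_def mult.commute)
    have psd': "0 \<le> Re (\<Sum>x<n. \<Sum>y<n. z x * G' x y * cnj (z y))" for z
    proof -
      define h where "h = (\<Sum>x<n. z x * G x p)"
      have ch: "cnj h = (\<Sum>y<n. G p y * cnj (z y))"
        unfolding h_def by (simp, intro sum.cong refl) (simp add: herm[OF _ p(1)] mult.commute)
      have "(\<Sum>x<n. \<Sum>y<n. z x * G' x y * cnj (z y)) = S z z - (\<Sum>x<n. \<Sum>y<n. (z x * G x p) * (G p y * cnj (z y)) / of_real g)"
        unfolding S_def G'_def by (simp add: sum_subtractf left_diff_distrib right_diff_distrib mult_ac)
      also have "(\<Sum>x<n. \<Sum>y<n. (z x * G x p) * (G p y * cnj (z y)) / of_real g) = h * cnj h / of_real g"
        unfolding ch unfolding h_def by (simp add: sum_product sum_divide_distrib)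
      also have "\<dots> = of_real ((cmod h)\<^sup>2 / g)"
        unfolding of_real_divide complex_norm_square ..
      finally have *: "Re (\<Sum>x<n. \<Sum>y<n. z x * G' x y * cnj (z y)) = Re (S z z) - (cmod h)\<^sup>2 / g" by simp
      \<comment> \<open>The value -h / g minimizes the quadratic in a; the minimum is exactly the
        form of the reduced matrix.\<close>
      have "0 \<le> Re (S z z) + 2 * Re (cnj (- h / of_real g) * h) + (cmod (- h / of_real g))\<^sup>2 * g"
        using expand[OF p(1), of z "- h / of_real g"] unfolding g_def h_def[symmetric] .
      also have "cnj (- h / of_real g) * h = of_real (- (cmod h)\<^sup>2 / g)"
        unfolding of_real_divide of_real_minus complex_norm_square by simp
      also have "(cmod (- h / of_real g))\<^sup>2 * g = (cmod h)\<^sup>2 / g"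
        using g by (simp add: norm_divide power_divide power2_eq_square)
      finally show ?thesis unfolding * by simp
    qed
    have G'p: "G' p p = 0" using g by (simp add: G'_def Gpp)
    \<comment> \<open>If G x x = 0, the new entry is -|G x p|^2 / g, and positivity of the reduced
      matrix leaves only 0. Hence the induction measure cannot pick up new indices.\<close>
    have zero: "G' x x = 0" if "x < n" "G x x = 0" for x
    proof -
      have eq: "G' x x = - of_real ((cmod (G x p))\<^sup>2 / g)"
        unfolding G'_def herm[OF that(1) p(1)] that(2) of_real_divide complex_norm_square by simp
      have "0 \<le> Re (\<Sum>a<n. \<Sum>y<n. e x 1 a * G' a y * cnj (e x 1 y))" using psd' .
      also have "(\<Sum>a<n. \<Sum>y<n. e x 1 a * G' a y * cnj (e x 1 y)) = (\<Sum>a<n. if a = x then G' x x else 0)"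
      proof (intro sum.cong refl)
        fix a
        have "(\<Sum>y<n. e x 1 a * G' a y * cnj (e x 1 y)) = (\<Sum>y<n. if y = x then (if a = x then G' x x else 0) else 0)"
          by (rule sum.cong) (auto simp: e_def)
        then show "(\<Sum>y<n. e x 1 a * G' a y * cnj (e x 1 y)) = (if a = x then G' x x else 0)"
          using that(1) by simp
      qed
      finally have "0 \<le> Re (G' x x)" using that(1) by simp
      then have "(cmod (G x p))\<^sup>2 / g \<le> 0" unfolding eq by simp
      then have "(cmod (G x p))\<^sup>2 / g = 0" using g by (intro antisym) auto
      then show ?thesis unfolding eq by simp
    qed
    have "card {x. x < n \<and> G' x x \<noteq> 0} < card {x. x < n \<and> G x x \<noteq> 0}"
    proof (rule psubset_card_mono)
      show "{x. x < n \<and> G' x x \<noteq> 0} \<subset> {x. x < n \<and> G x x \<noteq> 0}"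
        using zero p G'p by blast
    qed simp
    then have "\<exists>(r::nat) U. \<forall>x<n. \<forall>y<n. G' x y = (\<Sum>i<r. U x i * cnj (U y i))"
      by (rule less.hyps) (erule (1) herm', rule psd')
    then obtain r :: nat and U where U: "\<forall>x<n. \<forall>y<n. G' x y = (\<Sum>i<r. U x i * cnj (U y i))"
      by (elim exE)
    define U' where "U' = (\<lambda>x i. if i = r then G x p / of_real (sqrt g) else U x i)"
    have "G x y = (\<Sum>i<Suc r. U' x i * cnj (U' y i))" if "x < n" "y < n" for x y
    proof -
      have "(\<Sum>i<Suc r. U' x i * cnj (U' y i)) = G' x y + G x p * cnj (G y p) / (of_real (sqrt g) * of_real (sqrt g))"
        using U that by (simp add: U'_def)
      also have "complex_of_real (sqrt g) * of_real (sqrt g) = of_real g"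
        using g by (simp flip: of_real_mult)
      also have "cnj (G y p) = G p y" using herm[OF that(2) p(1)] by simp
      finally show ?thesis by (simp add: G'_def)
    qed
    then show ?thesis by (intro exI[of _ "Suc r"] exI[of _ U'] allI impI)
  qed
qed

lemma sum_lessThan_add: "(\<Sum>i<r + s. f i) = (\<Sum>i<r. f i) + (\<Sum>i<(s::nat). f (r + i))"
  by (induction s) (simp_all add: add.assoc)

text \<open>Since Re (a * cnj b) = Re a * Re b + Im a * Im b, placing real and imaginary parts of a
  complex factor side by side gives a real factor with twice the columns.\<close>

lemma real_psd_gram_factorization:
  fixes G :: "nat \<Rightarrow> nat \<Rightarrow> real"
  assumes sym: "\<And>x y. x < n \<Longrightarrow> y < n \<Longrightarrow> G y x = G x y"
    and psd: "\<And>z. 0 \<le> (\<Sum>x<n. \<Sum>y<n. z x * G x y * z y)"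
  shows "\<exists>(r::nat) U. \<forall>x<n. \<forall>y<n. G x y = (\<Sum>i<r. U x i * U y i)"
proof -
  have "0 \<le> Re (\<Sum>x<n. \<Sum>y<n. z x * complex_of_real (G x y) * cnj (z y))" for z
  proof -
    have "Re (\<Sum>x<n. \<Sum>y<n. z x * complex_of_real (G x y) * cnj (z y)) =
        (\<Sum>x<n. \<Sum>y<n. Re (z x) * G x y * Re (z y)) + (\<Sum>x<n. \<Sum>y<n. Im (z x) * G x y * Im (z y))"
      by (simp add: sum.distrib)
    then show ?thesis using psd[of "\<lambda>x. Re (z x)"] psd[of "\<lambda>x. Im (z x)"] by simp
  qed
  then obtain r :: nat and U :: "nat \<Rightarrow> nat \<Rightarrow> complex"
    where U: "\<forall>x<n. \<forall>y<n. complex_of_real (G x y) = (\<Sum>i<r. U x i * cnj (U y i))"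
    using psd_gram_factorization[of n "\<lambda>x y. complex_of_real (G x y)"] sym by auto
  define W where "W = (\<lambda>x i. if i < r then Re (U x i) else Im (U x (i - r)))"
  have "G x y = (\<Sum>i<r+r. W x i * W y i)" if "x < n" "y < n" for x y
  proof -
    have "G x y = Re (\<Sum>i<r. U x i * cnj (U y i))"
      using U that by (metis Re_complex_of_real)
    also have "\<dots> = (\<Sum>i<r. W x i * W y i) + (\<Sum>i<r. W x (r + i) * W y (r + i))"
      by (simp add: W_def sum.distrib)
    also have "\<dots> = (\<Sum>i<r+r. W x i * W y i)"
      by (rule sum_lessThan_add[symmetric])
    finally show ?thesis .
  qed
  then show ?thesis by (intro exI[of _ "r + r"] exI[of _ W] allI impI)
qed

section \<open>Rigid correlations\<close>

text \<open>Tsirelson's description of the quantum correlations. Taking the ball rather than the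
  sphere keeps the set stable under orthogonal projection; r is left free because Gram
  factorizations change it.\<close>

definition vec_corr :: "nat \<Rightarrow> nat \<Rightarrow> (nat \<Rightarrow> nat \<Rightarrow> real) \<Rightarrow> bool" where
  "vec_corr n m c \<longleftrightarrow> (\<exists>(r::nat) U V.
     (\<forall>x<n. (\<Sum>i<r. (U x i)\<^sup>2) \<le> 1) \<and> (\<forall>y<m. (\<Sum>i<r. (V y i)\<^sup>2) \<le> 1) \<and>
     (\<forall>x<n. \<forall>y<m. c x y = (\<Sum>i<r. U x i * V y i)))"

text \<open>Extremality in midpoint form, expressed through vectors: the perturbation arguments
  always move c by e and by -e together.\<close>

definition rigid :: "nat \<Rightarrow> nat \<Rightarrow> (nat \<Rightarrow> nat \<Rightarrow> real) \<Rightarrow> bool" where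
  "rigid n m c \<longleftrightarrow> (\<forall>e. vec_corr n m (\<lambda>x y. c x y + e x y) \<and> vec_corr n m (\<lambda>x y. c x y - e x y) \<longrightarrow>
     (\<forall>x<n. \<forall>y<m. e x y = 0))"

lemma vec_corrI:
  fixes r :: nat
  assumes "\<And>x. x < n \<Longrightarrow> (\<Sum>i<r. (U x i)\<^sup>2) \<le> 1" "\<And>y. y < m \<Longrightarrow> (\<Sum>i<r. (V y i)\<^sup>2) \<le> 1"
    and "\<And>x y. x < n \<Longrightarrow> y < m \<Longrightarrow> c x y = (\<Sum>i<r. U x i * V y i)"
  shows "vec_corr n m c"
  unfolding vec_corr_def using assms by (intro exI[of _ r] exI[of _ U] exI[of _ V]) auto

lemma vec_corr_transpose: "vec_corr n m c \<Longrightarrow> vec_corr m n (\<lambda>y x. c x y)"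
  unfolding vec_corr_def
  by (elim exE conjE, rule vec_corrI[unfolded vec_corr_def]) (auto simp: mult.commute)

lemma rigid_transpose:
  assumes "rigid n m c"
  shows "rigid m n (\<lambda>y x. c x y)"
  unfolding rigid_def
proof (intro allI impI; elim conjE)
  fix e y x
  assume e: "vec_corr m n (\<lambda>y x. c x y + e y x)" "vec_corr m n (\<lambda>y x. c x y - e y x)" and "y < m" "x < n"
  show "e y x = 0"
    using assms[unfolded rigid_def, rule_format, of "\<lambda>x y. e y x"]
      vec_corr_transpose[OF e(1)] vec_corr_transpose[OF e(2)] \<open>y < m\<close> \<open>x < n\<close> by blast
qed

lemma inner_orthonormal_expansion:
  fixes u v :: "'a::real_inner"
  assumes "u = (\<Sum>i<r. inner u (g i) *\<^sub>R g i)"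
  shows "inner u v = (\<Sum>i<(r::nat). inner u (g i) * inner v (g i))"
proof -
  have "inner u v = inner (\<Sum>i<r. inner u (g i) *\<^sub>R g i) v"
    using assms by (rule arg_cong)
  also have "\<dots> = (\<Sum>i<r. inner u (g i) * inner (g i) v)" by (simp add: inner_sum_left)
  finally show ?thesis by (simp only: inner_commute[of _ v])
qed

text \<open>Projecting onto the span of the \<open>u x\<close> keeps all inner products with them
  and only shortens the \<open>v y\<close>, so finitely many coordinates suffice in any inner
  product space.\<close>

lemma vec_corr_inner:
  fixes u v :: "nat \<Rightarrow> 'a::real_inner"
  assumes u: "\<And>x. x < n \<Longrightarrow> inner (u x) (u x) \<le> 1" and v: "\<And>y. y < m \<Longrightarrow> inner (v y) (v y) \<le> 1"
    and c: "\<And>x y. x < n \<Longrightarrow> y < m \<Longrightarrow> c x y = inner (u x) (v y)"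
  shows "vec_corr n m c"
proof -
  obtain r :: nat and g where o: "\<forall>i<r. \<forall>j<r. inner (g i) (g j) = (if i = j then 1 else 0)"
    and e: "\<forall>x<n. u x = (\<Sum>i<r. inner (u x) (g i) *\<^sub>R g i)"
    using orthonormal_family_exists[of u n] by (elim exE conjE) (rule that; assumption)
  have b: "(\<Sum>i<r. (inner w (g i))\<^sup>2) \<le> inner w w" for w
    using norm_eq_orthonormal_expansion[OF o, of w] by simp
  show ?thesis
  proof (rule vec_corrI[where r = r and U = "\<lambda>x i. inner (u x) (g i)" and V = "\<lambda>y i. inner (v y) (g i)"])
    show "(\<Sum>i<r. (inner (u x) (g i))\<^sup>2) \<le> 1" if "x < n" for x
      using b[of "u x"] u[OF that] by linarith
    show "(\<Sum>i<r. (inner (v y) (g i))\<^sup>2) \<le> 1" if "y < m" for y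
      using b[of "v y"] v[OF that] by linarith
    show "c x y = (\<Sum>i<r. inner (u x) (g i) * inner (v y) (g i))" if "x < n" "y < m" for x y
      unfolding c[OF that] by (rule inner_orthonormal_expansion[OF e[rule_format, OF that(1)]])
  qed
qed

text \<open>The slack 1 - |a|^2 is 3 d, and a step of size d along a vector of the unit ball fits
  into it: the cross term costs at most d (|a|^2 + |w|^2) by the arithmetic-geometric mean
  inequality, which leaves the bound 1 - d - 2 d^2.\<close>

lemma sum_perturbed_squares_le_1:
  fixes a w :: "nat \<Rightarrow> real"
  assumes "(\<Sum>i<r. (w i)\<^sup>2) \<le> 1" and "\<bar>t\<bar> = d" "d = (1 - (\<Sum>i<r. (a i)\<^sup>2)) / 3" "0 \<le> d"
  shows "(\<Sum>i<r. (a i + t * w i)\<^sup>2) \<le> 1"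
proof -
  let ?A = "\<Sum>i<r. (a i)\<^sup>2" and ?W = "\<Sum>i<r. (w i)\<^sup>2"
  have t2: "t\<^sup>2 = d\<^sup>2" using assms(2) by (metis power2_abs)
  have "(a i + t * w i)\<^sup>2 \<le> (1 + d) * (a i)\<^sup>2 + (d + d\<^sup>2) * (w i)\<^sup>2" for i
  proof -
    have "2 * (a i * (t * w i)) \<le> \<bar>t\<bar> * (2 * \<bar>a i\<bar> * \<bar>w i\<bar>)"
      using abs_ge_self[of "2 * (a i * (t * w i))"] by (simp add: abs_mult mult_ac)
    also have "\<dots> \<le> \<bar>t\<bar> * ((a i)\<^sup>2 + (w i)\<^sup>2)"
      using sum_squares_bound[of "\<bar>a i\<bar>" "\<bar>w i\<bar>"] by (intro mult_left_mono) auto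
    finally show ?thesis
      unfolding assms(2) by (simp add: power2_sum power_mult_distrib t2 algebra_simps)
  qed
  then have "(\<Sum>i<r. (a i + t * w i)\<^sup>2) \<le> (\<Sum>i<r. (1 + d) * (a i)\<^sup>2 + (d + d\<^sup>2) * (w i)\<^sup>2)"
    by (intro sum_mono)
  also have "\<dots> = (1 + d) * ?A + (d + d\<^sup>2) * ?W" by (simp add: sum.distrib sum_distrib_left)
  also have "\<dots> \<le> (1 + d) * ?A + (d + d\<^sup>2) * 1"
    using assms by (intro add_left_mono mult_left_mono) auto
  also have "?A = 1 - 3 * d" using assms(3) by simp
  also have "(1 + d) * (1 - 3 * d) + (d + d\<^sup>2) * 1 = 1 - d - 2 * d\<^sup>2" 
    by (simp add: algebra_simps power2_eq_square)
  also have "\<dots> \<le> 1" using assms(4) zero_le_power2[of d] by linarith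
  finally show ?thesis .
qed

text \<open>If some v(y) had a component of length below 1 in the span of the u(x), it could be
  moved in both directions without leaving the unit ball.\<close>
lemma rigid_in_span:
  fixes u v :: "nat \<Rightarrow> 'a::real_inner"
  assumes rigid: "rigid n m c"
    and u: "\<And>x. x < n \<Longrightarrow> inner (u x) (u x) \<le> 1" and v: "\<And>y. y < m \<Longrightarrow> inner (v y) (v y) \<le> 1"
    and c: "\<And>x y. x < n \<Longrightarrow> y < m \<Longrightarrow> c x y = inner (u x) (v y)"
    and x0: "x0 < n" "u x0 \<noteq> 0" and y0: "y0 < m"
  shows "inner (v y0) (v y0) = 1 \<and> v y0 \<in> span (u ` {..<n})"
proof -
  obtain r :: nat and g where s: "\<forall>i<r. g i \<in> span (u ` {..<n})"
    and o: "\<forall>i<r. \<forall>j<r. inner (g i) (g j) = (if i = j then 1 else 0)"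
    and e: "\<forall>x<n. u x = (\<Sum>i<r. inner (u x) (g i) *\<^sub>R g i)"
    using orthonormal_family_exists[of u n] by (elim exE conjE) (rule that; assumption)
  define U where "U = (\<lambda>x i. inner (u x) (g i))"
  define V where "V = (\<lambda>y i. inner (v y) (g i))"
  have b: "(\<Sum>i<r. (inner w (g i))\<^sup>2) \<le> inner w w" for w
    using norm_eq_orthonormal_expansion[OF o, of w] by simp
  have U: "(\<Sum>i<r. (U x i)\<^sup>2) \<le> 1" if "x < n" for x
    using b[of "u x"] u[OF that] unfolding U_def by linarith
  have V: "(\<Sum>i<r. (V y i)\<^sup>2) \<le> 1" if "y < m" for y
    using b[of "v y"] v[OF that] unfolding V_def by linarith
  have uu: "inner (u x) w = (\<Sum>i<r. U x i * inner w (g i))" if "x < n" for x w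
    unfolding U_def by (rule inner_orthonormal_expansion[OF e[rule_format, OF that]])
  have cUV: "c x y = (\<Sum>i<r. U x i * V y i)" if "x < n" "y < m" for x y
    using c[OF that] uu[OF that(1)] by (simp add: V_def)
  have one: "(\<Sum>i<r. (V y0 i)\<^sup>2) = 1"
  proof (rule ccontr)
    assume "(\<Sum>i<r. (V y0 i)\<^sup>2) \<noteq> 1"
    define d where "d = (1 - (\<Sum>i<r. (V y0 i)\<^sup>2)) / 3"
    have d: "0 < d" using V[OF y0] \<open>_ \<noteq> 1\<close> by (simp add: d_def)
    \<comment> \<open>Only column y0 changes, by moving its vector along \<open>u x0\<close>. The
      change in row x0 is d times the squared length of \<open>u x0\<close>, hence nonzero.\<close>
    define f where "f = (\<lambda>x y. if y = y0 then d * (\<Sum>i<r. U x i * U x0 i) else 0)"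
    have pert: "vec_corr n m (\<lambda>x y. c x y + s * f x y)" if "\<bar>s\<bar> = 1" for s
    proof (rule vec_corrI[where r = r and U = U and V = "\<lambda>y i. if y = y0 then V y i + (s * d) * U x0 i else V y i"])
      show "(\<Sum>i<r. (if y = y0 then V y i + (s * d) * U x0 i else V y i)\<^sup>2) \<le> 1" if "y < m" for y
      proof (cases "y = y0")
        case True
        have "(\<Sum>i<r. (V y0 i + (s * d) * U x0 i)\<^sup>2) \<le> 1"
          using U[OF x0(1)] \<open>\<bar>s\<bar> = 1\<close> d
          by (intro sum_perturbed_squares_le_1[of _ _ _ d]) (auto simp: d_def abs_mult)
        then show ?thesis using True by simp
      qed (use V[OF that] in simp)
      show "c x y + s * f x y = (\<Sum>i<r. U x i * (if y = y0 then V y i + (s * d) * U x0 i else V y i))"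
        if "x < n" "y < m" for x y
        using cUV[OF that] by (simp add: f_def distrib_left sum.distrib sum_distrib_left mult_ac)
    qed (rule U)
    have "f x0 y0 = 0"
      using rigid[unfolded rigid_def, rule_format, of f x0 y0] pert[of 1] pert[of "-1"] x0(1) y0 by simp
    moreover have "f x0 y0 = d * inner (u x0) (u x0)"
      using uu[OF x0(1), of "u x0"] by (simp add: f_def U_def)
    ultimately show False using d x0(2) by simp
  qed
  \<comment> \<open>The projection already has length 1 while \<open>v y0\<close> has length at most
    1, so nothing is left outside the span.\<close>
  have E: "inner (v y0) (v y0) = 1 + (norm (v y0 - (\<Sum>i<r. V y0 i *\<^sub>R g i)))\<^sup>2"
    using norm_eq_orthonormal_expansion[OF o, of "v y0"] one unfolding V_def by simp
  then have "(norm (v y0 - (\<Sum>i<r. V y0 i *\<^sub>R g i)))\<^sup>2 = 0"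
    using v[OF y0] by (intro antisym) auto
  then have "v y0 = (\<Sum>i<r. V y0 i *\<^sub>R g i)" by simp
  moreover have "(\<Sum>i<r. V y0 i *\<^sub>R g i) \<in> span (u ` {..<n})"
    using s by (intro span_sum span_scale) auto
  ultimately show ?thesis using E by simp
qed

text \<open>Replacing the Gram matrix 1 of an orthonormal basis by 1 + eps Q keeps all vectors at unit
  length, so a form Q that is isotropic on all of them perturbs c in both directions.\<close>
lemma rigid_isotropic_form:
  fixes U V Q :: "nat \<Rightarrow> nat \<Rightarrow> real" and r :: nat
  assumes rigid: "rigid n m c"
    and c: "\<And>x y. x < n \<Longrightarrow> y < m \<Longrightarrow> c x y = (\<Sum>i<r. U x i * V y i)"
    and U: "\<And>x. x < n \<Longrightarrow> (\<Sum>i<r. (U x i)\<^sup>2) \<le> 1" and V: "\<And>y. y < m \<Longrightarrow> (\<Sum>i<r. (V y i)\<^sup>2) \<le> 1"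
    and sym: "\<And>i j. Q i j = Q j i"
    and QU: "\<And>x. x < n \<Longrightarrow> (\<Sum>i<r. \<Sum>j<r. U x i * Q i j * U x j) = 0"
    and QV: "\<And>y. y < m \<Longrightarrow> (\<Sum>i<r. \<Sum>j<r. V y i * Q i j * V y j) = 0"
    and xy: "x < n" "y < m"
  shows "(\<Sum>i<r. \<Sum>j<r. U x i * Q i j * V y j) = 0"
proof -
  define K where "K = (\<Sum>i<r. \<Sum>j<r. \<bar>Q i j\<bar>)"
  \<comment> \<open>K bounds the form Q against the squared length, so d K \<le> 1 keeps both 1 + d
    Q and 1 - d Q positive semidefinite and thus Gram matrices.\<close>
  define d where "d = 1 / (1 + K)"
  have K: "0 \<le> K" unfolding K_def by (intro sum_nonneg) auto
  have d: "0 < d" "d * K \<le> 1" using K by (auto simp: d_def field_simps)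
  have bound: "\<bar>\<Sum>i<r. \<Sum>j<r. z i * Q i j * z j\<bar> \<le> K * (\<Sum>i<r. (z i)\<^sup>2)" for z
  proof -
    have "\<bar>\<Sum>i<r. \<Sum>j<r. z i * Q i j * z j\<bar> \<le> (\<Sum>i<r. \<Sum>j<r. \<bar>z i * Q i j * z j\<bar>)"
      by (rule order_trans[OF sum_abs]) (intro sum_mono sum_abs)
    also have "\<dots> \<le> (\<Sum>i<r. \<Sum>j<r. \<bar>Q i j\<bar> * (\<Sum>k<r. (z k)\<^sup>2))"
    proof (intro sum_mono)
      fix i j assume ij: "i \<in> {..<r}" "j \<in> {..<r}"
      have sq: "(z k)\<^sup>2 \<le> (\<Sum>k<r. (z k)\<^sup>2)" if "k \<in> {..<r}" for k
        using that by (intro member_le_sum) auto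
      have "\<bar>z i\<bar> * \<bar>z j\<bar> \<le> (\<Sum>k<r. (z k)\<^sup>2)"
        using sum_squares_bound[of "\<bar>z i\<bar>" "\<bar>z j\<bar>"] sq[OF ij(1)] sq[OF ij(2)] by simp
      then have "\<bar>Q i j\<bar> * (\<bar>z i\<bar> * \<bar>z j\<bar>) \<le> \<bar>Q i j\<bar> * (\<Sum>k<r. (z k)\<^sup>2)"
        by (rule mult_left_mono) simp
      then show "\<bar>z i * Q i j * z j\<bar> \<le> \<bar>Q i j\<bar> * (\<Sum>k<r. (z k)\<^sup>2)"
        by (simp add: abs_mult mult_ac)
    qed
    finally show ?thesis by (simp add: K_def sum_distrib_right)
  qed
  have pert: "vec_corr n m (\<lambda>x y. c x y + s * (d * (\<Sum>i<r. \<Sum>j<r. U x i * Q i j * V y j)))"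
    if s: "\<bar>s\<bar> = 1" for s
  proof -
    define G where "G = (\<lambda>i j. (if i = j then 1 else 0) + s * d * Q i j)"
    have GG: "(\<Sum>i<r. \<Sum>j<r. z i * G i j * w j) = (\<Sum>i<r. z i * w i) + s * (d * (\<Sum>i<r. \<Sum>j<r. z i * Q i j * w j))"
      for z w :: "nat \<Rightarrow> real"
    proof -
      have "(\<Sum>i<r. \<Sum>j<r. z i * G i j * w j) =
          (\<Sum>i<r. \<Sum>j<r. (if j = i then z i * w i else 0) + s * (d * (z i * Q i j * w j)))"
        by (intro sum.cong refl) (auto simp: G_def algebra_simps)
      then show ?thesis by (simp add: sum.distrib sum_distrib_left)
    qed
    have "0 \<le> (\<Sum>i<r. \<Sum>j<r. z i * G i j * z j)" for z
    proof -
      have "\<bar>s * (d * (\<Sum>i<r. \<Sum>j<r. z i * Q i j * z j))\<bar> \<le> d * (K * (\<Sum>i<r. (z i)\<^sup>2))"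
        using bound[of z] d(1) s by (simp add: abs_mult)
      also have "\<dots> \<le> 1 * (\<Sum>i<r. (z i)\<^sup>2)"
        unfolding mult.assoc[symmetric] using d(2) by (intro mult_right_mono sum_nonneg) auto
      finally show ?thesis unfolding GG by (simp add: power2_eq_square)
    qed
    moreover have "G j i = G i j" for i j using sym[of i j] by (simp add: G_def)
    ultimately obtain k :: nat and L where L: "\<forall>i<r. \<forall>j<r. G i j = (\<Sum>l<k. L i l * L j l)"
      using real_psd_gram_factorization[of r G] by blast
    have gram: "(\<Sum>l<k. (\<Sum>i<r. z i * L i l) * (\<Sum>j<r. w j * L j l)) = (\<Sum>i<r. \<Sum>j<r. z i * G i j * w j)"
      for z w
    proof -
      have "(\<Sum>l<k. (\<Sum>i<r. z i * L i l) * (\<Sum>j<r. w j * L j l)) =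
          (\<Sum>l<k. \<Sum>i<r. \<Sum>j<r. z i * w j * (L i l * L j l))"
        unfolding sum_product by (intro sum.cong refl) (simp add: mult_ac)
      also have "\<dots> = (\<Sum>i<r. \<Sum>l<k. \<Sum>j<r. z i * w j * (L i l * L j l))" by (rule sum.swap)
      also have "\<dots> = (\<Sum>i<r. \<Sum>j<r. \<Sum>l<k. z i * w j * (L i l * L j l))"
        by (rule sum.cong[OF refl], rule sum.swap)
      also have "\<dots> = (\<Sum>i<r. \<Sum>j<r. z i * G i j * w j)"
        using L by (intro sum.cong refl) (simp add: sum_distrib_left[symmetric] mult_ac)
      finally show ?thesis .
    qed
    show ?thesis
    proof (rule vec_corrI[where r = k and U = "\<lambda>x l. \<Sum>i<r. U x i * L i l" and V = "\<lambda>y l. \<Sum>i<r. V y i * L i l"])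
      show "(\<Sum>l<k. (\<Sum>i<r. U x i * L i l)\<^sup>2) \<le> 1" if "x < n" for x
        using U[OF that] QU[OF that] unfolding power2_eq_square gram GG by simp
      show "(\<Sum>l<k. (\<Sum>i<r. V y i * L i l)\<^sup>2) \<le> 1" if "y < m" for y
        using V[OF that] QV[OF that] unfolding power2_eq_square gram GG by simp
    qed (simp add: gram GG c)
  qed
  have "d * (\<Sum>i<r. \<Sum>j<r. U x i * Q i j * V y j) = 0"
    using rigid[unfolded rigid_def, rule_format, of "\<lambda>x y. d * (\<Sum>i<r. \<Sum>j<r. U x i * Q i j * V y j)" x y]
      pert[of 1] pert[of "-1"] xy by simp
  then show ?thesis using d(1) by simp
qed

section \<open>Clifford relations\<close>

text \<open>Self-adjointness turns the cross term of |T T X - X|^2 into |T X|^2 = |X|^2; what is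
  left is |T T X|^2 - |X|^2, which a contraction makes at most 0.\<close>

lemma selfadjoint_contraction_involution:
  fixes T :: "'a::real_inner \<Rightarrow> 'a"
  assumes sa: "\<And>X Y. inner (T X) Y = inner X (T Y)" and contr: "\<And>X. norm (T X) \<le> norm X"
    and eq: "norm (T X) = norm X"
  shows "T (T X) = X"
proof -
  have "(norm (T (T X) - X))\<^sup>2 = (norm (T (T X)))\<^sup>2 - 2 * inner (T (T X)) X + (norm X)\<^sup>2"
    unfolding power2_norm_eq_inner by (simp add: inner_diff inner_commute)
  also have "inner (T (T X)) X = (norm X)\<^sup>2"
    unfolding sa eq[symmetric] power2_norm_eq_inner ..
  also have "(norm (T (T X)))\<^sup>2 - 2 * (norm X)\<^sup>2 + (norm X)\<^sup>2 \<le> 0"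
    using contr[of "T X"] eq by (simp add: power_mono)
  finally show ?thesis by simp
qed

text \<open>The second conclusion is the bridge to a larger space: at P, Alice's combination acts as
  one of Bob's operators, which commute with everything of Alice's. E is a parameter with a defining
  equation so that the conclusions can speak of it at the obtained coefficients b.\<close>

lemma rigid_clifford_relations:
  fixes M N :: "nat \<Rightarrow> 'a::real_inner \<Rightarrow> 'a"
  assumes rigid: "rigid n m c"
    and linM: "\<And>x. x < n \<Longrightarrow> linear (M x)" and linN: "\<And>y. y < m \<Longrightarrow> linear (N y)"
    and saM: "\<And>x X Y. x < n \<Longrightarrow> inner (M x X) Y = inner X (M x Y)"
    and saN: "\<And>y X Y. y < m \<Longrightarrow> inner (N y X) Y = inner X (N y Y)"
    and cM: "\<And>x X. x < n \<Longrightarrow> norm (M x X) \<le> norm X" and cN: "\<And>y X. y < m \<Longrightarrow> norm (N y X) \<le> norm X"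
    and comm: "\<And>x y X. x < n \<Longrightarrow> y < m \<Longrightarrow> M x (N y X) = N y (M x X)"
    and P: "norm P = 1"
    and c: "\<And>x y. x < n \<Longrightarrow> y < m \<Longrightarrow> c x y = inner (M x P) (N y P)"
    and E_def: "E = (\<lambda>b i X. \<Sum>x<n. b i x *\<^sub>R M x X)"
  obtains r :: nat and U V a b where
    "\<And>x y. x < n \<Longrightarrow> y < m \<Longrightarrow> c x y = (\<Sum>i<r. U x i * V y i)"
    "\<And>i. i < r \<Longrightarrow> E b i P = (\<Sum>y<m. a i y *\<^sub>R N y P)"
    "\<And>i j. i < r \<Longrightarrow> j < r \<Longrightarrow> E b i (E b j P) + E b j (E b i P) = (if i = j then 2 *\<^sub>R P else 0)"
proof (cases "\<forall>x<n. \<forall>y<m. c x y = 0")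
  case True
  \<comment> \<open>With c = 0 there need be no nonzero vector to start the span argument from; the
    empty factorization serves.\<close>
  then show ?thesis by (intro that[where r = 0]) auto
next
  case False
  then obtain x0 y0 where xy0: "x0 < n" "y0 < m" "c x0 y0 \<noteq> 0" by blast
  define u where "u = (\<lambda>x. M x P)"
  define v where "v = (\<lambda>y. N y P)"
  have u1: "inner (u x) (u x) \<le> 1" if "x < n" for x
    using cM[OF that, of P] P by (simp add: u_def norm_eq_sqrt_inner)
  have v1: "inner (v y) (v y) \<le> 1" if "y < m" for y
    using cN[OF that, of P] P by (simp add: v_def norm_eq_sqrt_inner)
  have cuv: "c x y = inner (u x) (v y)" if "x < n" "y < m" for x y
    using c[OF that] by (simp add: u_def v_def)
  have nz: "u x0 \<noteq> 0" "v y0 \<noteq> 0" using cuv[OF xy0(1,2)] xy0(3) by auto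
  have v_span: "inner (v y) (v y) = 1 \<and> v y \<in> span (u ` {..<n})" if "y < m" for y
    by (rule rigid_in_span[OF rigid u1 v1 cuv xy0(1) nz(1) that])
  have u_span: "inner (u x) (u x) = 1 \<and> u x \<in> span (v ` {..<m})" if "x < n" for x
    by (rule rigid_in_span[where u = v and v = u and ?x0.0 = y0, OF rigid_transpose[OF rigid]])
      (use v1 u1 xy0 nz that in \<open>simp_all add: cuv inner_commute\<close>)
  obtain r :: nat and g where g_span: "\<forall>i<r. g i \<in> span (u ` {..<n})"
    and o: "\<forall>i<r. \<forall>j<r. inner (g i) (g j) = (if i = j then 1 else 0)"
    and e: "\<forall>x<n. u x = (\<Sum>i<r. inner (u x) (g i) *\<^sub>R g i)"
    using orthonormal_family_exists[of u n] by (elim exE conjE) (rule that; assumption)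
  \<comment> \<open>Rigidity of c and of its transpose makes the two spans equal, so each basis
    vector is reached from P both by Alice's and by Bob's operators.\<close>
  have "span (u ` {..<n}) \<subseteq> span (v ` {..<m})"
    using u_span by (intro span_minimal subspace_span) auto
  then have g_span': "\<forall>i<r. g i \<in> span (v ` {..<m})" using g_span by blast
  have "\<forall>i. \<exists>bi. i < r \<longrightarrow> g i = (\<Sum>x<n. bi x *\<^sub>R u x)"
    using g_span span_image_lessThan_sum by metis
  then obtain b where b: "g i = (\<Sum>x<n. b i x *\<^sub>R u x)" if "i < r" for i by metis
  have "\<forall>i. \<exists>ai. i < r \<longrightarrow> g i = (\<Sum>y<m. ai y *\<^sub>R v y)"
    using g_span' span_image_lessThan_sum by metis
  then obtain a where a: "g i = (\<Sum>y<m. a i y *\<^sub>R v y)" if "i < r" for i by metis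
  define U where "U = (\<lambda>x i. inner (u x) (g i))"
  define V where "V = (\<lambda>y i. inner (v y) (g i))"
  have eu: "u x = (\<Sum>i<r. U x i *\<^sub>R g i)" if "x < n" for x
    unfolding U_def using e that by (elim allE impE)
  have ev: "v y = (\<Sum>i<r. V y i *\<^sub>R g i)" if "y < m" for y
    unfolding V_def
  proof (rule linear_eq_on_span[where f = "\<lambda>w. w" and g = "\<lambda>w. \<Sum>i<r. inner w (g i) *\<^sub>R g i" and B = "u ` {..<n}"])
    show "linear (\<lambda>w. \<Sum>i<r. inner w (g i) *\<^sub>R g i)"
      by (intro linearI) (simp_all add: inner_add_left scaleR_add_left sum.distrib scaleR_sum_right)
    show "v y \<in> span (u ` {..<n})" using v_span[OF that] ..
    show "w = (\<Sum>i<r. inner w (g i) *\<^sub>R g i)" if "w \<in> u ` {..<n}" for w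
      using that eu unfolding U_def by blast
  qed (simp add: linear_ident)
  have U2: "(\<Sum>i<r. (U x i)\<^sup>2) = 1" if "x < n" for x
    using norm_eq_orthonormal_expansion[OF o, of "u x"] eu[OF that] u_span[OF that]
    unfolding U_def by simp
  have V2: "(\<Sum>i<r. (V y i)\<^sup>2) = 1" if "y < m" for y
    using norm_eq_orthonormal_expansion[OF o, of "v y"] ev[OF that] v_span[OF that]
    unfolding V_def by simp
  have cUV: "c x y = (\<Sum>i<r. U x i * V y i)" if "x < n" "y < m" for x y
    unfolding cuv[OF that] U_def V_def
    by (rule inner_orthonormal_expansion) (use eu[OF that(1)] in \<open>simp only: U_def\<close>)

  \<comment> \<open>\<open>A i\<close> and \<open>B i\<close> both send P to \<open>g i\<close> but
    belong to different parties, so they commute. This gives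
    \<open>B i (g j) = A j (g i)\<close>.\<close>
  define A where "A = (\<lambda>i X. \<Sum>x<n. b i x *\<^sub>R M x X)"
  define B where "B = (\<lambda>i X. \<Sum>y<m. a i y *\<^sub>R N y X)"
  have AP: "A i P = g i" and BP: "B i P = g i" if "i < r" for i
    using b[OF that] a[OF that] by (simp_all add: A_def B_def u_def v_def)
  have linA: "linear (A i)" for i
    unfolding A_def by (intro linear_compose_sum ballI linear_compose_scale_right linM) auto
  have linB: "linear (B i)" for i
    unfolding B_def by (intro linear_compose_sum ballI linear_compose_scale_right linN) auto
  have MB: "M x (B i X) = B i (M x X)" if "x < n" for x i X
    using that by (simp add: B_def linear_sum[OF linM] linear_cmul[OF linM] comm)
  have NA: "N y (A i X) = A i (N y X)" if "y < m" for y i X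
    using that by (simp add: A_def linear_sum[OF linN] linear_cmul[OF linN] comm)
  have BA: "B i (A j X) = A j (B i X)" for i j X
    unfolding B_def by (simp add: NA linear_sum[OF linA] linear_cmul[OF linA])
  have MM: "M x (M x P) = P" if "x < n" for x
    by (rule selfadjoint_contraction_involution[of "M x", OF saM[OF that] cM[OF that]])
      (use u_span[OF that] P in \<open>simp add: u_def norm_eq_sqrt_inner\<close>)
  have NN: "N y (N y P) = P" if "y < m" for y
    by (rule selfadjoint_contraction_involution[of "N y", OF saN[OF that] cN[OF that]])
      (use v_span[OF that] P in \<open>simp add: v_def norm_eq_sqrt_inner\<close>)
  \<comment> \<open>The identity \<open>M x (M x P) = P\<close> in coordinates: writing
    \<open>g i\<close> as \<open>B i P\<close> lets \<open>M x\<close> pass through, so only the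
    coordinates of \<open>u x\<close> and the fixed vectors \<open>A j (g i)\<close> remain. Bob's
    squares give the same form in the coordinates of \<open>v y\<close>, which is why one defect
    serves both parties.\<close>
  have MM': "P = (\<Sum>i<r. \<Sum>j<r. (U x i * U x j) *\<^sub>R A j (g i))" if "x < n" for x
  proof -
    have "P = M x (u x)" using MM[OF that] by (simp add: u_def)
    also have "\<dots> = (\<Sum>i<r. U x i *\<^sub>R M x (g i))"
      by (subst eu[OF that]) (simp add: linear_sum[OF linM] linear_cmul[OF linM] that)
    also have "\<dots> = (\<Sum>i<r. U x i *\<^sub>R B i (u x))"
      using that by (intro sum.cong refl) (simp add: BP[symmetric] MB u_def)
    also have "\<dots> = (\<Sum>i<r. U x i *\<^sub>R (\<Sum>j<r. U x j *\<^sub>R B i (g j)))"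
      by (subst eu[OF that]) (simp add: linear_sum[OF linB] linear_cmul[OF linB])
    also have "\<dots> = (\<Sum>i<r. \<Sum>j<r. (U x i * U x j) *\<^sub>R A j (g i))"
    proof -
      have "B i (g j) = A j (g i)" if "i < r" "j < r" for i j
        using BA[of i j P] by (simp add: AP BP that)
      then show ?thesis by (simp add: scaleR_sum_right)
    qed
    finally show ?thesis .
  qed
  have NN': "P = (\<Sum>i<r. \<Sum>j<r. (V y j * V y i) *\<^sub>R A j (g i))" if "y < m" for y
  proof -
    have "P = N y (v y)" using NN[OF that] by (simp add: v_def)
    also have "\<dots> = (\<Sum>j<r. V y j *\<^sub>R N y (g j))"
      by (subst ev[OF that]) (simp add: linear_sum[OF linN] linear_cmul[OF linN] that)
    also have "\<dots> = (\<Sum>j<r. V y j *\<^sub>R A j (v y))"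
      using that by (intro sum.cong refl) (simp add: AP[symmetric] NA v_def)
    also have "\<dots> = (\<Sum>j<r. V y j *\<^sub>R (\<Sum>i<r. V y i *\<^sub>R A j (g i)))"
      by (subst ev[OF that]) (simp add: linear_sum[OF linA] linear_cmul[OF linA])
    also have "\<dots> = (\<Sum>j<r. \<Sum>i<r. (V y j * V y i) *\<^sub>R A j (g i))"
      by (simp add: scaleR_sum_right)
    also have "\<dots> = (\<Sum>i<r. \<Sum>j<r. (V y j * V y i) *\<^sub>R A j (g i))" by (rule sum.swap)
    finally show ?thesis .
  qed

  have rel: "A k (g l) + A l (g k) = (if k = l then 2 *\<^sub>R P else 0)" if kl: "k < r" "l < r" for k l
  proof -
    \<comment> \<open>The defect of the Clifford relations at P; it is isotropic on the vectors u(x) and v(y) because the squares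
      of M(x) and N(y) fix P.\<close>
    define D where "D = (\<lambda>i j. A i (g j) + A j (g i) - (if i = j then 2 *\<^sub>R P else 0))"
    \<comment> \<open>Pairing with the fixed vector \<open>D k l\<close> turns the vector-valued
      form into a scalar one, and \<open>Q k l\<close> becomes the squared length of
      \<open>D k l\<close>.\<close>
    define Q where "Q = (\<lambda>i j. inner (D i j) (D k l))"
    have isotropic: "(\<Sum>i<r. \<Sum>j<r. w i * Q i j * w j) = 0"
      if w: "P = (\<Sum>i<r. \<Sum>j<r. (w i * w j) *\<^sub>R A j (g i))" "(\<Sum>i<r. (w i)\<^sup>2) = 1" for w
    proof -
      have "(\<Sum>i<r. \<Sum>j<r. (w i * w j) *\<^sub>R D i j) =
          (\<Sum>i<r. \<Sum>j<r. (w i * w j) *\<^sub>R A i (g j)) + (\<Sum>i<r. \<Sum>j<r. (w i * w j) *\<^sub>R A j (g i))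
          - (\<Sum>i<r. \<Sum>j<r. if j = i then (w i * w i) *\<^sub>R (2 *\<^sub>R P) else 0)"
        unfolding sum.distrib[symmetric] sum_subtractf[symmetric]
        by (intro sum.cong refl) (simp add: D_def scaleR_add_right scaleR_diff_right)
      also have "(\<Sum>i<r. \<Sum>j<r. (w i * w j) *\<^sub>R A i (g j)) = P"
        by (subst w(1), subst sum.swap) (simp add: mult.commute)
      also have "(\<Sum>i<r. \<Sum>j<r. if j = i then (w i * w i) *\<^sub>R (2 *\<^sub>R P) else 0) = 2 *\<^sub>R P"
        using w(2) by (simp add: scaleR_sum_left[symmetric] sum_distrib_right[symmetric] power2_eq_square)
      also have "(\<Sum>i<r. \<Sum>j<r. (w i * w j) *\<^sub>R A j (g i)) = P" using w(1) ..
      also have "P + P - 2 *\<^sub>R P = 0" by (simp add: scaleR_2)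
      finally have "inner (\<Sum>i<r. \<Sum>j<r. (w i * w j) *\<^sub>R D i j) (D k l) = 0" by simp
      then show ?thesis by (simp add: inner_sum_left Q_def mult_ac)
    qed
    have zero: "(\<Sum>i<r. \<Sum>j<r. U x i * Q i j * V y j) = 0" if "x < n" "y < m" for x y
    proof (rule rigid_isotropic_form[OF rigid cUV _ _ _ _ _ that])
      show "Q i j = Q j i" for i j by (simp add: Q_def D_def add.commute)
      show "(\<Sum>i<r. \<Sum>j<r. U x i * Q i j * U x j) = 0" if "x < n" for x
        by (rule isotropic[OF MM'[OF that] U2[OF that]])
      show "(\<Sum>i<r. \<Sum>j<r. V y i * Q i j * V y j) = 0" if "y < m" for y
        using NN'[OF that] by (intro isotropic V2[OF that]) (simp add: mult.commute)
    qed (simp_all add: U2 V2)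
    \<comment> \<open>Since \<open>g k\<close> is a combination of the \<open>u x\<close> and
      \<open>g l\<close> one of the \<open>v y\<close>, the same combinations of the equations for
      all pairs (x, y) isolate the single coefficient \<open>Q k l\<close>.\<close>
    have bU: "(\<Sum>x<n. b k x * U x i) = (if k = i then 1 else 0)" if "i < r" for i
      using o kl(1) that by (simp add: U_def inner_sum_left[symmetric] inner_scaleR_left[symmetric] b[OF kl(1), symmetric] del: inner_scaleR_left)
    have aV: "(\<Sum>y<m. a l y * V y j) = (if l = j then 1 else 0)" if "j < r" for j
      using o kl(2) that by (simp add: V_def inner_sum_left[symmetric] inner_scaleR_left[symmetric] a[OF kl(2), symmetric] del: inner_scaleR_left)
    have "Q k l = (\<Sum>i<r. \<Sum>j<r. (\<Sum>x<n. b k x * U x i) * Q i j * (\<Sum>y<m. a l y * V y j))"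
    proof -
      have "(\<Sum>i<r. \<Sum>j<r. (\<Sum>x<n. b k x * U x i) * Q i j * (\<Sum>y<m. a l y * V y j)) =
          (\<Sum>i<r. \<Sum>j<r. if j = l then (if i = k then Q k l else 0) else 0)"
        by (intro sum.cong refl) (simp add: bU aV)
      then show ?thesis using kl by simp
    qed
    also have "\<dots> = (\<Sum>i<r. \<Sum>j<r. \<Sum>x<n. \<Sum>y<m. b k x * a l y * (U x i * Q i j * V y j))"
      by (intro sum.cong refl) (simp add: sum_distrib_right sum_distrib_left mult_ac)
    also have "\<dots> = (\<Sum>i<r. \<Sum>x<n. \<Sum>j<r. \<Sum>y<m. b k x * a l y * (U x i * Q i j * V y j))"
      by (rule sum.cong[OF refl], rule sum.swap)
    also have "\<dots> = (\<Sum>x<n. \<Sum>i<r. \<Sum>j<r. \<Sum>y<m. b k x * a l y * (U x i * Q i j * V y j))"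
      by (rule sum.swap)
    also have "\<dots> = (\<Sum>x<n. \<Sum>i<r. \<Sum>y<m. \<Sum>j<r. b k x * a l y * (U x i * Q i j * V y j))"
      by (rule sum.cong[OF refl], rule sum.cong[OF refl], rule sum.swap)
    also have "\<dots> = (\<Sum>x<n. \<Sum>y<m. \<Sum>i<r. \<Sum>j<r. b k x * a l y * (U x i * Q i j * V y j))"
      by (rule sum.cong[OF refl], rule sum.swap)
    also have "\<dots> = 0"
      by (simp add: sum_distrib_left[symmetric] zero)
    finally have "D k l = 0" by (simp add: Q_def)
    then show ?thesis by (simp add: D_def)
  qed
  show ?thesis
  proof (rule that[where r = r and U = U and V = V and b = b and a = a])
    show "E b i P = (\<Sum>y<m. a i y *\<^sub>R N y P)" if "i < r" for i
      using AP[OF that] BP[OF that] by (simp add: E_def A_def B_def)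
    show "E b i (E b j P) + E b j (E b i P) = (if i = j then 2 *\<^sub>R P else 0)" if "i < r" "j < r" for i j
      using rel[OF that] unfolding AP[OF that(1), symmetric] AP[OF that(2), symmetric]
      by (simp add: E_def A_def)
  qed (rule cUV)
qed

text \<open>Induction two generators at a time. For the last two, A and B, the operator Z = J A B is
  a self-adjoint involution on K that commutes with J and with the other generators but anticommutes
  with B. The induction applies to its +1 eigenspace, and B copies the family isometrically into the
  -1 eigenspace, doubling it. The count is over the reals: J turns a single vector into two, hence
  the exponent s + 1.\<close>

lemma clifford_orthogonal_family:
  fixes E :: "nat \<Rightarrow> 'a::real_inner \<Rightarrow> 'a"
  assumes linJ: "linear J" and linE: "\<And>i. i < 2 * s \<Longrightarrow> linear (E i)"
    and JJ: "\<And>X. J (J X) = - X" and skew: "\<And>X Y. inner (J X) Y = - inner X (J Y)"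
    and sa: "\<And>i X Y. i < 2 * s \<Longrightarrow> inner (E i X) Y = inner X (E i Y)"
    and JE: "\<And>i X. i < 2 * s \<Longrightarrow> J (E i X) = E i (J X)"
    and K: "Real_Vector_Spaces.subspace K" "X0 \<in> K" "X0 \<noteq> 0"
    and KJ: "\<And>X. X \<in> K \<Longrightarrow> J X \<in> K" and KE: "\<And>i X. i < 2 * s \<Longrightarrow> X \<in> K \<Longrightarrow> E i X \<in> K"
    and anti: "\<And>i j X. i < 2 * s \<Longrightarrow> j < 2 * s \<Longrightarrow> X \<in> K \<Longrightarrow>
          E i (E j X) + E j (E i X) = (if i = j then 2 *\<^sub>R X else 0)"
  shows "\<exists>F\<subseteq>K. finite F \<and> card F = 2 ^ (s + 1) \<and> 0 \<notin> F \<and> pairwise (\<lambda>X Y. inner X Y = 0) F"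
  using assms
proof (induction s arbitrary: K X0)
  case 0
  have 1: "inner (J X0) X0 = 0" using "0.prems"(4)[of X0 X0] by (simp add: inner_commute)
  have 2: "J X0 \<noteq> 0" using "0.prems"(3)[of X0] "0.prems"(1,9) by (auto simp: linear_0)
  have 3: "X0 \<noteq> J X0" using 1 "0.prems"(9) by force
  show ?case
    using 1 2 3 "0.prems"(8-10) by (intro exI[of _ "{X0, J X0}"]) (auto simp: pairwise_def inner_commute)
next
  case (Suc s)
  define A where "A = E (2 * s)"
  define B where "B = E (2 * s + 1)"
  note linJ = Suc.prems(1) and JJ = Suc.prems(3) and skew = Suc.prems(4) and K = Suc.prems(7-9) and KJ = Suc.prems(10)
    and anti = Suc.prems(12)
  have linA: "linear A" "linear B" using Suc.prems(2) by (simp_all add: A_def B_def)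
  have sa: "inner (A X) Y = inner X (A Y)" "inner (B X) Y = inner X (B Y)" for X Y
    using Suc.prems(5) by (simp_all add: A_def B_def)
  have JA: "J (A X) = A (J X)" "J (B X) = B (J X)" for X
    using Suc.prems(6) by (simp_all add: A_def B_def)
  have KA: "A X \<in> K" "B X \<in> K" if "X \<in> K" for X
    using Suc.prems(11) that by (simp_all add: A_def B_def)
  have AB: "A (B X) = - B (A X)" if "X \<in> K" for X
    using anti[of "2 * s" "2 * s + 1" X] that by (simp add: A_def B_def eq_neg_iff_add_eq_0)
  have AA: "A (A X) = X" "B (B X) = X" if "X \<in> K" for X
    using anti[of "2 * s" "2 * s" X] anti[of "2 * s + 1" "2 * s + 1" X] that
    by (simp_all add: A_def B_def scaleR_2[symmetric] del: scaleR_2)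
  have EA: "E i (A X) = - A (E i X)" "E i (B X) = - B (E i X)" if "i < 2 * s" "X \<in> K" for i X
    using anti[of i "2 * s" X] anti[of i "2 * s + 1" X] that
    by (simp_all add: A_def B_def eq_neg_iff_add_eq_0)
  \<comment> \<open>The square of A B is -1 on K; the factor J corrects this to +1 and makes the
    product self-adjoint there.\<close>
  define Z where "Z = (\<lambda>X. J (A (B X)))"
  have linZ: "linear Z" unfolding Z_def
    using linJ linA linear_compose[of B A] linear_compose[of "A \<circ> B" J] by (simp add: o_def)
  have KZ: "Z X \<in> K" if "X \<in> K" for X using that by (simp add: Z_def KA KJ)
  have ZZ: "Z (Z X) = X" if "X \<in> K" for X
  proof -
    have "Z (Z X) = J (J (A (B (A (B X)))))" by (simp add: Z_def JA)
    also have "\<dots> = - A (B (A (B X)))" by (rule JJ)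
    also have "\<dots> = B (A (A (B X)))" using AB[of "A (B X)"] that by (simp add: KA)
    also have "\<dots> = X" using that by (simp add: KA AA)
    finally show ?thesis .
  qed
  have saZ: "inner (Z X) Y = inner X (Z Y)" if "Y \<in> K" for X Y
  proof -
    have "inner (Z X) Y = - inner X (B (A (J Y)))" by (simp add: Z_def skew sa)
    also have "B (A (J Y)) = - A (B (J Y))" using AB[of "J Y"] that by (simp add: KJ)
    finally show ?thesis by (simp add: Z_def JA)
  qed
  have ZB: "Z (B X) = - B (Z X)" if "X \<in> K" for X
  proof -
    have "Z (B X) = J (- B (A (B X)))" using AB[OF KA(2)[OF that]] by (simp add: Z_def)
    also have "\<dots> = - B (Z X)" by (simp add: Z_def linear_neg[OF linJ] JA)
    finally show ?thesis .
  qed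
  have ZE: "Z (E i X) = E i (Z X)" if "i < 2 * s" "X \<in> K" for i X
  proof -
    have iX: "E i X \<in> K" using Suc.prems(11) that by simp
    have "E i (Z X) = J (E i (A (B X)))" unfolding Z_def using Suc.prems(6)[of i] that by simp
    also have "E i (A (B X)) = A (B (E i X))"
      using that by (simp add: EA KA linear_neg[OF linA(1)])
    finally show ?thesis by (simp add: Z_def)
  qed
  have ZJ: "Z (J X) = J (Z X)" for X by (simp add: Z_def JA)
  define K' where "K' = {X \<in> K. Z X = X}"
  \<comment> \<open>X0 + Z X0 is fixed by Z. If it is zero, X0 lies in the -1 eigenspace and B moves
    it into the +1 eigenspace without killing it.\<close>
  have "\<exists>Y\<in>K'. Y \<noteq> 0"
  proof (cases "X0 + Z X0 = 0")
    case False
    then show ?thesis using K KZ ZZ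
      by (intro bexI[of _ "X0 + Z X0"]) (auto simp: K'_def linear_add[OF linZ] add.commute intro: Real_Vector_Spaces.subspace_add)
  next
    case True
    then have Z0: "Z X0 = - X0" by (simp add: eq_neg_iff_add_eq_0 add.commute)
    have "B X0 \<noteq> 0" using AA(2)[OF K(2)] K(3) linear_0[OF linA(2)] by auto
    then show ?thesis using K(2) KA ZB[OF K(2)]
      by (intro bexI[of _ "B X0"]) (auto simp: K'_def Z0 linear_neg[OF linA(2)])
  qed
  then obtain Y0 where Y0: "Y0 \<in> K'" "Y0 \<noteq> 0" by blast
  have sub: "Real_Vector_Spaces.subspace K'"
    using K(1) linZ unfolding K'_def Real_Vector_Spaces.subspace_def by (auto simp: linear_0 linear_add linear_cmul)
  have "\<exists>F\<subseteq>K'. finite F \<and> card F = 2 ^ (s + 1) \<and> 0 \<notin> F \<and> pairwise (\<lambda>X Y. inner X Y = 0) F"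
  proof (rule Suc.IH[OF linJ _ JJ skew _ _ sub Y0])
    show "E i X \<in> K'" if "i < 2 * s" "X \<in> K'" for i X
      using that Suc.prems(11)[of i X] ZE[of i X] by (simp add: K'_def)
    show "J X \<in> K'" if "X \<in> K'" for X
      using that KJ ZJ by (simp add: K'_def)
    show "E i (E j X) + E j (E i X) = (if i = j then 2 *\<^sub>R X else 0)"
      if "i < 2 * s" "j < 2 * s" "X \<in> K'" for i j X
      using that anti[of i j X] by (simp add: K'_def)
  qed (use Suc.prems in auto)
  then obtain F where F: "F \<subseteq> K'" "finite F" "card F = 2 ^ (s + 1)" "0 \<notin> F" "pairwise (\<lambda>X Y. inner X Y = 0) F" by blast
  have FK: "X \<in> K" "Z X = X" if "X \<in> F" for X using F(1) that by (auto simp: K'_def)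
  have isoB: "inner (B X) (B Y) = inner X Y" if "Y \<in> K" for X Y
    using that by (simp add: sa AA)
  \<comment> \<open>X and \<open>B Y\<close> lie in the +1 and the -1 eigenspace of the self-adjoint
    Z.\<close>
  have cross: "inner X (B Y) = 0" if "X \<in> F" "Y \<in> F" for X Y
  proof -
    have "inner X (B Y) = inner (Z X) (B Y)" using FK[OF that(1)] by simp
    also have "\<dots> = inner X (Z (B Y))" using FK[OF that(2)] by (intro saZ KA)
    also have "\<dots> = - inner X (B Y)" using FK[OF that(2)] by (simp add: ZB)
    finally show ?thesis by simp
  qed
  have injB: "inj_on B F"
    by (rule inj_on_inverseI[of _ B]) (use FK AA in auto)
  have "B X \<noteq> 0" if "X \<in> F" for X
    using isoB[of X X] FK[OF that] F(4) that by auto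
  moreover have "F \<inter> B ` F = {}"
  proof -
    have "B Y \<notin> F" if "Y \<in> F" for Y
    proof
      assume "B Y \<in> F"
      then have "inner (B Y) (B Y) = 0" using cross that by blast
      then show False using \<open>B Y \<in> F\<close> F(4) by auto
    qed
    then show ?thesis by blast
  qed
  moreover have "pairwise (\<lambda>X Y. inner X Y = 0) (F \<union> B ` F)"
  proof -
    have "inner (B X) (B Y) = 0" if "X \<in> F" "Y \<in> F" "B X \<noteq> B Y" for X Y
      using that F(5) isoB[of Y X] FK(1)[of Y] unfolding pairwise_def by auto
    moreover have "inner (B X) Y = 0" if "X \<in> F" "Y \<in> F" for X Y
      using cross[OF that(2,1)] by (simp add: inner_commute)
    ultimately show ?thesis using F(5) cross unfolding pairwise_def by auto
  qed
  ultimately show ?case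
    using F KA FK injB
    by (intro exI[of _ "F \<union> B ` F"]) (auto simp: card_Un_disjoint card_image)
qed

section \<open>Matrices and Clifford generators\<close>

lemma sum_div_mod:
  fixes f :: "nat \<Rightarrow> nat \<Rightarrow> 'a::comm_monoid_add"
  shows "(\<Sum>p<d * d. f (p div d) (p mod d)) = (\<Sum>i<d. \<Sum>j<d. f i j)"
  unfolding sum.cartesian_product
proof (rule sum.reindex_bij_witness[where i = "\<lambda>(i, j). i * d + j" and j = "\<lambda>p. (p div d, p mod d)"])
  fix p assume "p \<in> {..<d * d}"
  then show "(p div d, p mod d) \<in> {..<d} \<times> {..<d}"
    by (cases "d = 0") (auto simp: less_mult_imp_div_less)
next
  fix ij assume "ij \<in> {..<d} \<times> {..<d}"
  then obtain i j where ij: "ij = (i, j)" "i < d" "j < d" by auto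
  have "i * d + j < Suc i * d" using ij by simp
  also have "\<dots> \<le> d * d" using ij by (intro mult_le_mono1) simp
  finally show "(case ij of (i, j) \<Rightarrow> i * d + j) \<in> {..<d * d}" using ij by simp
  show "((case ij of (i, j) \<Rightarrow> i * d + j) div d, (case ij of (i, j) \<Rightarrow> i * d + j) mod d) = ij"
    using ij by simp
qed auto

lemma herm_iff:
  "herm d A \<longleftrightarrow> A \<in> carrier_mat d d \<and> (\<forall>i<d. \<forall>j<d. A $$ (j, i) = cnj (A $$ (i, j)))"
proof (cases "A \<in> carrier_mat d d")
  case True
  then have adj: "mat_adjoint A \<in> carrier_mat d d"
    and ent: "\<And>i j. i < d \<Longrightarrow> j < d \<Longrightarrow> mat_adjoint A $$ (i, j) = cnj (A $$ (j, i))"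
    unfolding mat_adjoint_def by (auto simp: mat_of_rows_index)
  have "mat_adjoint A = A \<longleftrightarrow> (\<forall>i<d. \<forall>j<d. mat_adjoint A $$ (i, j) = A $$ (i, j))"
    using True adj by (auto intro!: eq_matI)
  then show ?thesis using True ent unfolding herm_def by (metis complex_cnj_cnj)
qed (simp add: herm_def)

lemma quadratic_form_eq:
  fixes A :: "complex mat"
  assumes "A \<in> carrier_mat d d" "v \<in> carrier_vec d"
  shows "(A *\<^sub>v v) \<bullet>c v = (\<Sum>i<d. \<Sum>j<d. A $$ (i, j) * v $ j * cnj (v $ i))"
  using assms
  by (simp add: scalar_prod_def sum_distrib_right atLeast0LessThan)

lemma psd_iff:
  "psd d A \<longleftrightarrow> A \<in> carrier_mat d d \<and> (\<forall>i<d. \<forall>j<d. A $$ (j, i) = cnj (A $$ (i, j))) \<and>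
     (\<forall>z. 0 \<le> Re (\<Sum>i<d. \<Sum>j<d. A $$ (i, j) * z j * cnj (z i)))"
proof -
  have "(\<forall>v \<in> carrier_vec d. 0 \<le> Re ((A *\<^sub>v v) \<bullet>c v)) \<longleftrightarrow>
      (\<forall>z. 0 \<le> Re (\<Sum>i<d. \<Sum>j<d. A $$ (i, j) * z j * cnj (z i)))" if A: "A \<in> carrier_mat d d"
  proof safe
    fix z :: "nat \<Rightarrow> complex"
    assume "\<forall>v \<in> carrier_vec d. 0 \<le> Re ((A *\<^sub>v v) \<bullet>c v)"
    then have "0 \<le> Re ((A *\<^sub>v vec d z) \<bullet>c vec d z)" by simp
    then show "0 \<le> Re (\<Sum>i<d. \<Sum>j<d. A $$ (i, j) * z j * cnj (z i))"
      by (subst (asm) quadratic_form_eq[OF A]) simp_all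
  next
    fix v :: "complex vec"
    assume "\<forall>z. 0 \<le> Re (\<Sum>i<d. \<Sum>j<d. A $$ (i, j) * z j * cnj (z i))" "v \<in> carrier_vec d"
    then show "0 \<le> Re ((A *\<^sub>v v) \<bullet>c v)" by (simp add: quadratic_form_eq[OF A])
  qed
  then show ?thesis unfolding psd_def herm_iff by blast
qed

lemma mtrace_kron_mult:
  assumes "R \<in> carrier_mat (d * d) (d * d)"
  shows "mtrace (kron d A B * R) =
    (\<Sum>p<d * d. \<Sum>q<d * d. A $$ (p div d, q div d) * B $$ (p mod d, q mod d) * R $$ (q, p))"
  using assms unfolding mtrace_def
  by (intro sum.cong) (auto simp: kron_def scalar_prod_def atLeast0LessThan intro!: sum.cong)

lemma sum_even_odd: "(\<Sum>b<2 * (K::nat). f b) = (\<Sum>b<K. f (2 * b) + f (2 * b + 1))"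
  by (induction K) (simp_all add: add.assoc)

text \<open>Doubling the dimension with diag(g, -g) for the old generators and the block swap for the new one;
  the block is the lowest bit of the index.\<close>
lemma clifford_generators_exist:
  "\<exists>g :: nat \<Rightarrow> nat \<Rightarrow> nat \<Rightarrow> real.
     (\<forall>i<k. \<forall>a<2 ^ k. \<forall>b<2 ^ k. g i a b = g i b a) \<and>
     (\<forall>i<k. (\<Sum>a<2 ^ k. g i a a) = 0) \<and>
     (\<forall>i<k. \<forall>j<k. \<forall>a<2 ^ k. \<forall>c<2 ^ k. (\<Sum>b<2 ^ k. g i a b * g j b c) + (\<Sum>b<2 ^ k. g j a b * g i b c) =
        (if i = j \<and> a = c then 2 else 0))"
proof (induction k)
  case 0
  show ?case by simp
next
  case (Suc k)
  define K :: nat where "K = 2 ^ k"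
  obtain g :: "nat \<Rightarrow> nat \<Rightarrow> nat \<Rightarrow> real" where g:
    "\<forall>i<k. \<forall>a<K. \<forall>b<K. g i a b = g i b a" "\<forall>i<k. (\<Sum>a<K. g i a a) = 0"
    "\<forall>i<k. \<forall>j<k. \<forall>a<K. \<forall>c<K. (\<Sum>b<K. g i a b * g j b c) + (\<Sum>b<K. g j a b * g i b c) =
        (if i = j \<and> a = c then 2 else 0)"
    using Suc.IH unfolding K_def[symmetric] by (elim exE conjE) (rule that; assumption)
  have sym: "g i a b = g i b a" if "i < k" "a < K" "b < K" for i a b
    using g(1) that by (elim allE impE)
  have tr: "(\<Sum>a<K. g i a a) = 0" if "i < k" for i
    using g(2) that by (elim allE impE)
  have cl: "(\<Sum>b<K. g i a b * g j b c) + (\<Sum>b<K. g j a b * g i b c) = (if i = j \<and> a = c then 2 else 0)"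
    if "i < k" "j < k" "a < K" "c < K" for i j a c
    using g(3) that by (elim allE impE)
  define s :: "nat \<Rightarrow> real" where "s = (\<lambda>t. if t = 0 then 1 else -1)"
  define h where "h = (\<lambda>i a b. if i < k then (if a mod 2 = b mod 2 then s (a mod 2) * g i (a div 2) (b div 2) else 0)
      else if a div 2 = b div 2 \<and> a mod 2 \<noteq> b mod 2 then 1 else 0)"
  have ss: "s t * s t = 1" for t by (simp add: s_def)
  have dm: "(2 * b) div 2 = b" "(2 * b) mod 2 = 0" "(2 * b + 1) div 2 = b" "(2 * b + 1) mod 2 = 1" for b :: nat
    by simp_all
  have par: "a mod 2 = 0 \<or> a mod 2 = 1" for a :: nat by auto
  have hsym: "h i a b = h i b a" if "a < 2 * K" "b < 2 * K" for i a b
    using sym[of i "a div 2" "b div 2"] that by (auto simp: h_def)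
  have htr: "(\<Sum>a<2 * K. h i a a) = 0" if "i < Suc k" for i
    unfolding sum_even_odd using that by (auto simp: h_def s_def)
  \<comment> \<open>The four products old-old, old-new, new-old and new-new. In the mixed ones the
    sign is read off the row in one order and off the column in the other; they differ in the lowest
    bit, so the anticommutator vanishes.\<close>
  have P1: "(\<Sum>b<2 * K. h i a b * h j b c) =
      (if a mod 2 = c mod 2 then \<Sum>b<K. g i (a div 2) b * g j b (c div 2) else 0)"
    if "i < k" "j < k" for i j a c
    unfolding sum_even_odd using that par[of a] par[of c]
    by (elim disjE) (simp_all add: h_def s_def)
  have P2: "(\<Sum>b<2 * K. h i a b * h k b c) = (if a mod 2 \<noteq> c mod 2 then s (a mod 2) * g i (a div 2) (c div 2) else 0)"
    if "i < k" "c < 2 * K" for i a c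
  proof -
    have "h i a (2 * b) * h k (2 * b) c + h i a (2 * b + 1) * h k (2 * b + 1) c =
        (if b = c div 2 then (if a mod 2 \<noteq> c mod 2 then s (a mod 2) * g i (a div 2) (c div 2) else 0) else 0)" for b
      using that par[of a] par[of c] by (elim disjE) (simp_all add: h_def s_def)
    then show ?thesis using that unfolding sum_even_odd by simp
  qed
  have P3: "(\<Sum>b<2 * K. h k a b * h i b c) = (if a mod 2 \<noteq> c mod 2 then s (c mod 2) * g i (a div 2) (c div 2) else 0)"
    if "i < k" "a < 2 * K" for i a c
  proof -
    have "h k a (2 * b) * h i (2 * b) c + h k a (2 * b + 1) * h i (2 * b + 1) c =
        (if b = a div 2 then (if a mod 2 \<noteq> c mod 2 then s (c mod 2) * g i (a div 2) (c div 2) else 0) else 0)" for b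
      using that par[of a] par[of c] by (elim disjE) (auto simp add: h_def s_def)
    then show ?thesis using that unfolding sum_even_odd by simp
  qed
  have P4: "(\<Sum>b<2 * K. h k a b * h k b c) = (if a = c then 1 else 0)"
    if "a < 2 * K" "c < 2 * K" for a c
  proof -
    have ac: "a = c \<longleftrightarrow> a div 2 = c div 2 \<and> a mod 2 = c mod 2"
      by (metis div_mult_mod_eq)
    have "h k a (2 * b) * h k (2 * b) c + h k a (2 * b + 1) * h k (2 * b + 1) c =
        (if b = a div 2 then (if a = c then 1 else 0) else 0)" for b
      unfolding ac using that par[of a] par[of c] by (elim disjE) (auto simp add: h_def)
    moreover have "a div 2 < K" using that by linarith
    ultimately show ?thesis unfolding sum_even_odd by simp
  qed
  have hcl: "(\<Sum>b<2 * K. h i a b * h j b c) + (\<Sum>b<2 * K. h j a b * h i b c) = (if i = j \<and> a = c then 2 else 0)"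
    if ij: "i < Suc k" "j < Suc k" and ac: "a < 2 * K" "c < 2 * K" for i j a c
  proof -
    have eq: "a = c \<longleftrightarrow> a div 2 = c div 2 \<and> a mod 2 = c mod 2"
      by (metis div_mult_mod_eq)
    have s_opp: "s (a mod 2) + s (c mod 2) = 0" if "a mod 2 \<noteq> c mod 2"
      using that par[of a] par[of c] by (auto simp: s_def)
    have s_opp': "s (a mod 2) * w + s (c mod 2) * w = 0" if "a mod 2 \<noteq> c mod 2" for w
      using s_opp[OF that] by (simp flip: distrib_right)
    consider "i < k" "j < k" | "i < k" "j = k" | "i = k" "j < k" | "i = k" "j = k"
      using ij by linarith
    then show ?thesis
    proof cases
      case 1
      then show ?thesis using cl[OF 1, of "a div 2" "c div 2"] ac by (auto simp: P1 eq)
    next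
      case 2
      then show ?thesis using s_opp'[of "g i (a div 2) (c div 2)"] ac by (auto simp: P2 P3)
    next
      case 3
      then show ?thesis using s_opp'[of "g j (a div 2) (c div 2)"] ac by (auto simp: P2 P3 add.commute)
    next
      case 4
      then show ?thesis using ac by (simp add: P4)
    qed
  qed
  have K2: "2 ^ Suc k = 2 * K" by (simp add: K_def)
  show ?case unfolding K2 using hsym htr hcl by (intro exI[of _ h] conjI allI impI) auto
qed

text \<open>Tsirelson's construction: u becomes the sum of u_i times the i-th Clifford generator.
  Squares are then the scalars |u|^2, anticommutators are twice the inner products, and trace zero
  will make the marginals uniform.\<close>

lemma vec_corr_symmetric_matrices:
  assumes "vec_corr n m c"
  obtains d :: nat and S T :: "nat \<Rightarrow> nat \<Rightarrow> nat \<Rightarrow> real" and \<alpha> \<beta> where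
    "d \<ge> 1"
    "\<And>x a b. x < n \<Longrightarrow> a < d \<Longrightarrow> b < d \<Longrightarrow> S x a b = S x b a"
    "\<And>y a b. y < m \<Longrightarrow> a < d \<Longrightarrow> b < d \<Longrightarrow> T y a b = T y b a"
    "\<And>x. x < n \<Longrightarrow> (\<Sum>a<d. S x a a) = 0" "\<And>y. y < m \<Longrightarrow> (\<Sum>a<d. T y a a) = 0"
    "\<And>x a c. x < n \<Longrightarrow> a < d \<Longrightarrow> c < d \<Longrightarrow> (\<Sum>b<d. S x a b * S x b c) = (if a = c then \<alpha> x else 0)"
    "\<And>y a c. y < m \<Longrightarrow> a < d \<Longrightarrow> c < d \<Longrightarrow> (\<Sum>b<d. T y a b * T y b c) = (if a = c then \<beta> y else 0)"
    "\<And>x. x < n \<Longrightarrow> 0 \<le> \<alpha> x \<and> \<alpha> x \<le> 1" "\<And>y. y < m \<Longrightarrow> 0 \<le> \<beta> y \<and> \<beta> y \<le> 1"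
    "\<And>x y. x < n \<Longrightarrow> y < m \<Longrightarrow> (\<Sum>a<d. \<Sum>b<d. S x a b * T y a b) = real d * c x y"
proof -
  obtain k :: nat and U V where U: "\<forall>x<n. (\<Sum>i<k. (U x i)\<^sup>2) \<le> 1" and V: "\<forall>y<m. (\<Sum>i<k. (V y i)\<^sup>2) \<le> 1"
    and c: "\<forall>x<n. \<forall>y<m. c x y = (\<Sum>i<k. U x i * V y i)"
    using assms unfolding vec_corr_def by (elim exE conjE) (rule that; assumption)
  define d :: nat where "d = 2 ^ k"
  obtain g :: "nat \<Rightarrow> nat \<Rightarrow> nat \<Rightarrow> real" where g:
    "\<forall>i<k. \<forall>a<d. \<forall>b<d. g i a b = g i b a" "\<forall>i<k. (\<Sum>a<d. g i a a) = 0"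
    "\<forall>i<k. \<forall>j<k. \<forall>a<d. \<forall>c<d. (\<Sum>b<d. g i a b * g j b c) + (\<Sum>b<d. g j a b * g i b c) =
        (if i = j \<and> a = c then 2 else 0)"
    using clifford_generators_exist[of k] unfolding d_def[symmetric] by (elim exE conjE) (rule that; assumption)
  have sym: "g i a b = g i b a" if "i < k" "a < d" "b < d" for i a b
    using g(1) that by (elim allE impE)
  have tr: "(\<Sum>a<d. g i a a) = 0" if "i < k" for i
    using g(2) that by (elim allE impE)
  have cl: "(\<Sum>b<d. g i a b * g j b c) + (\<Sum>b<d. g j a b * g i b c) = (if i = j \<and> a = c then 2 else 0)"
    if "i < k" "j < k" "a < d" "c < d" for i j a c
    using g(3) that by (elim allE impE)
  have d1: "Suc 0 \<le> d" by (simp add: d_def)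
  define L where "L = (\<lambda>(u :: nat \<Rightarrow> real) a b. \<Sum>i<k. u i * g i a b)"
  have Lsym: "L u a b = L u b a" if "a < d" "b < d" for u a b
    unfolding L_def using that sym by (intro sum.cong refl) auto
  have Ltr: "(\<Sum>a<d. L u a a) = 0" for u
  proof -
    have "(\<Sum>a<d. L u a a) = (\<Sum>i<k. u i * (\<Sum>a<d. g i a a))"
      unfolding L_def by (subst sum.swap) (simp add: sum_distrib_left)
    then show ?thesis using tr by simp
  qed
  have prod: "(\<Sum>b<d. L u a b * L v b e) = (\<Sum>i<k. \<Sum>j<k. (u i * v j) * (\<Sum>b<d. g i a b * g j b e))" for u v a e
  proof -
    have "(\<Sum>b<d. L u a b * L v b e) = (\<Sum>b<d. \<Sum>i<k. \<Sum>j<k. (u i * v j) * (g i a b * g j b e))"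
      unfolding L_def sum_product by (simp add: mult_ac)
    also have "\<dots> = (\<Sum>i<k. \<Sum>b<d. \<Sum>j<k. (u i * v j) * (g i a b * g j b e))" by (rule sum.swap)
    also have "\<dots> = (\<Sum>i<k. \<Sum>j<k. \<Sum>b<d. (u i * v j) * (g i a b * g j b e))"
      by (rule sum.cong[OF refl], rule sum.swap)
    finally show ?thesis by (simp add: sum_distrib_left)
  qed
  have Lcl: "(\<Sum>b<d. L u a b * L v b e) + (\<Sum>b<d. L v a b * L u b e) = (if a = e then 2 * (\<Sum>i<k. u i * v i) else 0)"
    if "a < d" "e < d" for u v a e
  proof -
    have "(\<Sum>b<d. L v a b * L u b e) = (\<Sum>i<k. \<Sum>j<k. (u i * v j) * (\<Sum>b<d. g j a b * g i b e))"
      unfolding prod by (subst sum.swap) (simp add: mult_ac)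
    then have "(\<Sum>b<d. L u a b * L v b e) + (\<Sum>b<d. L v a b * L u b e) =
        (\<Sum>i<k. \<Sum>j<k. (u i * v j) * ((\<Sum>b<d. g i a b * g j b e) + (\<Sum>b<d. g j a b * g i b e)))"
      unfolding prod by (simp add: sum.distrib distrib_left)
    also have "\<dots> = (\<Sum>i<k. \<Sum>j<k. if j = i then (if a = e then 2 * (u i * v i) else 0) else 0)"
      using that by (intro sum.cong refl) (simp add: cl)
    also have "\<dots> = (if a = e then 2 * (\<Sum>i<k. u i * v i) else 0)"
      by (simp add: sum_distrib_left)
    finally show ?thesis .
  qed
  have Lsq: "(\<Sum>b<d. L u a b * L u b e) = (if a = e then (\<Sum>i<k. (u i)\<^sup>2) else 0)" if "a < d" "e < d" for u a e
    using Lcl[OF that, of u u] by (auto simp: power2_eq_square split: if_splits)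
  have Lip: "(\<Sum>a<d. \<Sum>b<d. L u a b * L v a b) = real d * (\<Sum>i<k. u i * v i)" for u v
  proof -
    have 1: "(\<Sum>a<d. \<Sum>b<d. L u a b * L v a b) = (\<Sum>a<d. \<Sum>b<d. L u a b * L v b a)"
      by (intro sum.cong refl) (simp add: Lsym)
    have 2: "(\<Sum>a<d. \<Sum>b<d. L u a b * L v a b) = (\<Sum>a<d. \<Sum>b<d. L v a b * L u b a)"
      by (intro sum.cong refl) (simp add: Lsym)
    \<comment> \<open>By symmetry of the matrices the entrywise sum is the trace of the product in
      either order, so twice it is the trace of the anticommutator.\<close>
    have "2 * (\<Sum>a<d. \<Sum>b<d. L u a b * L v a b) =
       (\<Sum>a<d. (\<Sum>b<d. L u a b * L v b a) + (\<Sum>b<d. L v a b * L u b a))"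
      unfolding sum.distrib using 1 2 by simp
    also have "\<dots> = (\<Sum>a<d. 2 * (\<Sum>i<k. u i * v i))"
      by (intro sum.cong refl) (simp add: Lcl)
    finally show ?thesis by simp
  qed
  show ?thesis
    by (rule that[where d = d and S = "\<lambda>x. L (U x)" and T = "\<lambda>y. L (V y)"
          and \<alpha> = "\<lambda>x. \<Sum>i<k. (U x i)\<^sup>2" and \<beta> = "\<lambda>y. \<Sum>i<k. (V y i)\<^sup>2"])
      (use U V c d1 in \<open>auto simp: Ltr Lsq Lip sum_nonneg intro: Lsym\<close>)
qed

section \<open>Quantum realization of vector correlations\<close>

definition max_entangled :: "nat \<Rightarrow> complex mat" where
  "max_entangled d = mat (d * d) (d * d)
     (\<lambda>(p, q). if p div d = p mod d \<and> q div d = q mod d then 1 / of_nat d else 0)"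

text \<open>The double sum is the trace of A times the transpose of B; the matrices from the
  Clifford construction are symmetric, so the transpose does no harm there.\<close>

lemma mtrace_kron_max_entangled:
  "mtrace (kron d A B * max_entangled d) = (\<Sum>i<d. \<Sum>j<d. A $$ (i, j) * B $$ (i, j)) / of_nat d"
proof -
  define F where "F = (\<lambda>i j k l. A $$ (i, k) * B $$ (j, l) * (if k = l \<and> i = j then 1 / complex_of_nat d else 0))"
  have "mtrace (kron d A B * max_entangled d) =
      (\<Sum>p<d * d. \<Sum>q<d * d. F (p div d) (p mod d) (q div d) (q mod d))"
    by (subst mtrace_kron_mult) (auto simp: max_entangled_def F_def intro!: sum.cong)
  also have "\<dots> = (\<Sum>p<d * d. \<Sum>k<d. \<Sum>l<d. F (p div d) (p mod d) k l)"
    by (rule sum.cong[OF refl], rule sum_div_mod)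
  also have "\<dots> = (\<Sum>i<d. \<Sum>j<d. \<Sum>k<d. \<Sum>l<d. F i j k l)"
    by (rule sum_div_mod[where f = "\<lambda>i j. \<Sum>k<d. \<Sum>l<d. F i j k l"])
  also have "\<dots> = (\<Sum>i<d. \<Sum>j<d. if i = j then (\<Sum>k<d. A $$ (i, k) * B $$ (i, k) / of_nat d) else 0)"
  proof (rule sum.cong[OF refl], rule sum.cong[OF refl])
    fix i j
    have "(\<Sum>l<d. F i j k l) = (if i = j then A $$ (i, k) * B $$ (i, k) / of_nat d else 0)"
      if "k < d" for k
    proof -
      have "(\<Sum>l<d. F i j k l) = (\<Sum>l<d. if k = l then (if i = j then A $$ (i, k) * B $$ (i, k) / of_nat d else 0) else 0)"
        by (rule sum.cong) (auto simp: F_def)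
      then show ?thesis using that by simp
    qed
    then show "(\<Sum>k<d. \<Sum>l<d. F i j k l) = (if i = j then (\<Sum>k<d. A $$ (i, k) * B $$ (i, k) / of_nat d) else 0)"
      by simp
  qed
  finally show ?thesis by (simp add: sum_divide_distrib)
qed

lemma state_max_entangled:
  assumes "d \<ge> 1"
  shows "state d (max_entangled d)"
proof -
  have "0 \<le> Re (\<Sum>p<d * d. \<Sum>q<d * d. max_entangled d $$ (p, q) * z q * cnj (z p))" for z
  proof -
    define h where "h = (\<Sum>p<d * d. if p div d = p mod d then z p else 0)"
    have "(\<Sum>p<d * d. \<Sum>q<d * d. max_entangled d $$ (p, q) * z q * cnj (z p)) =
        (\<Sum>p<d * d. \<Sum>q<d * d. cnj (if p div d = p mod d then z p else 0) * (if q div d = q mod d then z q else 0) / of_nat d)"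
      by (rule sum.cong[OF refl], rule sum.cong[OF refl]) (auto simp: max_entangled_def)
    also have "\<dots> = cnj h * h / of_nat d"
      unfolding h_def cnj_sum sum_product sum_divide_distrib ..
    also have "cnj h * h = of_real ((cmod h)\<^sup>2)"
      unfolding complex_norm_square by (rule mult.commute)
    also have "of_real ((cmod h)\<^sup>2) / of_nat d = complex_of_real ((cmod h)\<^sup>2 / real d)" by simp
    finally show ?thesis by simp
  qed
  moreover have "mtrace (max_entangled d) = 1"
  proof -
    have "mtrace (max_entangled d) = (\<Sum>p<d * d. (\<lambda>i j. if i = j then 1 / of_nat d else 0) (p div d) (p mod d))"
      unfolding mtrace_def by (intro sum.cong) (auto simp: max_entangled_def)
    also have "\<dots> = (\<Sum>i<d. \<Sum>j<d. if i = j then 1 / of_nat d else 0)" by (rule sum_div_mod)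
    finally show ?thesis using assms by simp
  qed
  ultimately show ?thesis
    unfolding state_def psd_iff by (auto simp: max_entangled_def)
qed

section \<open>Real symmetric matrices whose square is a scalar\<close>

lemma scaled_involution_norm:
  fixes S :: "nat \<Rightarrow> nat \<Rightarrow> real" and z :: "nat \<Rightarrow> complex"
  assumes sym: "\<And>a b. a < d \<Longrightarrow> b < d \<Longrightarrow> S a b = S b a"
    and sq: "\<And>a c. a < d \<Longrightarrow> c < d \<Longrightarrow> (\<Sum>b<d. S a b * S b c) = (if a = c then \<alpha> else 0)"
  shows "(\<Sum>a<d. (cmod (\<Sum>b<d. of_real (S a b) * z b))\<^sup>2) = \<alpha> * (\<Sum>a<d. (cmod (z a))\<^sup>2)"
proof -
  have "complex_of_real (\<Sum>a<d. (cmod (\<Sum>b<d. of_real (S a b) * z b))\<^sup>2) =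
      (\<Sum>a<d. \<Sum>b<d. \<Sum>c<d. z b * cnj (z c) * of_real (S a b * S a c))"
    unfolding of_real_sum complex_norm_square cnj_sum sum_product by (simp add: mult_ac)
  also have "\<dots> = (\<Sum>b<d. \<Sum>a<d. \<Sum>c<d. z b * cnj (z c) * of_real (S a b * S a c))" by (rule sum.swap)
  also have "\<dots> = (\<Sum>b<d. \<Sum>c<d. \<Sum>a<d. z b * cnj (z c) * of_real (S a b * S a c))"
    by (rule sum.cong[OF refl], rule sum.swap)
  also have "\<dots> = (\<Sum>b<d. \<Sum>c<d. if b = c then of_real (\<alpha> * (cmod (z b))\<^sup>2) else 0)"
  proof (rule sum.cong[OF refl], rule sum.cong[OF refl])
    fix b c assume bc: "b \<in> {..<d}" "c \<in> {..<d}"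
    have "(\<Sum>a<d. S a b * S a c) = (\<Sum>a<d. S b a * S a c)"
      using bc by (intro sum.cong refl) (simp add: sym)
    also have "\<dots> = (if b = c then \<alpha> else 0)" using bc by (simp add: sq)
    finally have "(\<Sum>a<d. z b * cnj (z c) * of_real (S a b * S a c)) = z b * cnj (z c) * of_real (if b = c then \<alpha> else 0)"
      unfolding sum_distrib_left[symmetric] of_real_sum[symmetric] by simp
    then show "(\<Sum>a<d. z b * cnj (z c) * of_real (S a b * S a c)) = (if b = c then of_real (\<alpha> * (cmod (z b))\<^sup>2) else 0)"
      unfolding of_real_mult complex_norm_square by (simp add: mult_ac)
  qed
  also have "\<dots> = complex_of_real (\<alpha> * (\<Sum>a<d. (cmod (z a))\<^sup>2))"
    by (simp add: sum_distrib_left)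
  finally show ?thesis unfolding of_real_eq_iff .
qed

text \<open>Applying the matrix twice to an eigenvector gives k^2 = \<alpha>, so k is plus or minus
  the square root of \<alpha>.\<close>

lemma scaled_involution_observable:
  fixes S :: "nat \<Rightarrow> nat \<Rightarrow> real"
  assumes sym: "\<And>a b. a < d \<Longrightarrow> b < d \<Longrightarrow> S a b = S b a"
    and sq: "\<And>a c. a < d \<Longrightarrow> c < d \<Longrightarrow> (\<Sum>b<d. S a b * S b c) = (if a = c then \<alpha> else 0)"
    and \<alpha>: "0 \<le> \<alpha>" "\<alpha> \<le> 1"
  shows "observable d (mat d d (\<lambda>(i, j). complex_of_real (S i j)))" (is "observable d ?M")
proof -
  have "k \<in> complex_of_real ` {-1..1}" if k: "eigenvalue ?M k" for k
  proof -
    obtain v where v: "v \<in> carrier_vec d" "v \<noteq> 0\<^sub>v d" "?M *\<^sub>v v = k \<cdot>\<^sub>v v"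
      using k unfolding eigenvalue_def eigenvector_def by auto
    have ev: "(\<Sum>b<d. of_real (S a b) * v $ b) = k * v $ a" if "a < d" for a
    proof -
      have "(?M *\<^sub>v v) $ a = (k \<cdot>\<^sub>v v) $ a" using v(3) by simp
      then show ?thesis using that v(1) by (simp add: scalar_prod_def atLeast0LessThan)
    qed
    obtain a where a: "a < d" "v $ a \<noteq> 0" using v(1,2) by (metis carrier_vecD eq_vecI index_zero_vec)
    have "k * (k * v $ a) = (\<Sum>b<d. of_real (S a b) * (k * v $ b))"
      using ev[OF a(1)] by (simp add: sum_distrib_left[symmetric] mult.left_commute)
    also have "\<dots> = (\<Sum>b<d. of_real (S a b) * (\<Sum>c<d. of_real (S b c) * v $ c))"
      by (intro sum.cong refl) (simp add: ev)
    also have "\<dots> = (\<Sum>b<d. \<Sum>c<d. of_real (S a b * S b c) * v $ c)"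
      by (simp add: sum_distrib_left mult.assoc)
    also have "\<dots> = (\<Sum>c<d. \<Sum>b<d. of_real (S a b * S b c) * v $ c)" by (rule sum.swap)
    also have "\<dots> = (\<Sum>c<d. of_real (\<Sum>b<d. S a b * S b c) * v $ c)" by (simp add: sum_distrib_right)
    also have "\<dots> = (\<Sum>c<d. if c = a then of_real \<alpha> * v $ a else 0)"
      using a(1) by (intro sum.cong refl) (simp add: sq)
    also have "\<dots> = of_real \<alpha> * v $ a" using a(1) by simp
    finally have "k * k = of_real \<alpha>" using a(2) by simp
    also have "\<dots> = of_real (sqrt \<alpha>) * of_real (sqrt \<alpha>)" using \<alpha>(1) by (simp flip: of_real_mult)
    finally have "k = of_real (sqrt \<alpha>) \<or> k = of_real (- sqrt \<alpha>)"
      by (simp add: square_eq_iff)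
    moreover have "sqrt \<alpha> \<in> {-1..1}" "- sqrt \<alpha> \<in> {-1..1}"
      using \<alpha> real_sqrt_ge_zero[OF \<alpha>(1)] by (auto intro: order_trans[of _ 0])
    ultimately show ?thesis by blast
  qed
  moreover have "herm d ?M" unfolding herm_iff using sym by auto
  ultimately show ?thesis unfolding observable_def by blast
qed

text \<open>Twice the real part of <z + t S z, z> equals |z + t S z|^2 + |z|^2 - |S z|^2, and |S
  z|^2 = \<alpha> |z|^2 is at most |z|^2.\<close>

lemma scaled_involution_psd:
  fixes S :: "nat \<Rightarrow> nat \<Rightarrow> real"
  assumes sym: "\<And>a b. a < d \<Longrightarrow> b < d \<Longrightarrow> S a b = S b a"
    and sq: "\<And>a c. a < d \<Longrightarrow> c < d \<Longrightarrow> (\<Sum>b<d. S a b * S b c) = (if a = c then \<alpha> else 0)"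
    and \<alpha>: "\<alpha> \<le> 1" and t: "t = 1 \<or> t = -1"
  shows "psd d (mat d d (\<lambda>(i, j). complex_of_real (((if i = j then 1 else 0) + t * S i j) / 2)))"
proof -
  have "0 \<le> Re (\<Sum>i<d. \<Sum>j<d. complex_of_real (((if i = j then 1 else 0) + t * S i j) / 2) * z j * cnj (z i))" for z
  proof -
    define w where "w = (\<lambda>i. \<Sum>j<d. complex_of_real (S i j) * z j)"
    have "(\<Sum>j<d. complex_of_real (((if i = j then 1 else 0) + t * S i j) / 2) * z j * cnj (z i)) =
        (z i + of_real t * w i) * cnj (z i) / 2" if "i < d" for i
    proof -
      have "(\<Sum>j<d. complex_of_real (((if i = j then 1 else 0) + t * S i j) / 2) * z j * cnj (z i)) =
         (\<Sum>j<d. (if i = j then z i * cnj (z i) / 2 else 0) + of_real (S i j) * z j * (of_real t * cnj (z i) / 2))"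
        by (rule sum.cong) (auto simp: field_simps)
      also have "\<dots> = z i * cnj (z i) / 2 + w i * (of_real t * cnj (z i) / 2)"
        unfolding sum.distrib w_def sum_distrib_right using that by simp
      finally show ?thesis by (simp add: algebra_simps add_divide_distrib)
    qed
    then have "(\<Sum>i<d. \<Sum>j<d. complex_of_real (((if i = j then 1 else 0) + t * S i j) / 2) * z j * cnj (z i)) =
        (\<Sum>i<d. (z i + of_real t * w i) * cnj (z i) / 2)"
      by (intro sum.cong[OF refl]) blast
    then have eq: "Re (\<Sum>i<d. \<Sum>j<d. complex_of_real (((if i = j then 1 else 0) + t * S i j) / 2) * z j * cnj (z i)) =
        (\<Sum>i<d. Re ((z i + of_real t * w i) * cnj (z i) / 2))" by (simp only: Re_sum)
    have sqs: "4 * Re ((z i + of_real t * w i) * cnj (z i) / 2) =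
        (cmod (z i + of_real t * w i))\<^sup>2 + (cmod (z i))\<^sup>2 - (cmod (w i))\<^sup>2" for i
      using t unfolding cmod_power2 by (elim disjE) (simp_all add: field_simps power2_eq_square)
    have "(\<Sum>i<d. (cmod (w i))\<^sup>2) = \<alpha> * (\<Sum>i<d. (cmod (z i))\<^sup>2)"
      unfolding w_def by (rule scaled_involution_norm[OF sym sq])
    also have "\<dots> \<le> 1 * (\<Sum>i<d. (cmod (z i))\<^sup>2)" using \<alpha> by (intro mult_right_mono sum_nonneg) auto
    finally have "0 \<le> (\<Sum>i<d. (cmod (z i + of_real t * w i))\<^sup>2) + (\<Sum>i<d. (cmod (z i))\<^sup>2) - (\<Sum>i<d. (cmod (w i))\<^sup>2)"
      using sum_nonneg[of "{..<d}" "\<lambda>i. (cmod (z i + of_real t * w i))\<^sup>2"] by simp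
    also have "\<dots> = 4 * (\<Sum>i<d. Re ((z i + of_real t * w i) * cnj (z i) / 2))"
      unfolding sum_distrib_left sqs by (simp add: sum.distrib sum_subtractf)
    finally show ?thesis unfolding eq by simp
  qed
  then show ?thesis unfolding psd_iff using sym by simp
qed

lemma vec_corr_abs_le_1:
  assumes "vec_corr n m c" "x < n" "y < m"
  shows "\<bar>c x y\<bar> \<le> 1"
proof -
  obtain k :: nat and U V where U: "\<forall>x<n. (\<Sum>i<k. (U x i)\<^sup>2) \<le> 1" and V: "\<forall>y<m. (\<Sum>i<k. (V y i)\<^sup>2) \<le> 1"
    and c: "\<forall>x<n. \<forall>y<m. c x y = (\<Sum>i<k. U x i * V y i)"
    using assms(1) unfolding vec_corr_def by (elim exE conjE) (rule that; assumption)
  have "2 * \<bar>\<Sum>i<k. U x i * V y i\<bar> \<le> 2 * (\<Sum>i<k. \<bar>U x i\<bar> * \<bar>V y i\<bar>)"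
    by (simp flip: abs_mult)
  also have "\<dots> \<le> (\<Sum>i<k. (U x i)\<^sup>2 + (V y i)\<^sup>2)"
    unfolding sum_distrib_left using sum_squares_bound[of "\<bar>U x _\<bar>" "\<bar>V y _\<bar>"]
    by (intro sum_mono) (simp add: mult.assoc)
  finally show ?thesis using U V c assms(2,3) by (fastforce simp: sum.distrib)
qed

text \<open>A given realization of c may have biased marginals, so the Clifford matrices are used:
  in the product of the effects (1 + pm a S) / 2 and (1 + pm b T) / 2 the terms linear in S or T
  have trace zero, and only the uniform part and the correlation survive.\<close>

lemma vec_corr_has_rep:
  assumes "vec_corr n m c"
  shows "\<exists>d. has_rep n m 2 2 d (\<lambda>a b x y. (1 + pm a * pm b * c x y) / 4)"
  using assms
proof (rule vec_corr_symmetric_matrices)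
  fix d :: nat and S T :: "nat \<Rightarrow> nat \<Rightarrow> nat \<Rightarrow> real" and \<alpha> \<beta>
  assume d: "d \<ge> 1" and
    S: "\<And>x a b. x < n \<Longrightarrow> a < d \<Longrightarrow> b < d \<Longrightarrow> S x a b = S x b a" and
    T: "\<And>y a b. y < m \<Longrightarrow> a < d \<Longrightarrow> b < d \<Longrightarrow> T y a b = T y b a" and
    trS: "\<And>x. x < n \<Longrightarrow> (\<Sum>a<d. S x a a) = 0" and trT: "\<And>y. y < m \<Longrightarrow> (\<Sum>a<d. T y a a) = 0" and
    S2: "\<And>x a c. x < n \<Longrightarrow> a < d \<Longrightarrow> c < d \<Longrightarrow> (\<Sum>b<d. S x a b * S x b c) = (if a = c then \<alpha> x else 0)" and
    T2: "\<And>y a c. y < m \<Longrightarrow> a < d \<Longrightarrow> c < d \<Longrightarrow> (\<Sum>b<d. T y a b * T y b c) = (if a = c then \<beta> y else 0)" and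
    \<alpha>: "\<And>x. x < n \<Longrightarrow> 0 \<le> \<alpha> x \<and> \<alpha> x \<le> 1" and \<beta>: "\<And>y. y < m \<Longrightarrow> 0 \<le> \<beta> y \<and> \<beta> y \<le> 1" and
    ST: "\<And>x y. x < n \<Longrightarrow> y < m \<Longrightarrow> (\<Sum>a<d. \<Sum>b<d. S x a b * T y a b) = real d * c x y"
  define M where "M = (\<lambda>(W :: nat \<Rightarrow> nat \<Rightarrow> nat \<Rightarrow> real) a x.
     mat d d (\<lambda>(i, j). complex_of_real (((if i = j then 1 else 0) + pm a * W x i j) / 2)))"
  have pm: "pm a = 1 \<or> pm a = -1" for a by (simp add: pm_def)
  have psd: "psd d (M S a x)" if "x < n" for a x
    unfolding M_def by (rule scaled_involution_psd[where \<alpha> = "\<alpha> x"]) (use S S2 \<alpha> that pm in auto)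
  have psd': "psd d (M T b y)" if "y < m" for b y
    unfolding M_def by (rule scaled_involution_psd[where \<alpha> = "\<beta> y"]) (use T T2 \<beta> that pm in auto)
  have one: "(\<Sum>a<2. M W a x $$ (i, j)) = 1\<^sub>m d $$ (i, j)" if "i < d" "j < d" for W x i j
    using that by (simp add: M_def pm_def numeral_2_eq_2 add_divide_distrib diff_divide_distrib)
  have tr: "complex_of_real ((1 + pm a * pm b * c x y) / 4) = mtrace (kron d (M S a x) (M T b y) * max_entangled d)"
    if "x < n" "y < m" for a b x y
  proof -
    have "(\<Sum>i<d. \<Sum>j<d. ((if i = j then 1 else 0) + pm a * S x i j) / 2 * (((if i = j then 1 else 0) + pm b * T y i j) / 2)) =
        (\<Sum>i<d. \<Sum>j<d. (if i = j then 1 / 4 + pm a * S x i i / 4 + pm b * T y i i / 4 else 0) + pm a * pm b / 4 * (S x i j * T y i j))"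
      by (rule sum.cong[OF refl], rule sum.cong[OF refl]) (auto simp: field_simps)
    also have "\<dots> = (\<Sum>i<d. 1 / 4 + pm a * S x i i / 4 + pm b * T y i i / 4) + pm a * pm b / 4 * (real d * c x y)"
      unfolding sum.distrib sum_distrib_left[symmetric] ST[OF that] by simp
    also have "(\<Sum>i<d. 1 / 4 + pm a * S x i i / 4 + pm b * T y i i / 4) = real d / 4"
      by (simp add: sum.distrib sum_divide_distrib[symmetric] sum_distrib_left[symmetric] trS trT that)
    finally have "(\<Sum>i<d. \<Sum>j<d. ((if i = j then 1 else 0) + pm a * S x i j) / 2 * (((if i = j then 1 else 0) + pm b * T y i j) / 2)) / real d
        = (1 + pm a * pm b * c x y) / 4"
      using d by (simp add: field_simps)
    moreover have "(\<Sum>i<d. \<Sum>j<d. complex_of_real (f i j) * complex_of_real (g i j)) / of_nat d =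
        complex_of_real ((\<Sum>i<d. \<Sum>j<d. f i j * g i j) / real d)" for f g by simp
    ultimately have "complex_of_real ((1 + pm a * pm b * c x y) / 4) =
        (\<Sum>i<d. \<Sum>j<d. complex_of_real (((if i = j then 1 else 0) + pm a * S x i j) / 2) * complex_of_real (((if i = j then 1 else 0) + pm b * T y i j) / 2)) / of_nat d"
      by (simp only:)
    also have "\<dots> = mtrace (kron d (M S a x) (M T b y) * max_entangled d)"
      unfolding mtrace_kron_max_entangled M_def by simp
    finally show ?thesis .
  qed
  have "has_rep n m 2 2 d (\<lambda>a b x y. (1 + pm a * pm b * c x y) / 4)"
    unfolding has_rep_def
  proof (rule exI[of _ "max_entangled d"], rule exI[of _ "M S"], rule exI[of _ "M T"], intro conjI allI impI)
    show "state d (max_entangled d)" by (rule state_max_entangled[OF d])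
  qed (rule psd psd' one tr; assumption)+
  then show ?thesis ..
qed

text \<open>Tsirelson's theorem from vectors to operators; it puts perturbed matrices back into
  \<open>Cor\<close>, where extremality can be applied to them.\<close>

lemma vec_corr_Cor:
  assumes C: "C \<in> carrier_mat n m" and vc: "vec_corr n m (\<lambda>x y. C $$ (x, y))"
  shows "C \<in> Cor n m"
  using vc
proof (rule vec_corr_symmetric_matrices)
  fix d :: nat and S T :: "nat \<Rightarrow> nat \<Rightarrow> nat \<Rightarrow> real" and \<alpha> \<beta>
  assume d: "d \<ge> 1" and
    S: "\<And>x a b. x < n \<Longrightarrow> a < d \<Longrightarrow> b < d \<Longrightarrow> S x a b = S x b a" and
    T: "\<And>y a b. y < m \<Longrightarrow> a < d \<Longrightarrow> b < d \<Longrightarrow> T y a b = T y b a" and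
    S2: "\<And>x a c. x < n \<Longrightarrow> a < d \<Longrightarrow> c < d \<Longrightarrow> (\<Sum>b<d. S x a b * S x b c) = (if a = c then \<alpha> x else 0)" and
    T2: "\<And>y a c. y < m \<Longrightarrow> a < d \<Longrightarrow> c < d \<Longrightarrow> (\<Sum>b<d. T y a b * T y b c) = (if a = c then \<beta> y else 0)" and
    \<alpha>: "\<And>x. x < n \<Longrightarrow> 0 \<le> \<alpha> x \<and> \<alpha> x \<le> 1" and \<beta>: "\<And>y. y < m \<Longrightarrow> 0 \<le> \<beta> y \<and> \<beta> y \<le> 1" and
    ST: "\<And>x y. x < n \<Longrightarrow> y < m \<Longrightarrow> (\<Sum>a<d. \<Sum>b<d. S x a b * T y a b) = real d * C $$ (x, y)"
  define M where "M = (\<lambda>(W :: nat \<Rightarrow> nat \<Rightarrow> nat \<Rightarrow> real) x. mat d d (\<lambda>(i, j). complex_of_real (W x i j)))"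
  have obs: "observable d (M S x)" if "x < n" for x
    unfolding M_def by (rule scaled_involution_observable[where \<alpha> = "\<alpha> x"]) (use S S2 \<alpha> that in auto)
  have obs': "observable d (M T y)" if "y < m" for y
    unfolding M_def by (rule scaled_involution_observable[where \<alpha> = "\<beta> y"]) (use T T2 \<beta> that in auto)
  have tr: "complex_of_real (C $$ (x, y)) = mtrace (kron d (M S x) (M T y) * max_entangled d)"
    if "x < n" "y < m" for x y
  proof -
    have "C $$ (x, y) = (\<Sum>a<d. \<Sum>b<d. S x a b * T y a b) / real d"
      using d by (simp add: ST[OF that])
    then have "complex_of_real (C $$ (x, y)) = (\<Sum>a<d. \<Sum>b<d. complex_of_real (S x a b) * complex_of_real (T y a b)) / of_nat d"
      by simp
    then show ?thesis unfolding mtrace_kron_max_entangled M_def by simp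
  qed
  have "C $$ (x, y) \<in> {-1..1}" if "x < n" "y < m" for x y
    using vec_corr_abs_le_1[OF vc that] by auto
  then show ?thesis
    unfolding Cor_def using C d state_max_entangled[OF d] obs obs' tr by blast
qed

text \<open>C is the midpoint of C + e and C - e, and both are quantum correlations as soon as they
  come from vectors.\<close>

lemma extreme_point_rigid:
  assumes ext: "extreme_point_mat (Cor n m) C"
  shows "rigid n m (\<lambda>x y. C $$ (x, y))"
  unfolding rigid_def
proof (intro allI impI; elim conjE)
  fix e x y
  assume e: "vec_corr n m (\<lambda>x y. C $$ (x, y) + e x y)" "vec_corr n m (\<lambda>x y. C $$ (x, y) - e x y)"
    and xy: "x < n" "y < m"
  have C: "C \<in> carrier_mat n m" using ext by (simp add: extreme_point_mat_def Cor_def)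
  define A where "A = (\<lambda>s. mat n m (\<lambda>(x, y). C $$ (x, y) + s * e x y))"
  have vc: "vec_corr n m (\<lambda>x y. A s $$ (x, y)) \<longleftrightarrow> vec_corr n m (\<lambda>x y. C $$ (x, y) + s * e x y)" for s
    unfolding vec_corr_def A_def by simp
  have "A 1 \<in> Cor n m" "A (-1) \<in> Cor n m"
    using e by (auto intro!: vec_corr_Cor simp: vc) (simp_all add: A_def)
  moreover have "C = (1 / 2) \<cdot>\<^sub>m A 1 + (1 - 1 / 2) \<cdot>\<^sub>m A (-1)"
    using C by (intro eq_matI) (auto simp: A_def field_simps)
  ultimately have "A 1 = C" using ext unfolding extreme_point_mat_def
    by (metis half_gt_zero_iff less_numeral_extra(1) field_sum_of_halves less_add_same_cancel1)
  then have "A 1 $$ (x, y) = C $$ (x, y)" by simp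
  then show "e x y = 0" using xy by (simp add: A_def)
qed

section \<open>Observables as contractions\<close>

text \<open>Compactness of the unit sphere gives a minimizer z; a Gram factorization of A - mu shows that z is in its kernel.\<close>
lemma hermitian_minimum_eigenvalue:
  fixes A :: "nat \<Rightarrow> nat \<Rightarrow> complex"
  assumes d: "d \<ge> 1" and herm: "\<And>i j. i < d \<Longrightarrow> j < d \<Longrightarrow> A j i = cnj (A i j)"
  obtains \<mu> :: real and z where "\<exists>i<d. z i \<noteq> 0"
    "\<And>i. i < d \<Longrightarrow> (\<Sum>j<d. A i j * z j) = of_real \<mu> * z i"
    "\<And>w. \<mu> * (\<Sum>i<d. (cmod (w i))\<^sup>2) \<le> Re (\<Sum>i<d. \<Sum>j<d. A i j * w j * cnj (w i))"
proof -
  define q where "q = (\<lambda>w. Re (\<Sum>i<d. \<Sum>j<d. A i j * w j * cnj (w i)))"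
  define N where "N = (\<lambda>w :: nat \<Rightarrow> complex. \<Sum>i<d. (cmod (w i))\<^sup>2)"
  \<comment> \<open>Coordinates from d on are fixed at 0, which makes the unit sphere of C^d a
    closed subset of a product of closed discs, compact in the product topology on
    functions.\<close>
  define S where "S = {z. (\<forall>i. d \<le> i \<longrightarrow> z i = 0) \<and> N z = 1}"
  have "compactin (product_topology (\<lambda>_::nat. euclidean) UNIV) (PiE UNIV (\<lambda>_. cball (0::complex) 1))"
    unfolding compactin_PiE by simp
  then have box: "compact (PiE UNIV (\<lambda>_::nat. cball (0::complex) 1))"
    by (simp add: euclidean_product_topology)
  have "closed {z :: nat \<Rightarrow> complex. \<forall>i. d \<le> i \<longrightarrow> z i = 0}"
    by (intro closed_Collect_all closed_Collect_imp open_Collect_const closed_Collect_eq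
        continuous_on_product_coordinates continuous_on_const)
  moreover have contN: "continuous_on UNIV N"
    unfolding N_def by (intro continuous_intros continuous_on_product_coordinates)
  ultimately have closedS: "closed S"
    unfolding S_def by (intro closed_Collect_conj closed_Collect_eq continuous_on_const) auto
  have "S \<subseteq> PiE UNIV (\<lambda>_. cball 0 1)"
  proof
    fix z assume z: "z \<in> S"
    have "cmod (z i) \<le> 1" for i
    proof (cases "i < d")
      case True
      then have "(cmod (z i))\<^sup>2 \<le> N z"
        unfolding N_def by (intro member_le_sum) auto
      then show ?thesis using z by (simp add: S_def power2_le_iff_abs_le abs_square_le_1)
    qed (use z in \<open>simp add: S_def\<close>)
    then show "z \<in> PiE UNIV (\<lambda>_. cball 0 1)" by (auto simp: PiE_def Pi_def)
  qed
  then have compS: "compact S"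
    using compact_Int_closed[OF box closedS] by (simp add: inf.absorb2)
  have "(\<lambda>i. if i = 0 then 1 else 0) \<in> S"
    using d by (auto simp: S_def N_def if_distrib[of "\<lambda>z. (cmod z)\<^sup>2"] cong: if_cong)
  then have neS: "S \<noteq> {}" by blast
  have "continuous_on UNIV q"
    unfolding q_def by (intro continuous_intros continuous_on_product_coordinates)
  then have "continuous_on S q" by (rule continuous_on_subset) simp
  then obtain z where z: "z \<in> S" and zmin: "\<And>w. w \<in> S \<Longrightarrow> q z \<le> q w"
    using continuous_attains_inf[OF compS neS] by blast
  have min: "q z * N w \<le> q w" for w
  proof (cases "N w = 0")
    case True
    then have "\<forall>i<d. w i = 0" unfolding N_def by (subst (asm) sum_nonneg_eq_0_iff) auto
    then show ?thesis using True by (simp add: q_def)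
  next
    case False
    then have Npos: "N w > 0" using sum_nonneg[of "{..<d}" "\<lambda>i. (cmod (w i))\<^sup>2"] by (simp add: N_def)
    define t where "t = 1 / sqrt (N w)"
    have t2: "t * t = 1 / N w" using Npos by (simp add: t_def)
    define w' where "w' = (\<lambda>i. if i < d then of_real t * w i else 0)"
    have "N w' = (\<Sum>i<d. (t * t) * (cmod (w i))\<^sup>2)"
      unfolding N_def w'_def by (intro sum.cong) (auto simp: norm_mult power_mult_distrib power2_eq_square)
    also have "\<dots> = 1" unfolding sum_distrib_left[symmetric] t2 using Npos by (simp add: N_def)
    finally have "w' \<in> S" by (simp add: S_def w'_def)
    have "(\<Sum>i<d. \<Sum>j<d. A i j * w' j * cnj (w' i)) = (\<Sum>i<d. \<Sum>j<d. of_real (t * t) * (A i j * w j * cnj (w i)))"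
      by (intro sum.cong refl) (simp add: w'_def)
    then have "q w' = (t * t) * q w"
      unfolding q_def by (simp only: sum_distrib_left[symmetric] Re_complex_of_real times_complex.sel Im_complex_of_real)
    then have "q z \<le> q w / N w" using zmin[OF \<open>w' \<in> S\<close>] by (simp add: t2)
    then show ?thesis using Npos by (simp add: field_simps)
  qed
  define G where "G = (\<lambda>i j. A i j - (if i = j then of_real (q z) else 0))"
  have Gform: "(\<Sum>i<d. \<Sum>j<d. G i j * w j * cnj (w i)) =
      (\<Sum>i<d. \<Sum>j<d. A i j * w j * cnj (w i)) - of_real (q z * N w)" for w
  proof -
    have "(\<Sum>i<d. \<Sum>j<d. G i j * w j * cnj (w i)) =
        (\<Sum>i<d. \<Sum>j<d. A i j * w j * cnj (w i) - (if j = i then of_real (q z) * (w i * cnj (w i)) else 0))"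
      by (intro sum.cong refl) (auto simp: G_def algebra_simps)
    then show ?thesis
      by (simp add: sum_subtractf N_def sum_distrib_left complex_norm_square del: of_real_power)
  qed
  then have reG: "Re (\<Sum>i<d. \<Sum>j<d. G i j * w j * cnj (w i)) = q w - q z * N w" for w
    unfolding q_def by (simp only: minus_complex.sel Re_complex_of_real)
  have "0 \<le> Re (\<Sum>x<d. \<Sum>y<d. w x * G x y * cnj (w y))" for w
  proof -
    have "(\<Sum>x<d. \<Sum>y<d. w x * G x y * cnj (w y)) = (\<Sum>i<d. \<Sum>j<d. G i j * cnj (w j) * cnj (cnj (w i)))"
      by (simp add: mult_ac)
    then show ?thesis
      using min[of "\<lambda>i. cnj (w i)"] reG[of "\<lambda>i. cnj (w i)"] by (simp only:)
  qed
  moreover have "G j i = cnj (G i j)" if "i < d" "j < d" for i j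
    using herm[OF that] by (simp add: G_def)
  ultimately obtain r :: nat and U where U: "\<forall>i<d. \<forall>j<d. G i j = (\<Sum>l<r. U i l * cnj (U j l))"
    using psd_gram_factorization[of d G] by blast
  define h where "h = (\<lambda>l. \<Sum>j<d. cnj (U j l) * z j)"
  have "(\<Sum>i<d. \<Sum>j<d. G i j * z j * cnj (z i)) = (\<Sum>i<d. \<Sum>j<d. \<Sum>l<r. U i l * cnj (U j l) * z j * cnj (z i))"
    using U by (intro sum.cong refl) (simp add: sum_distrib_right)
  also have "\<dots> = (\<Sum>i<d. \<Sum>l<r. \<Sum>j<d. U i l * cnj (U j l) * z j * cnj (z i))"
    by (rule sum.cong[OF refl], rule sum.swap)
  also have "\<dots> = (\<Sum>l<r. \<Sum>i<d. \<Sum>j<d. U i l * cnj (U j l) * z j * cnj (z i))" by (rule sum.swap)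
  also have "\<dots> = (\<Sum>l<r. \<Sum>i<d. \<Sum>j<d. (cnj (cnj (U i l) * z i)) * (cnj (U j l) * z j))"
    by (simp add: mult_ac)
  also have "\<dots> = (\<Sum>l<r. of_real ((cmod (h l))\<^sup>2))"
    unfolding complex_norm_square h_def cnj_sum sum_product[symmetric] by (simp add: mult.commute)
  finally have "Re (\<Sum>i<d. \<Sum>j<d. G i j * z j * cnj (z i)) = (\<Sum>l<r. (cmod (h l))\<^sup>2)"
    by simp
  moreover have "Re (\<Sum>i<d. \<Sum>j<d. G i j * z j * cnj (z i)) = 0"
    using z unfolding reG by (simp add: S_def)
  ultimately have "(\<Sum>l<r. (cmod (h l))\<^sup>2) = 0" by simp
  then have h0: "\<forall>l<r. h l = 0" by (subst (asm) sum_nonneg_eq_0_iff) auto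
  show ?thesis
  proof (rule that[where \<mu> = "q z" and z = z])
    show "\<exists>i<d. z i \<noteq> 0"
    proof (rule ccontr)
      assume "\<not> (\<exists>i<d. z i \<noteq> 0)"
      then have "N z = 0" by (simp add: N_def)
      then show False using z by (simp add: S_def)
    qed
    show "(\<Sum>j<d. A i j * z j) = of_real (q z) * z i" if i: "i < d" for i
    proof -
      have "(\<Sum>j<d. G i j * z j) = (\<Sum>j<d. \<Sum>l<r. U i l * (cnj (U j l) * z j))"
        using U i by (intro sum.cong refl) (simp add: sum_distrib_right mult.assoc)
      also have "\<dots> = (\<Sum>l<r. U i l * h l)"
        unfolding h_def sum_distrib_left by (rule sum.swap)
      also have "\<dots> = 0" using h0 by simp
      finally have "(\<Sum>j<d. A i j * z j - (if i = j then of_real (q z) * z i else 0)) = 0"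
        by (simp add: G_def left_diff_distrib if_distrib[of "\<lambda>w. w * _"] cong: if_cong)
      then show ?thesis using i by (simp add: sum_subtractf)
    qed
  qed (use min in \<open>simp only: q_def N_def\<close>)
qed

text \<open>-1 \<le> A \<le> 1 as an inequality of quadratic forms: a common footing for
  observables, which are given by their eigenvalues, and for differences of two effects, which are
  given by positivity.\<close>

definition herm_contraction :: "nat \<Rightarrow> complex mat \<Rightarrow> bool" where
  "herm_contraction d A \<longleftrightarrow> (\<forall>i<d. \<forall>j<d. A $$ (j, i) = cnj (A $$ (i, j))) \<and>
     (\<forall>z. \<bar>Re (\<Sum>i<d. \<Sum>j<d. A $$ (i, j) * z j * cnj (z i))\<bar> \<le> (\<Sum>i<d. (cmod (z i))\<^sup>2))"

text \<open>The minimum of the form on the sphere is an eigenvalue, hence at least -1. The upper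
  bound is the same argument for -M.\<close>

lemma observable_herm_contraction:
  assumes "observable d M"
  shows "herm_contraction d M"
proof (cases "d = 0")
  case False
  then have d: "d \<ge> 1" by simp
  have M: "M \<in> carrier_mat d d" and herm: "\<And>i j. i < d \<Longrightarrow> j < d \<Longrightarrow> M $$ (j, i) = cnj (M $$ (i, j))"
    and spec: "\<And>k. eigenvalue M k \<Longrightarrow> k \<in> complex_of_real ` {-1..1}"
    using assms unfolding observable_def herm_iff by blast+
  have ev: "-1 \<le> \<mu> \<and> \<mu> \<le> 1" if z: "\<exists>i<d. z i \<noteq> 0" "\<And>i. i < d \<Longrightarrow> (\<Sum>j<d. M $$ (i, j) * z j) = of_real \<mu> * z i" for \<mu> z
  proof -
    have "vec d z \<noteq> 0\<^sub>v d" using z(1) by (metis index_vec index_zero_vec(1))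
    moreover have "M *\<^sub>v vec d z = complex_of_real \<mu> \<cdot>\<^sub>v vec d z"
      using M z(2) by (intro eq_vecI) (auto simp: scalar_prod_def atLeast0LessThan)
    ultimately have "eigenvalue M (of_real \<mu>)"
      using M unfolding eigenvalue_def eigenvector_def by (intro exI[of _ "vec d z"]) auto
    then show ?thesis using spec by fastforce
  qed
  have lower: "- (\<Sum>i<d. (cmod (w i))\<^sup>2) \<le> Re (\<Sum>i<d. \<Sum>j<d. M $$ (i, j) * w j * cnj (w i))" for w
  proof -
    obtain \<mu> z where mz: "\<exists>i<d. z i \<noteq> 0" "\<And>i. i < d \<Longrightarrow> (\<Sum>j<d. M $$ (i, j) * z j) = of_real \<mu> * z i"
      and min: "\<And>w. \<mu> * (\<Sum>i<d. (cmod (w i))\<^sup>2) \<le> Re (\<Sum>i<d. \<Sum>j<d. M $$ (i, j) * w j * cnj (w i))"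
      by (rule hermitian_minimum_eigenvalue[of d "\<lambda>i j. M $$ (i, j)", OF d herm]) (assumption | (rule that; assumption))+
    have "(-1) * (\<Sum>i<d. (cmod (w i))\<^sup>2) \<le> \<mu> * (\<Sum>i<d. (cmod (w i))\<^sup>2)"
      using ev[OF mz] by (intro mult_right_mono sum_nonneg) auto
    then show ?thesis using min[of w] by simp
  qed
  have upper: "Re (\<Sum>i<d. \<Sum>j<d. M $$ (i, j) * w j * cnj (w i)) \<le> (\<Sum>i<d. (cmod (w i))\<^sup>2)" for w
  proof -
    have herm': "- M $$ (j, i) = cnj (- M $$ (i, j))" if "i < d" "j < d" for i j
      using herm[OF that] by simp
    obtain \<mu> z where mz: "\<exists>i<d. z i \<noteq> 0" "\<And>i. i < d \<Longrightarrow> (\<Sum>j<d. - M $$ (i, j) * z j) = of_real \<mu> * z i"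
      and min: "\<And>w. \<mu> * (\<Sum>i<d. (cmod (w i))\<^sup>2) \<le> Re (\<Sum>i<d. \<Sum>j<d. - M $$ (i, j) * w j * cnj (w i))"
      by (rule hermitian_minimum_eigenvalue[of d "\<lambda>i j. - M $$ (i, j)", OF d herm']) (assumption | (rule that; assumption))+
    have "(\<Sum>j<d. M $$ (i, j) * z j) = of_real (- \<mu>) * z i" if "i < d" for i
      using mz(2)[OF that] by (simp add: sum_negf minus_equation_iff)
    then have "-1 \<le> \<mu>" using ev[OF mz(1), of "- \<mu>"] by simp
    then have "(-1) * (\<Sum>i<d. (cmod (w i))\<^sup>2) \<le> \<mu> * (\<Sum>i<d. (cmod (w i))\<^sup>2)"
      by (intro mult_right_mono sum_nonneg) auto
    then show ?thesis using min[of w] by (simp add: sum_negf)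
  qed
  have "\<bar>Re (\<Sum>i<d. \<Sum>j<d. M $$ (i, j) * w j * cnj (w i))\<bar> \<le> (\<Sum>i<d. (cmod (w i))\<^sup>2)" for w
    using lower[of w] upper[of w] by linarith
  then show ?thesis unfolding herm_contraction_def using herm by blast
qed (simp add: herm_contraction_def)

text \<open>Polarization in place of diagonalization: with Y the multiple of \<open>T X\<close> that
  has the length of X, 4 <T X, Y> is a difference of values of the form at X + Y and X - Y, so it is
  at most 2 |X|^2 + 2 |Y|^2 = 4 |X|^2.\<close>

lemma numerical_radius_contraction:
  fixes T :: "'a::real_inner \<Rightarrow> 'a"
  assumes lin: "linear T" and sa: "\<And>X Y. inner (T X) Y = inner X (T Y)"
    and nr: "\<And>X. \<bar>inner (T X) X\<bar> \<le> inner X X"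
  shows "norm (T X) \<le> norm X"
proof (cases "T X = 0")
  case False
  define a where "a = norm X"
  define b where "b = norm (T X)"
  have b: "b > 0" using False by (simp add: b_def)
  have a: "a > 0" using False linear_0[OF lin] by (auto simp: a_def)
  define Y where "Y = (a / b) *\<^sub>R T X"
  have "norm Y = a" using a b by (simp add: Y_def b_def)
  then have YY: "inner Y Y = a\<^sup>2" by (simp add: power2_norm_eq_inner[symmetric])
  have XX: "inner X X = a\<^sup>2" by (simp add: a_def power2_norm_eq_inner)
  have TXY: "inner (T X) Y = a * b"
    using b by (simp add: Y_def b_def power2_norm_eq_inner[symmetric] power2_eq_square)
  have "4 * inner (T X) Y = inner (T (X + Y)) (X + Y) - inner (T (X - Y)) (X - Y)"
    by (simp add: linear_add[OF lin] linear_diff[OF lin] inner_add inner_diff sa[of Y X] inner_commute[of Y "T X"])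
  also have "\<dots> \<le> inner (X + Y) (X + Y) + inner (X - Y) (X - Y)"
    using nr[of "X + Y"] nr[of "X - Y"] by linarith
  also have "\<dots> = 2 * inner X X + 2 * inner Y Y" by (simp add: inner_add inner_diff)
  finally have "a * b \<le> a * a" using TXY XX YY by (simp add: power2_eq_square)
  then show ?thesis using a by (simp add: a_def b_def)
qed simp

section \<open>Purification of a bipartite state\<close>

text \<open>Entry (i, j, l) belongs to Alice's index i, Bob's index j and the purifying index l.\<close>
type_synonym tvec = "(nat \<times> nat \<times> nat) \<Rightarrow>\<^sub>0 complex"

text \<open>Zero outside the box, so that the operator is defined on every vector of the type and
  returns finite support.\<close>

lift_definition alice :: "nat \<Rightarrow> nat \<Rightarrow> complex mat \<Rightarrow> tvec \<Rightarrow> tvec" is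
  "\<lambda>d r A X (i, j, l). if i < d \<and> j < d \<and> l < r then \<Sum>k<d. A $$ (i, k) * X (k, j, l) else 0"
  by (rule finite_subset[where B = "{..<d} \<times> {..<d} \<times> {..<r}" for d r]) (auto split: if_splits)

lift_definition bob :: "nat \<Rightarrow> nat \<Rightarrow> complex mat \<Rightarrow> tvec \<Rightarrow> tvec" is
  "\<lambda>d r B X (i, j, l). if i < d \<and> j < d \<and> l < r then \<Sum>k<d. B $$ (j, k) * X (i, k, l) else 0"
  by (rule finite_subset[where B = "{..<d} \<times> {..<d} \<times> {..<r}" for d r]) (auto split: if_splits)

lift_definition imul :: "tvec \<Rightarrow> tvec" is "\<lambda>X s. \<i> * X s" by simp

text \<open>Projection onto one value of the purifying index. It commutes with both parties'
  operators and cuts the box down to d * d coordinates.\<close>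

lift_definition layer :: "nat \<Rightarrow> tvec \<Rightarrow> tvec" is "\<lambda>l0 X (i, j, l). if l = l0 then X (i, j, l) else 0"
  by (erule finite_subset[rotated]) (auto split: if_splits)

abbreviation tbox :: "nat \<Rightarrow> nat \<Rightarrow> (nat \<times> nat \<times> nat) set" where
  "tbox d r \<equiv> {..<d} \<times> {..<d} \<times> {..<r}"

lemma tvec_eqI: "(\<And>i j l. Poly_Mapping.lookup X (i, j, l) = Poly_Mapping.lookup Y (i, j, l)) \<Longrightarrow> X = (Y :: tvec)"
  by (rule poly_mapping_eqI) auto

lemmas lookup_scaleR = scaleR_poly_mapping.rep_eq

lemma linear_alice: "linear (alice d r A)"
  by (intro linearI tvec_eqI)
    (auto simp: alice.rep_eq lookup_add lookup_scaleR distrib_left sum.distrib scaleR_sum_right)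

lemma linear_bob: "linear (bob d r B)"
  by (intro linearI tvec_eqI)
    (auto simp: bob.rep_eq lookup_add lookup_scaleR distrib_left sum.distrib scaleR_sum_right)

lemma linear_imul: "linear imul"
  by (intro linearI tvec_eqI) (auto simp: imul.rep_eq lookup_add lookup_scaleR distrib_left)

lemma linear_layer: "linear (layer l)"
  by (intro linearI tvec_eqI) (auto simp: layer.rep_eq lookup_add lookup_scaleR)

lemma alice_bob_commute: "alice d r A (bob d r B X) = bob d r B (alice d r A X)"
proof (rule tvec_eqI)
  fix i j l
  have "(\<Sum>k<d. A $$ (i, k) * (\<Sum>q<d. B $$ (j, q) * Poly_Mapping.lookup X (k, q, l))) =
      (\<Sum>k<d. \<Sum>q<d. A $$ (i, k) * (B $$ (j, q) * Poly_Mapping.lookup X (k, q, l)))"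
    by (simp add: sum_distrib_left)
  also have "\<dots> = (\<Sum>q<d. \<Sum>k<d. A $$ (i, k) * (B $$ (j, q) * Poly_Mapping.lookup X (k, q, l)))"
    by (rule sum.swap)
  also have "\<dots> = (\<Sum>q<d. B $$ (j, q) * (\<Sum>k<d. A $$ (i, k) * Poly_Mapping.lookup X (k, q, l)))"
    by (simp add: sum_distrib_left mult.left_commute)
  finally show "Poly_Mapping.lookup (alice d r A (bob d r B X)) (i, j, l) =
      Poly_Mapping.lookup (bob d r B (alice d r A X)) (i, j, l)"
    by (simp add: alice.rep_eq bob.rep_eq)
qed

lemma imul_alice: "imul (alice d r A X) = alice d r A (imul X)"
  by (rule tvec_eqI) (simp add: imul.rep_eq alice.rep_eq sum_distrib_left mult.left_commute)

lemma imul_imul: "imul (imul X) = - X"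
  by (rule tvec_eqI) (simp add: imul.rep_eq mult.assoc[symmetric])

lemma layer_alice: "layer l (alice d r A X) = alice d r A (layer l X)"
  by (rule tvec_eqI) (simp add: layer.rep_eq alice.rep_eq)

lemma layer_bob: "layer l (bob d r B X) = bob d r B (layer l X)"
  by (rule tvec_eqI) (simp add: layer.rep_eq bob.rep_eq)

lemma inner_imul: "inner (imul X) Y = - inner X (imul Y)"
proof -
  have "Poly_Mapping.keys (imul X) \<subseteq> Poly_Mapping.keys X" by (auto simp: in_keys_iff imul.rep_eq)
  then show ?thesis
    by (simp add: inner_poly_mapping_eq_sum[of "Poly_Mapping.keys X"] imul.rep_eq inner_complex_def
        sum_negf[symmetric] algebra_simps)
qed

lemma keys_alice: "Poly_Mapping.keys (alice d r A X) \<subseteq> tbox d r"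
  by (auto simp: in_keys_iff alice.rep_eq split: if_splits)

lemma keys_bob: "Poly_Mapping.keys (bob d r A X) \<subseteq> tbox d r"
  by (auto simp: in_keys_iff bob.rep_eq split: if_splits)

lemma inner_box:
  fixes X Y :: tvec
  assumes "Poly_Mapping.keys X \<subseteq> tbox d r"
  shows "inner X Y = (\<Sum>i<d. \<Sum>j<d. \<Sum>l<r.
    Re (Poly_Mapping.lookup X (i, j, l) * cnj (Poly_Mapping.lookup Y (i, j, l))))"
proof -
  have "inner X Y = (\<Sum>(i, j, l)\<in>tbox d r. Re (Poly_Mapping.lookup X (i, j, l) * cnj (Poly_Mapping.lookup Y (i, j, l))))"
    using assms by (subst inner_poly_mapping_eq_sum[of "tbox d r"]) (auto simp: inner_complex_def intro!: sum.cong)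
  then show ?thesis by (simp add: sum.cartesian_product split_def)
qed

text \<open>Only an inequality, because X may have entries outside the box.\<close>

lemma sum_box_le_inner:
  fixes X :: tvec
  shows "(\<Sum>i<d. \<Sum>j<d. \<Sum>l<r. (cmod (Poly_Mapping.lookup X (i, j, l)))\<^sup>2) \<le> inner X X"
proof -
  have "(\<Sum>i<d. \<Sum>j<d. \<Sum>l<r. (cmod (Poly_Mapping.lookup X (i, j, l)))\<^sup>2) =
      (\<Sum>s\<in>tbox d r. (cmod (Poly_Mapping.lookup X s))\<^sup>2)"
    by (simp add: sum.cartesian_product split_def)
  also have "\<dots> \<le> (\<Sum>s\<in>tbox d r \<union> Poly_Mapping.keys X. (cmod (Poly_Mapping.lookup X s))\<^sup>2)"
    by (intro sum_mono2) auto
  also have "\<dots> = inner X X"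
    by (subst inner_poly_mapping_eq_sum[of "tbox d r \<union> Poly_Mapping.keys X"]) (auto simp: power2_norm_eq_inner)
  finally show ?thesis .
qed

text \<open>The sesquilinear form of A. The forms of \<open>alice\<close> and \<open>bob\<close> are
  sums of copies of it, one for each value of the two remaining indices.\<close>

definition sesq :: "nat \<Rightarrow> complex mat \<Rightarrow> (nat \<Rightarrow> complex) \<Rightarrow> (nat \<Rightarrow> complex) \<Rightarrow> complex" where
  "sesq d A f g = (\<Sum>i<d. \<Sum>k<d. A $$ (i, k) * f k * cnj (g i))"

lemma inner_alice:
  "inner (alice d r A X) Y = (\<Sum>j<d. \<Sum>l<r. Re (sesq d A (\<lambda>i. Poly_Mapping.lookup X (i, j, l)) (\<lambda>i. Poly_Mapping.lookup Y (i, j, l))))"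
proof -
  have "inner (alice d r A X) Y = (\<Sum>i<d. \<Sum>j<d. \<Sum>l<r.
      Re (\<Sum>k<d. A $$ (i, k) * Poly_Mapping.lookup X (k, j, l) * cnj (Poly_Mapping.lookup Y (i, j, l))))"
    unfolding inner_box[OF keys_alice]
    by (intro sum.cong refl arg_cong[where f = Re]) (simp add: alice.rep_eq sum_distrib_right)
  also have "\<dots> = (\<Sum>j<d. \<Sum>i<d. \<Sum>l<r.
      Re (\<Sum>k<d. A $$ (i, k) * Poly_Mapping.lookup X (k, j, l) * cnj (Poly_Mapping.lookup Y (i, j, l))))"
    by (rule sum.swap)
  also have "\<dots> = (\<Sum>j<d. \<Sum>l<r. \<Sum>i<d.
      Re (\<Sum>k<d. A $$ (i, k) * Poly_Mapping.lookup X (k, j, l) * cnj (Poly_Mapping.lookup Y (i, j, l))))"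
    by (rule sum.cong[OF refl], rule sum.swap)
  finally show ?thesis unfolding sesq_def by (simp only: Re_sum)
qed

lemma inner_bob:
  "inner (bob d r A X) Y = (\<Sum>i<d. \<Sum>l<r. Re (sesq d A (\<lambda>j. Poly_Mapping.lookup X (i, j, l)) (\<lambda>j. Poly_Mapping.lookup Y (i, j, l))))"
proof -
  have "inner (bob d r A X) Y = (\<Sum>i<d. \<Sum>j<d. \<Sum>l<r.
      Re (\<Sum>k<d. A $$ (j, k) * Poly_Mapping.lookup X (i, k, l) * cnj (Poly_Mapping.lookup Y (i, j, l))))"
    unfolding inner_box[OF keys_bob]
    by (intro sum.cong refl arg_cong[where f = Re]) (simp add: bob.rep_eq sum_distrib_right)
  also have "\<dots> = (\<Sum>i<d. \<Sum>l<r. \<Sum>j<d.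
      Re (\<Sum>k<d. A $$ (j, k) * Poly_Mapping.lookup X (i, k, l) * cnj (Poly_Mapping.lookup Y (i, j, l))))"
    by (rule sum.cong[OF refl], rule sum.swap)
  finally show ?thesis unfolding sesq_def by (simp only: Re_sum)
qed

lemma sesq_commute:
  assumes "herm_contraction d A"
  shows "sesq d A g f = cnj (sesq d A f g)"
proof -
  have h: "cnj (A $$ (i, j)) = A $$ (j, i)" if "i < d" "j < d" for i j
    by (rule sym) (use assms that in \<open>unfold herm_contraction_def, blast\<close>)
  have "cnj (sesq d A f g) = (\<Sum>i<d. \<Sum>k<d. A $$ (k, i) * g i * cnj (f k))"
    unfolding sesq_def cnj_sum by (intro sum.cong refl) (simp add: h)
  also have "\<dots> = sesq d A g f" unfolding sesq_def by (rule sum.swap)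
  finally show ?thesis ..
qed

lemma sesq_bound:
  assumes "herm_contraction d A"
  shows "\<bar>Re (sesq d A f f)\<bar> \<le> (\<Sum>i<d. (cmod (f i))\<^sup>2)"
  using assms unfolding herm_contraction_def sesq_def by blast

lemma selfadjoint_alice:
  assumes "herm_contraction d A"
  shows "inner (alice d r A X) Y = inner X (alice d r A Y)"
  unfolding inner_commute[of X] inner_alice
  by (intro sum.cong refl) (subst sesq_commute[OF assms], simp)

lemma selfadjoint_bob:
  assumes "herm_contraction d A"
  shows "inner (bob d r A X) Y = inner X (bob d r A Y)"
  unfolding inner_commute[of X] inner_bob
  by (intro sum.cong refl) (subst sesq_commute[OF assms], simp)

lemma contraction_alice:
  assumes "herm_contraction d A"
  shows "norm (alice d r A X) \<le> norm X"
proof (rule numerical_radius_contraction[OF linear_alice selfadjoint_alice[OF assms]])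
  fix X :: tvec
  let ?x = "\<lambda>i j l. Poly_Mapping.lookup X (i, j, l)"
  have "\<bar>inner (alice d r A X) X\<bar> \<le> (\<Sum>j<d. \<Sum>l<r. \<bar>Re (sesq d A (\<lambda>i. ?x i j l) (\<lambda>i. ?x i j l))\<bar>)"
    unfolding inner_alice by (rule order_trans[OF sum_abs]) (intro sum_mono sum_abs)
  also have "\<dots> \<le> (\<Sum>j<d. \<Sum>l<r. \<Sum>i<d. (cmod (?x i j l))\<^sup>2)"
    by (intro sum_mono sesq_bound[OF assms])
  also have "\<dots> = (\<Sum>j<d. \<Sum>i<d. \<Sum>l<r. (cmod (?x i j l))\<^sup>2)"
    by (rule sum.cong[OF refl], rule sum.swap)
  also have "\<dots> = (\<Sum>i<d. \<Sum>j<d. \<Sum>l<r. (cmod (?x i j l))\<^sup>2)" by (rule sum.swap)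
  also have "\<dots> \<le> inner X X" by (rule sum_box_le_inner)
  finally show "\<bar>inner (alice d r A X) X\<bar> \<le> inner X X" .
qed

lemma contraction_bob:
  assumes "herm_contraction d A"
  shows "norm (bob d r A X) \<le> norm X"
proof (rule numerical_radius_contraction[OF linear_bob selfadjoint_bob[OF assms]])
  fix X :: tvec
  let ?x = "\<lambda>i j l. Poly_Mapping.lookup X (i, j, l)"
  have "\<bar>inner (bob d r A X) X\<bar> \<le> (\<Sum>i<d. \<Sum>l<r. \<bar>Re (sesq d A (\<lambda>j. ?x i j l) (\<lambda>j. ?x i j l))\<bar>)"
    unfolding inner_bob by (rule order_trans[OF sum_abs]) (intro sum_mono sum_abs)
  also have "\<dots> \<le> (\<Sum>i<d. \<Sum>l<r. \<Sum>j<d. (cmod (?x i j l))\<^sup>2)"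
    by (intro sum_mono sesq_bound[OF assms])
  also have "\<dots> = (\<Sum>i<d. \<Sum>j<d. \<Sum>l<r. (cmod (?x i j l))\<^sup>2)"
    by (rule sum.cong[OF refl], rule sum.swap)
  also have "\<dots> \<le> inner X X" by (rule sum_box_le_inner)
  finally show "\<bar>inner (bob d r A X) X\<bar> \<le> inner X X" .
qed

text \<open>The columns of a Gram factor of \<rho> are unnormalized pure states on the two parties;
  stacked along a third index they form P. The trace is then <A B P, P>, and self-adjointness moves
  A to the other side.\<close>

lemma state_purification:
  assumes "state d \<rho>"
  obtains r and P :: tvec where "norm P = 1" "Poly_Mapping.keys P \<subseteq> tbox d r"
    "\<And>A B c. herm_contraction d A \<Longrightarrow> herm_contraction d B \<Longrightarrow>
       complex_of_real c = mtrace (kron d A B * \<rho>) \<Longrightarrow> c = inner (alice d r A P) (bob d r B P)"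
proof -
  have \<rho>: "\<rho> \<in> carrier_mat (d * d) (d * d)"
    and herm: "\<forall>i<d * d. \<forall>j<d * d. \<rho> $$ (j, i) = cnj (\<rho> $$ (i, j))"
    and psd: "\<forall>z. 0 \<le> Re (\<Sum>i<d * d. \<Sum>j<d * d. \<rho> $$ (i, j) * z j * cnj (z i))"
    and tr: "mtrace \<rho> = 1"
    using assms unfolding state_def psd_iff by blast+
  \<comment> \<open>The factorization conjugates the column variable, positivity the row variable;
    substituting the conjugate vector passes between them.\<close>
  have "0 \<le> Re (\<Sum>x<d * d. \<Sum>y<d * d. z x * \<rho> $$ (x, y) * cnj (z y))" for z
    using psd[rule_format, of "\<lambda>i. cnj (z i)"] by (simp only: complex_cnj_cnj mult_ac)
  then obtain r :: nat and U where U: "\<forall>x<d * d. \<forall>y<d * d. \<rho> $$ (x, y) = (\<Sum>l<r. U x l * cnj (U y l))"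
    using psd_gram_factorization[of "d * d" "\<lambda>x y. \<rho> $$ (x, y)"] herm by blast
  define f where "f = (\<lambda>(i, j, l). if (i, j, l) \<in> tbox d r then U (i * d + j) l else 0)"
  define P :: tvec where "P = Abs_poly_mapping f"
  have "{s. f s \<noteq> 0} \<subseteq> tbox d r" by (auto simp: f_def split: if_splits)
  then have "finite {s. f s \<noteq> 0}" by (rule finite_subset) simp
  then have lP: "Poly_Mapping.lookup P = f" by (simp add: P_def)
  have keys: "Poly_Mapping.keys P \<subseteq> tbox d r"
    by (auto simp: in_keys_iff lP f_def split: if_splits)
  have P: "Poly_Mapping.lookup P (i, j, l) = U (i * d + j) l" if "i < d" "j < d" "l < r" for i j l
    using that by (simp add: lP f_def)
  have idx: "i * d + j < d * d" if "i < d" "j < d" for i j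
  proof -
    have "i * d + j < Suc i * d" using that by simp
    also have "\<dots> \<le> d * d" using that by (intro mult_le_mono1) simp
    finally show ?thesis .
  qed
  have \<rho>P: "\<rho> $$ (i * d + j, k * d + q) =
      (\<Sum>l<r. Poly_Mapping.lookup P (i, j, l) * cnj (Poly_Mapping.lookup P (k, q, l)))"
    if "i < d" "j < d" "k < d" "q < d" for i j k q
    using U idx that by (simp add: P)
  have "inner P P = Re (\<Sum>i<d. \<Sum>j<d. \<rho> $$ (i * d + j, i * d + j))"
    unfolding inner_box[OF keys] Re_sum by (intro sum.cong refl) (simp add: \<rho>P)
  also have "(\<Sum>i<d. \<Sum>j<d. \<rho> $$ (i * d + j, i * d + j)) = mtrace \<rho>"
    using \<rho> sum_div_mod[of "\<lambda>i j. \<rho> $$ (i * d + j, i * d + j)" d] by (simp add: mtrace_def)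
  finally have "norm P = 1" using tr by (simp add: norm_eq_sqrt_inner)
  moreover have "c = inner (alice d r A P) (bob d r B P)"
    if A: "herm_contraction d A" and B: "herm_contraction d B"
      and c: "complex_of_real c = mtrace (kron d A B * \<rho>)" for A B c
  proof -
    let ?p = "\<lambda>i j l. Poly_Mapping.lookup P (i, j, l)"
    have "mtrace (kron d A B * \<rho>) =
        (\<Sum>p<d * d. \<Sum>q<d * d. (\<lambda>i j. A $$ (p div d, i) * B $$ (p mod d, j) * \<rho> $$ (i * d + j, p)) (q div d) (q mod d))"
      unfolding mtrace_kron_mult[OF \<rho>] by simp
    also have "\<dots> = (\<Sum>p<d * d. \<Sum>k<d. \<Sum>q<d. A $$ (p div d, k) * B $$ (p mod d, q) * \<rho> $$ (k * d + q, p))"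
      by (rule sum.cong[OF refl], rule sum_div_mod)
    also have "\<dots> = (\<Sum>p<d * d. (\<lambda>i j. \<Sum>k<d. \<Sum>q<d. A $$ (i, k) * B $$ (j, q) * \<rho> $$ (k * d + q, i * d + j)) (p div d) (p mod d))"
      by simp
    also have "\<dots> = (\<Sum>i<d. \<Sum>j<d. \<Sum>k<d. \<Sum>q<d. A $$ (i, k) * B $$ (j, q) * \<rho> $$ (k * d + q, i * d + j))"
      by (rule sum_div_mod)
    also have "\<dots> = (\<Sum>i<d. \<Sum>j<d. \<Sum>l<r. \<Sum>k<d. \<Sum>q<d. A $$ (i, k) * (B $$ (j, q) * ?p k q l) * cnj (?p i j l))"
    proof (rule sum.cong[OF refl], rule sum.cong[OF refl])
      fix i j assume ij: "i \<in> {..<d}" "j \<in> {..<d}"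
      have "(\<Sum>k<d. \<Sum>q<d. A $$ (i, k) * B $$ (j, q) * \<rho> $$ (k * d + q, i * d + j)) =
          (\<Sum>k<d. \<Sum>q<d. \<Sum>l<r. A $$ (i, k) * (B $$ (j, q) * ?p k q l) * cnj (?p i j l))"
        using ij by (intro sum.cong refl) (simp add: \<rho>P sum_distrib_left mult.assoc)
      also have "\<dots> = (\<Sum>k<d. \<Sum>l<r. \<Sum>q<d. A $$ (i, k) * (B $$ (j, q) * ?p k q l) * cnj (?p i j l))"
        by (rule sum.cong[OF refl], rule sum.swap)
      also have "\<dots> = (\<Sum>l<r. \<Sum>k<d. \<Sum>q<d. A $$ (i, k) * (B $$ (j, q) * ?p k q l) * cnj (?p i j l))"
        by (rule sum.swap)
      finally show "(\<Sum>k<d. \<Sum>q<d. A $$ (i, k) * B $$ (j, q) * \<rho> $$ (k * d + q, i * d + j)) =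
          (\<Sum>l<r. \<Sum>k<d. \<Sum>q<d. A $$ (i, k) * (B $$ (j, q) * ?p k q l) * cnj (?p i j l))" .
    qed
    also have "\<dots> = (\<Sum>i<d. \<Sum>j<d. \<Sum>l<r. Poly_Mapping.lookup (alice d r A (bob d r B P)) (i, j, l) * cnj (?p i j l))"
      by (intro sum.cong refl) (simp add: alice.rep_eq bob.rep_eq sum_distrib_left sum_distrib_right)
    finally have "c = Re (\<Sum>i<d. \<Sum>j<d. \<Sum>l<r. Poly_Mapping.lookup (alice d r A (bob d r B P)) (i, j, l) * cnj (?p i j l))"
      using c by (metis Re_complex_of_real)
    also have "\<dots> = inner (alice d r A (bob d r B P)) P"
      unfolding inner_box[OF keys_alice] by (simp only: Re_sum)
    also have "\<dots> = inner (bob d r B P) (alice d r A P)" by (rule selfadjoint_alice[OF A])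
    finally show ?thesis by (simp add: inner_commute)
  qed
  ultimately show ?thesis using keys that by blast
qed

section \<open>Dimension bound\<close>

text \<open>Each index contributes two real directions, 1 and i, so the ambient real dimension is
  twice the number of indices.\<close>

lemma orthogonal_family_card_le:
  fixes F :: "tvec set"
  assumes S: "finite S" and keys: "\<And>X. X \<in> F \<Longrightarrow> Poly_Mapping.keys X \<subseteq> S"
    and F: "0 \<notin> F" "pairwise (\<lambda>X Y. inner X Y = 0) F"
  shows "card F \<le> 2 * card S"
proof -
  let ?B = "(\<lambda>s. Poly_Mapping.single s (1::complex)) ` S \<union> (\<lambda>s. Poly_Mapping.single s \<i>) ` S"
  have "independent F"
    using F by (intro pairwise_orthogonal_independent) (auto simp: pairwise_def Linear_Algebra.orthogonal_def)
  moreover have "F \<subseteq> span ?B"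
  proof
    fix X assume "X \<in> F"
    have "X = (\<Sum>s\<in>S. Re (Poly_Mapping.lookup X s) *\<^sub>R Poly_Mapping.single s 1 + Im (Poly_Mapping.lookup X s) *\<^sub>R Poly_Mapping.single s \<i>)"
      (is "X = (\<Sum>s\<in>S. ?g s)")
    proof (rule poly_mapping_eqI)
      fix k
      have "Poly_Mapping.lookup (\<Sum>s\<in>S. ?g s) k = (\<Sum>s\<in>S. if s = k then Poly_Mapping.lookup X k else 0)"
        unfolding lookup_sum by (intro sum.cong refl)
          (auto simp: lookup_add lookup_scaleR lookup_single when_def complex_eq_iff)
      also have "\<dots> = Poly_Mapping.lookup X k"
        using S keys[OF \<open>X \<in> F\<close>] by (auto simp: in_keys_iff)
      finally show "Poly_Mapping.lookup X k = Poly_Mapping.lookup (\<Sum>s\<in>S. ?g s) k" ..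
    qed
    moreover have "(\<Sum>s\<in>S. ?g s) \<in> span ?B"
      by (intro span_sum span_add span_scale span_base) auto
    ultimately show "X \<in> span ?B" by simp
  qed
  ultimately have "card F \<le> card ?B"
    using independent_span_bound[of ?B F] S by blast
  also have "\<dots> \<le> card S + card S"
    using S by (intro order_trans[OF card_Un_le] add_mono card_image_le)
  finally show ?thesis by simp
qed

text \<open>Tsirelson's theorem from operators to vectors: the images of the purified state under
  the two parties' contractions.\<close>

lemma quantum_vec_corr:
  assumes "state d \<rho>" and "\<And>x. x < n \<Longrightarrow> herm_contraction d (M x)" "\<And>y. y < m \<Longrightarrow> herm_contraction d (N y)"
    and "\<And>x y. x < n \<Longrightarrow> y < m \<Longrightarrow> complex_of_real (c x y) = mtrace (kron d (M x) (N y) * \<rho>)"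
  shows "vec_corr n m c"
proof -
  obtain r and P :: tvec where P: "norm P = 1" and
    c: "\<And>A B c. herm_contraction d A \<Longrightarrow> herm_contraction d B \<Longrightarrow>
       complex_of_real c = mtrace (kron d A B * \<rho>) \<Longrightarrow> c = inner (alice d r A P) (bob d r B P)"
    using state_purification[OF assms(1)] by metis
  show ?thesis
  proof (rule vec_corr_inner[where u = "\<lambda>x. alice d r (M x) P" and v = "\<lambda>y. bob d r (N y) P"])
    show "inner (alice d r (M x) P) (alice d r (M x) P) \<le> 1" if "x < n" for x
      using contraction_alice[OF assms(2)[OF that], of r P] P by (simp add: norm_eq_sqrt_inner)
    show "inner (bob d r (N y) P) (bob d r (N y) P) \<le> 1" if "y < m" for y
      using contraction_bob[OF assms(3)[OF that], of r P] P by (simp add: norm_eq_sqrt_inner)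
    show "c x y = inner (alice d r (M x) P) (bob d r (N y) P)" if "x < n" "y < m" for x y
      by (rule c[OF assms(2)[OF that(1)] assms(3)[OF that(2)] assms(4)[OF that]])
  qed
qed

lemma rigid_dimension_bound:
  assumes rigid: "rigid n m c" and state: "state d \<rho>"
    and M: "\<And>x. x < n \<Longrightarrow> herm_contraction d (M x)" and N: "\<And>y. y < m \<Longrightarrow> herm_contraction d (N y)"
    and tr: "\<And>x y. x < n \<Longrightarrow> y < m \<Longrightarrow> complex_of_real (c x y) = mtrace (kron d (M x) (N y) * \<rho>)"
  obtains r :: nat and U V where "\<And>x y. x < n \<Longrightarrow> y < m \<Longrightarrow> c x y = (\<Sum>i<r. U x i * V y i)"
    "2 ^ (r div 2) \<le> d * d"
proof -
  obtain q and P :: tvec where P: "norm P = 1" and keysP: "Poly_Mapping.keys P \<subseteq> tbox d q" and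
    c: "\<And>A B c. herm_contraction d A \<Longrightarrow> herm_contraction d B \<Longrightarrow>
       complex_of_real c = mtrace (kron d A B * \<rho>) \<Longrightarrow> c = inner (alice d q A P) (bob d q B P)"
    using state_purification[OF state] by metis
  define E where "E = (\<lambda>(b :: nat \<Rightarrow> nat \<Rightarrow> real) i X. \<Sum>x<n. b i x *\<^sub>R alice d q (M x) X)"
  define B where "B = (\<lambda>(a :: nat \<Rightarrow> nat \<Rightarrow> real) i X. \<Sum>y<m. a i y *\<^sub>R bob d q (N y) X)"
  obtain r :: nat and U V a b where
    cUV: "\<And>x y. x < n \<Longrightarrow> y < m \<Longrightarrow> c x y = (\<Sum>i<r. U x i * V y i)" and
    EB: "\<And>i. i < r \<Longrightarrow> E b i P = (\<Sum>y<m. a i y *\<^sub>R bob d q (N y) P)" and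
    rel: "\<And>i j. i < r \<Longrightarrow> j < r \<Longrightarrow> E b i (E b j P) + E b j (E b i P) = (if i = j then 2 *\<^sub>R P else 0)"
    by (rule rigid_clifford_relations[where M = "\<lambda>x. alice d q (M x)" and N = "\<lambda>y. bob d q (N y)" and P = P and E = E,
          OF rigid linear_alice linear_bob selfadjoint_alice[OF M] selfadjoint_bob[OF N]
          contraction_alice[OF M] contraction_bob[OF N] alice_bob_commute P c[OF M N tr] E_def])
      (assumption | (rule that; assumption))+
  define A where "A = E b"
  have linA: "linear (A i)" for i
    unfolding A_def E_def by (intro linear_compose_sum ballI linear_compose_scale_right linear_alice)
  have linB: "linear (B a i)" for i
    unfolding B_def by (intro linear_compose_sum ballI linear_compose_scale_right linear_bob)
  have saA: "inner (A i X) Y = inner X (A i Y)" for i X Y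
    unfolding A_def E_def by (simp add: inner_sum_left inner_sum_right selfadjoint_alice[OF M])
  have imulA: "imul (A i X) = A i (imul X)" for i X
    unfolding A_def E_def by (simp add: linear_sum[OF linear_imul] linear_cmul[OF linear_imul] imul_alice)
  have layerA: "layer l (A i X) = A i (layer l X)" for l i X
    unfolding A_def E_def by (simp add: linear_sum[OF linear_layer] linear_cmul[OF linear_layer] layer_alice)
  have layerB: "layer l (B a i X) = B a i (layer l X)" for l i X
    unfolding B_def by (simp add: linear_sum[OF linear_layer] linear_cmul[OF linear_layer] layer_bob)
  have bobA: "bob d q Y (A i X) = A i (bob d q Y X)" for Y i X
    unfolding A_def E_def by (simp add: linear_sum[OF linear_bob] linear_cmul[OF linear_bob] alice_bob_commute)
  \<comment> \<open>All operators act within each layer, so both the agreement of Alice's and Bob's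
    combinations and the Clifford relations restrict from P to this nonzero slice.\<close>
  obtain l where l: "layer l P \<noteq> 0"
  proof (rule ccontr)
    assume "\<not> thesis"
    then have "layer l P = 0" for l using that by blast
    moreover have "Poly_Mapping.lookup (layer l P) (i, j, l) = Poly_Mapping.lookup P (i, j, l)" for i j l
      by (simp add: layer.rep_eq)
    ultimately have "P = 0" by (intro tvec_eqI) simp
    then show False using P by simp
  qed
  define p where "p = layer l P"
  have AB: "A i p = B a i p" if "i < r" for i
    using arg_cong[OF EB[OF that], of "layer l"] layerA[of l i P] layerB[of l i P]
    by (simp add: p_def A_def B_def)
  have anti: "A i (A j p) + A j (A i p) = (if i = j then 2 *\<^sub>R p else 0)" if "i < r" "j < r" for i j
    using arg_cong[OF rel[OF that], of "layer l"]
    by (simp add: p_def A_def[symmetric] linear_add[OF linear_layer] linear_cmul[OF linear_layer]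
        linear_0[OF linear_layer] layerA split: if_splits)

  \<comment> \<open>The relations at p carry over to T p for every T commuting with all A(i); composing with B(a, i) keeps
    T in this class, so the orbit of p is invariant.\<close>
  define Comm where "Comm = {T. linear T \<and> (\<forall>i X. T (A i X) = A i (T X)) \<and> (\<forall>X. layer l (T X) = T (layer l X)) \<and>
      (\<forall>X. Poly_Mapping.keys X \<subseteq> tbox d q \<longrightarrow> Poly_Mapping.keys (T X) \<subseteq> tbox d q)}"
  define K where "K = (\<lambda>T. T p) ` Comm"
  have keysp: "Poly_Mapping.keys p \<subseteq> tbox d q"
    using keysP by (auto simp: p_def in_keys_iff layer.rep_eq split: if_splits)
  \<comment> \<open>Commuting with the projection onto layer l and preserving the box confine the
    orbit to d * d complex coordinates, whatever the range q of the purifying index.\<close>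
  have keysK: "Poly_Mapping.keys X \<subseteq> {..<d} \<times> {..<d} \<times> {l}" if X: "X \<in> K" for X
  proof -
    obtain T where T: "T \<in> Comm" "X = T p" using X by (auto simp: K_def)
    have 1: "Poly_Mapping.keys X \<subseteq> tbox d q" using T keysp by (simp add: Comm_def)
    have "layer l p = p" unfolding p_def by (rule tvec_eqI) (simp add: layer.rep_eq)
    then have "X = layer l X" using T by (simp add: Comm_def)
    moreover have "Poly_Mapping.lookup (layer l X) (i, j, l') = 0" if "l' \<noteq> l" for i j l'
      using that by (simp add: layer.rep_eq)
    ultimately have "Poly_Mapping.lookup X (i, j, l') = 0" if "l' \<noteq> l" for i j l'
      using that by simp
    then show ?thesis using 1 by (fastforce simp: in_keys_iff)
  qed
  have idC: "(\<lambda>X. X) \<in> Comm" by (simp add: Comm_def linear_ident)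
  have addC: "(\<lambda>X. T X + T' X) \<in> Comm" if "T \<in> Comm" "T' \<in> Comm" for T T'
  proof -
    have "Poly_Mapping.keys (T X + T' X) \<subseteq> tbox d q" if "Poly_Mapping.keys X \<subseteq> tbox d q" for X
    proof -
      have "Poly_Mapping.keys (T X) \<subseteq> tbox d q" "Poly_Mapping.keys (T' X) \<subseteq> tbox d q"
        using \<open>T \<in> Comm\<close> \<open>T' \<in> Comm\<close> that unfolding Comm_def by blast+
      then show ?thesis using Poly_Mapping.keys_add[of "T X" "T' X"] by blast
    qed
    then show ?thesis using that
      by (simp add: Comm_def linear_compose_add linear_add[OF linA] linear_add[OF linear_layer])
  qed
  have scaleC: "(\<lambda>X. k *\<^sub>R T X) \<in> Comm" if "T \<in> Comm" for T k
  proof -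
    have "Poly_Mapping.keys (k *\<^sub>R T X) \<subseteq> Poly_Mapping.keys (T X)" for X
      by (auto simp: in_keys_iff lookup_scaleR)
    then show ?thesis using that
      by (simp add: Comm_def linear_compose_scale_right linear_cmul[OF linA] linear_cmul[OF linear_layer])
        (meson subset_trans)
  qed
  have imulC: "(\<lambda>X. imul (T X)) \<in> Comm" if "T \<in> Comm" for T
  proof -
    have "Poly_Mapping.keys (imul X) \<subseteq> Poly_Mapping.keys X" for X by (auto simp: in_keys_iff imul.rep_eq)
    moreover have "layer l (imul X) = imul (layer l X)" for X
      by (rule tvec_eqI) (simp add: layer.rep_eq imul.rep_eq)
    moreover have "linear (\<lambda>X. imul (T X))"
      using linear_compose[of T imul] linear_imul that by (simp add: o_def Comm_def)
    ultimately show ?thesis using that by (simp add: Comm_def imulA) (meson subset_trans)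
  qed
  have BC: "(\<lambda>X. T (B a i X)) \<in> Comm" if "T \<in> Comm" for T i
  proof -
    have lin: "linear (\<lambda>X. T (B a i X))"
      using linear_compose[OF linB, of T] that by (simp add: o_def Comm_def)
    have "B a i (A j X) = A j (B a i X)" for j X
      unfolding B_def by (simp add: bobA linear_sum[OF linA] linear_cmul[OF linA])
    moreover have "Poly_Mapping.keys (B a i X) \<subseteq> tbox d q" for X
    proof
      fix s assume "s \<in> Poly_Mapping.keys (B a i X)"
      then have "(\<Sum>y<m. a i y *\<^sub>R Poly_Mapping.lookup (bob d q (N y) X) s) \<noteq> 0"
        by (simp add: in_keys_iff B_def lookup_sum lookup_scaleR)
      then obtain y where "Poly_Mapping.lookup (bob d q (N y) X) s \<noteq> 0"
        by (metis (mono_tags, lifting) scaleR_zero_right sum.neutral)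
      then show "s \<in> tbox d q" using keys_bob[of d q "N y" X] by (auto simp: in_keys_iff)
    qed
    ultimately show ?thesis using that lin by (auto simp: Comm_def layerB)
  qed
  define s where "s = r div 2"
  have s: "i < r" if "i < 2 * s" for i using that by (simp add: s_def)
  have "\<exists>F\<subseteq>K. finite F \<and> card F = 2 ^ (s + 1) \<and> 0 \<notin> F \<and> pairwise (\<lambda>X Y. inner X Y = 0) F"
  proof (rule clifford_orthogonal_family[where J = imul and E = A and ?X0.0 = p])
    show "Real_Vector_Spaces.subspace K"
    proof (rule subspaceI)
      have "(\<lambda>X. 0 *\<^sub>R X) \<in> Comm" by (rule scaleC[OF idC])
      then show "0 \<in> K" unfolding K_def by (intro image_eqI[of _ _ "\<lambda>X. 0 *\<^sub>R X"]) auto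
    next
      fix X Y assume "X \<in> K" "Y \<in> K"
      then obtain T T' where "T \<in> Comm" "T' \<in> Comm" "X = T p" "Y = T' p" by (auto simp: K_def)
      then show "X + Y \<in> K" unfolding K_def by (intro image_eqI[OF _ addC[of T T']]) auto
    next
      fix k X assume "X \<in> K"
      then obtain T where "T \<in> Comm" "X = T p" by (auto simp: K_def)
      then show "k *\<^sub>R X \<in> K" unfolding K_def by (intro image_eqI[OF _ scaleC[of T k]]) auto
    qed
    show "p \<in> K" unfolding K_def by (intro image_eqI[OF _ idC]) auto
    show "imul X \<in> K" if X: "X \<in> K" for X
    proof -
      obtain T where "T \<in> Comm" "X = T p" using X by (auto simp: K_def)
      then show ?thesis unfolding K_def by (intro image_eqI[OF _ imulC[of T]]) auto
    qed
    show "A i X \<in> K" if i: "i < 2 * s" and X: "X \<in> K" for i X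
    proof -
      obtain T where T: "T \<in> Comm" "X = T p" using X by (auto simp: K_def)
      \<comment> \<open>Alice's operator passes through T down to p, where it can be traded for
        Bob's; the result is again the image of p under a member of \<open>Comm\<close>.\<close>
      then have "A i X = T (A i p)" by (simp add: Comm_def)
      then have "A i X = T (B a i p)" by (simp only: AB[OF s[OF i]])
      then show ?thesis unfolding K_def using T by (intro image_eqI[OF _ BC[of T i]])
    qed
    show "A i (A j X) + A j (A i X) = (if i = j then 2 *\<^sub>R X else 0)"
      if ij: "i < 2 * s" "j < 2 * s" and X: "X \<in> K" for i j X
    proof -
      obtain T where T: "T \<in> Comm" "X = T p" using X by (auto simp: K_def)
      then have TA: "T (A i Y) = A i (T Y)" and linT: "linear T" for i Y by (auto simp: Comm_def)
      have "A i (A j X) + A j (A i X) = T (A i (A j p) + A j (A i p))"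
        by (simp add: T(2) TA linear_add[OF linT])
      also have "\<dots> = (if i = j then 2 *\<^sub>R X else 0)"
        using anti[OF s[OF ij(1)] s[OF ij(2)]] by (simp add: T(2) linear_cmul[OF linT] linear_0[OF linT])
      finally show ?thesis .
    qed
  qed (use l in \<open>auto simp: linear_imul linA imul_imul inner_imul saA imulA p_def\<close>)
  then obtain F where F: "F \<subseteq> K" "card F = 2 ^ (s + 1)" "0 \<notin> F" "pairwise (\<lambda>X Y. inner X Y = 0) F"
    by blast
  \<comment> \<open>Both sides count real dimensions: 2^(s+1) orthogonal vectors against 2 d^2. The
    common factor 2 cancels.\<close>
  have "card F \<le> 2 * card ({..<d} \<times> {..<d} \<times> {l})"
    by (rule orthogonal_family_card_le) (use F keysK in auto)
  then have "2 ^ (r div 2) \<le> d * d" using F(2) by (simp add: s_def)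
  with cUV show ?thesis by (rule that)
qed

text \<open>The difference of a party's two effects is an observable with the right correlations:
  the sum of the four probabilities weighted by outcome signs is C(x, y). It is a contraction
  because the two forms are nonnegative with sum |z|^2, which bounds their difference.\<close>

lemma has_rep_dimension_bound:
  assumes rigid: "rigid n m (\<lambda>x y. C $$ (x, y))" and rep: "has_rep n m 2 2 d (pC C)"
  obtains r :: nat and U V where "\<And>x y. x < n \<Longrightarrow> y < m \<Longrightarrow> C $$ (x, y) = (\<Sum>i<r. U x i * V y i)"
    "2 ^ (r div 2) \<le> d * d"
proof -
  obtain \<rho> M N where st: "state d \<rho>"
    and M: "\<forall>x<n. (\<forall>a<2. psd d (M a x)) \<and> (\<forall>i<d. \<forall>j<d. (\<Sum>a<2. M a x $$ (i, j)) = 1\<^sub>m d $$ (i, j))"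
    and N: "\<forall>y<m. (\<forall>b<2. psd d (N b y)) \<and> (\<forall>i<d. \<forall>j<d. (\<Sum>b<2. N b y $$ (i, j)) = 1\<^sub>m d $$ (i, j))"
    and tr: "\<forall>x<n. \<forall>y<m. \<forall>a<2. \<forall>b<2. complex_of_real (pC C a b x y) = mtrace (kron d (M a x) (N b y) * \<rho>)"
    using rep unfolding has_rep_def by (elim exE conjE) (rule that; assumption)
  define D where "D = (\<lambda>(W :: nat \<Rightarrow> nat \<Rightarrow> complex mat) x. mat d d (\<lambda>(i, j). W 0 x $$ (i, j) - W 1 x $$ (i, j)))"
  have contr: "herm_contraction d (D W x)"
    if W: "(\<forall>a<2. psd d (W a x)) \<and> (\<forall>i<d. \<forall>j<d. (\<Sum>a<2. W a x $$ (i, j)) = 1\<^sub>m d $$ (i, j))" for W x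
  proof -
    have psd: "psd d (W 0 x)" "psd d (W 1 x)" using W by auto
    have one: "W 0 x $$ (i, j) + W 1 x $$ (i, j) = (if i = j then 1 else 0)" if "i < d" "j < d" for i j
    proof -
      have "(\<Sum>a<2. W a x $$ (i, j)) = 1\<^sub>m d $$ (i, j)" using W that by blast
      then show ?thesis using that by (simp add: numeral_2_eq_2)
    qed
    have herm: "D W x $$ (j, i) = cnj (D W x $$ (i, j))" if "i < d" "j < d" for i j
    proof -
      have "W 0 x $$ (j, i) = cnj (W 0 x $$ (i, j))" "W 1 x $$ (j, i) = cnj (W 1 x $$ (i, j))"
        using psd that unfolding psd_iff by blast+
      then show ?thesis using that unfolding D_def by simp
    qed
    have "\<bar>Re (\<Sum>i<d. \<Sum>j<d. D W x $$ (i, j) * z j * cnj (z i))\<bar> \<le> (\<Sum>i<d. (cmod (z i))\<^sup>2)" for z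
    proof -
      let ?f = "\<lambda>a. \<Sum>i<d. \<Sum>j<d. W a x $$ (i, j) * z j * cnj (z i)"
      have nn: "0 \<le> Re (?f 0)" "0 \<le> Re (?f 1)" using psd unfolding psd_iff by blast+
      have "?f 0 + ?f 1 = (\<Sum>i<d. \<Sum>j<d. (W 0 x $$ (i, j) + W 1 x $$ (i, j)) * (z j * cnj (z i)))"
        by (simp add: sum.distrib distrib_right mult.assoc)
      also have "\<dots> = (\<Sum>i<d. \<Sum>j<d. if j = i then of_real ((cmod (z i))\<^sup>2) else 0)"
      proof (rule sum.cong[OF refl], rule sum.cong[OF refl])
        fix i j assume "i \<in> {..<d}" "j \<in> {..<d}"
        then have "W 0 x $$ (i, j) + W 1 x $$ (i, j) = (if i = j then 1 else 0)" by (intro one) auto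
        then show "(W 0 x $$ (i, j) + W 1 x $$ (i, j)) * (z j * cnj (z i)) = (if j = i then of_real ((cmod (z i))\<^sup>2) else 0)"
          unfolding complex_norm_square by simp
      qed
      also have "\<dots> = of_real (\<Sum>i<d. (cmod (z i))\<^sup>2)" by simp
      finally have sum: "Re (?f 0) + Re (?f 1) = (\<Sum>i<d. (cmod (z i))\<^sup>2)"
        by (simp only: plus_complex.sel[symmetric] Re_complex_of_real)
      have "(\<Sum>i<d. \<Sum>j<d. D W x $$ (i, j) * z j * cnj (z i)) =
          (\<Sum>i<d. \<Sum>j<d. W 0 x $$ (i, j) * z j * cnj (z i) - W 1 x $$ (i, j) * z j * cnj (z i))"
        by (intro sum.cong refl) (simp add: D_def left_diff_distrib)
      then have "Re (\<Sum>i<d. \<Sum>j<d. D W x $$ (i, j) * z j * cnj (z i)) = Re (?f 0) - Re (?f 1)"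
        by (simp only: sum_subtractf minus_complex.sel)
      then show ?thesis using nn sum by linarith
    qed
    then show ?thesis unfolding herm_contraction_def using herm by blast
  qed
  have \<rho>: "\<rho> \<in> carrier_mat (d * d) (d * d)" using st unfolding state_def psd_iff by blast
  have corr: "complex_of_real (C $$ (x, y)) = mtrace (kron d (D M x) (D N y) * \<rho>)" if "x < n" "y < m" for x y
  proof -
    let ?t = "\<lambda>a b. mtrace (kron d (M a x) (N b y) * \<rho>)"
    have idx: "p div d < d" "p mod d < d" if "p < d * d" for p
      using that by (auto simp: less_mult_imp_div_less intro!: mod_less_divisor) (cases d; simp)
    have "mtrace (kron d (D M x) (D N y) * \<rho>) = ?t 0 0 - ?t 0 1 - ?t 1 0 + ?t 1 1"
      unfolding mtrace_kron_mult[OF \<rho>] sum_subtractf[symmetric] sum.distrib[symmetric]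
      by (intro sum.cong refl) (simp add: D_def idx algebra_simps)
    also have "\<dots> = complex_of_real (pC C 0 0 x y - pC C 0 1 x y - pC C 1 0 x y + pC C 1 1 x y)"
      using tr that by simp
    also have "pC C 0 0 x y - pC C 0 1 x y - pC C 1 0 x y + pC C 1 1 x y = C $$ (x, y)"
      by (simp add: pC_def pm_def field_simps)
    finally show ?thesis ..
  qed
  show ?thesis
    by (rule rigid_dimension_bound[OF rigid st _ _ corr])
      (use contr M N in blast, use contr M N in blast, assumption+, rule that)
qed

section \<open>Rank of a factorization, Lorentz vectors and conclusion\<close>

lemma mat_rank_le_inner_dimension:
  fixes C :: "real mat"
  assumes "C \<in> carrier_mat n m" and "\<And>x y. x < n \<Longrightarrow> y < m \<Longrightarrow> C $$ (x, y) = (\<Sum>i<r. U x i * V y i)"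
  shows "mat_rank C \<le> r"
  using assms
proof (induction r arbitrary: C)
  case 0
  then have "C = 0\<^sub>m n m" by (intro eq_matI) auto
  then show ?case by (simp add: mat_rank_def vec_space.rank_0I)
next
  case (Suc r)
  define A where "A = mat n m (\<lambda>(x, y). \<Sum>i<r. U x i * V y i)"
  define B where "B = mat n m (\<lambda>(x, y). U x r * V y r)"
  have AB: "A \<in> carrier_mat n m" "B \<in> carrier_mat n m" by (simp_all add: A_def B_def)
  have "C = A + B" using Suc.prems by (intro eq_matI) (auto simp: A_def B_def)
  moreover have "vec_space.rank n A \<le> r"
    using Suc.IH[OF AB(1)] AB by (simp add: mat_rank_def) (simp add: A_def)
  moreover have "vec_space.rank n B \<le> 1"
    by (rule vec_space.rank_le_1_product_entries[OF AB(2), where f = "\<lambda>x. U x r" and g = "\<lambda>y. V y r"])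
      (simp_all add: B_def)
  ultimately show ?case
    using vec_space.rank_subadditive[OF AB] Suc.prems(1) by (auto simp: mat_rank_def)
qed

text \<open>The factor 1/2 on all coordinates produces the denominator 4 of \<open>pC\<close>, and
  membership in the cone becomes membership of w in the unit ball.\<close>

lemma vec_corr_gram_lorentz:
  assumes "vec_corr n m (\<lambda>x y. C $$ (x, y))"
  shows "\<exists>R \<in> Aset n m 2 2 (pC C). gram_lorentz (index_set n m 2 2) R"
proof -
  obtain k :: nat and U V where U: "\<forall>x<n. (\<Sum>i<k. (U x i)\<^sup>2) \<le> 1" and V: "\<forall>y<m. (\<Sum>i<k. (V y i)\<^sup>2) \<le> 1"
    and c: "\<forall>x<n. \<forall>y<m. C $$ (x, y) = (\<Sum>i<k. U x i * V y i)"
    using assms unfolding vec_corr_def by (elim exE conjE) (rule that; assumption)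
  define w where "w = (\<lambda>i. case i of Inl (x, a) \<Rightarrow> (\<lambda>l. pm a * U x l) | Inr (y, b) \<Rightarrow> (\<lambda>l. pm b * V y l))"
  \<comment> \<open>Coordinate 0 is the axis of the cone and coordinate Suc l holds entry l of w, so
    k coordinates become Suc k.\<close>
  define v :: "idx \<Rightarrow> nat \<Rightarrow> real" where "v = (\<lambda>i l. (case l of 0 \<Rightarrow> 1 | Suc l \<Rightarrow> w i l) / 2)"
  define R where "R = (\<lambda>i j. \<Sum>l<Suc k. v i l * v j l)"
  have R: "R i j = (1 + (\<Sum>l<k. w i l * w j l)) / 4" for i j
    unfolding R_def sum.lessThan_Suc_shift
    by (simp add: v_def sum_divide_distrib[symmetric] add_divide_distrib)
  have pmpm: "pm a * z * (pm b * z') = pm a * pm b * (z * z')" for a b z z' by simp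
  have w_sum: "(\<Sum>l<k. w (Inl (x, a)) l * w (Inl (x', a')) l) = pm a * pm a' * (\<Sum>l<k. U x l * U x' l)"
    "(\<Sum>l<k. w (Inl (x, a)) l * w (Inr (y, b)) l) = pm a * pm b * (\<Sum>l<k. U x l * V y l)"
    "(\<Sum>l<k. w (Inr (y, b)) l * w (Inr (y', b')) l) = pm b * pm b' * (\<Sum>l<k. V y l * V y' l)" for x x' y y' a a' b b'
    by (simp_all add: w_def pmpm sum_distrib_left)
  \<comment> \<open>The signs cancel for every z, so blocks within one party are normalized as well,
    whatever the inner products of its vectors.\<close>
  have two: "(\<Sum>a<2. \<Sum>b<2. (1 + pm a * pm b * z) / 4) = 1" for z
    by (simp add: numeral_2_eq_2 pm_def add_divide_distrib[symmetric])
  have "R \<in> Aset n m 2 2 (pC C)"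
    unfolding Aset_def
  proof (rule CollectI, intro conjI)
    show "\<forall>i\<in>index_set n m 2 2. \<forall>j\<in>index_set n m 2 2. R i j = R j i"
      by (simp add: R_def mult.commute)
    show "\<forall>x<n. \<forall>y<m. \<forall>a<2. \<forall>b<2. R (Inl (x, a)) (Inr (y, b)) = pC C a b x y"
      using c by (simp add: R w_sum pC_def)
  qed (simp_all only: R w_sum two, simp_all)
  moreover have "in_lorentz (Suc k) (v i)" if "i \<in> index_set n m 2 2" for i
  proof -
    have "(\<Sum>l\<in>{1..<Suc k}. (v i l)\<^sup>2) = (\<Sum>l<k. (v i (Suc l))\<^sup>2)"
      using sum.shift_bounds_Suc_ivl[of "\<lambda>l. (v i l)\<^sup>2" 0 k] by (simp add: atLeast0LessThan)
    also have "\<dots> = (\<Sum>l<k. (w i l)\<^sup>2) / 4"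
      by (simp add: v_def power_divide sum_divide_distrib)
    also have "(\<Sum>l<k. (w i l)\<^sup>2) \<le> 1"
    proof -
      have "(pm a * z)\<^sup>2 = z\<^sup>2" for a z by (simp add: pm_def power_mult_distrib)
      then show ?thesis using that U V by (auto simp: index_set_def w_def)
    qed
    finally have "(\<Sum>l\<in>{1..<Suc k}. (v i l)\<^sup>2) \<le> (1 / 2)\<^sup>2" by (simp add: power2_eq_square)
    then have "sqrt (\<Sum>l\<in>{1..<Suc k}. (v i l)\<^sup>2) \<le> 1 / 2" by (intro real_le_lsqrt sum_nonneg) auto
    then show ?thesis by (simp add: in_lorentz_def v_def)
  qed
  ultimately show ?thesis
    unfolding gram_lorentz_def
    by (intro bexI[of _ R] exI[of _ "Suc k"] exI[of _ v]) (auto simp: R_def)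
qed

theorem theorem5p9:
  fixes n m :: nat and C :: "real mat"
  assumes "extreme_point_mat (Cor n m) C"
  shows "gram_lorentz_behavior n m 2 2 (pC C) \<and>
         sqrt 2 ^ (mat_rank C div 2) \<le> real (Dmin n m 2 2 (pC C))"
proof -
  have rigid: "rigid n m (\<lambda>x y. C $$ (x, y))" by (rule extreme_point_rigid[OF assms])
  have "C \<in> Cor n m" using assms by (simp add: extreme_point_mat_def)
  then obtain d M N \<rho> where C: "C \<in> carrier_mat n m"
    and M: "\<And>x. x < n \<Longrightarrow> observable d (M x)" and N: "\<And>y. y < m \<Longrightarrow> observable d (N y)"
    and st: "state d \<rho>"
    and tr: "\<And>x y. x < n \<Longrightarrow> y < m \<Longrightarrow> complex_of_real (C $$ (x, y)) = mtrace (kron d (M x) (N y) * \<rho>)"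
    unfolding Cor_def by blast
  have vc: "vec_corr n m (\<lambda>x y. C $$ (x, y))"
    by (rule quantum_vec_corr[OF st observable_herm_contraction[OF M] observable_herm_contraction[OF N] tr])
  \<comment> \<open>Existence of some representation makes the least one attained, so the bound can
    be applied to \<open>Dmin\<close> itself.\<close>
  have "\<exists>d. has_rep n m 2 2 d (pC C)" using vec_corr_has_rep[OF vc] unfolding pC_def .
  then have qb: "quantum_behavior n m 2 2 (pC C)" and rep: "has_rep n m 2 2 (Dmin n m 2 2 (pC C)) (pC C)"
    unfolding quantum_behavior_def Dmin_def by (auto intro: LeastI_ex)
  define D where "D = Dmin n m 2 2 (pC C)"
  obtain r :: nat and U V where fact: "\<And>x y. x < n \<Longrightarrow> y < m \<Longrightarrow> C $$ (x, y) = (\<Sum>i<r. U x i * V y i)"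
    and bound: "2 ^ (r div 2) \<le> D * D"
    using has_rep_dimension_bound[OF rigid rep] unfolding D_def by metis
  have "mat_rank C \<le> r" by (rule mat_rank_le_inner_dimension[OF C fact])
  then have "mat_rank C div 2 \<le> r div 2" by (rule div_le_mono)
  then have "sqrt 2 ^ (mat_rank C div 2) \<le> sqrt 2 ^ (r div 2)" by (intro power_increasing) auto
  also have "\<dots> = sqrt (2 ^ (r div 2))" by (simp add: real_sqrt_power)
  also have "\<dots> \<le> sqrt (real D * real D)"
  proof -
    have "real (2 ^ (r div 2)) \<le> real (D * D)" using bound by (simp only: of_nat_le_iff)
    then show ?thesis by (intro real_sqrt_le_mono) simp
  qed
  also have "\<dots> = real D" by simp
  finally have "sqrt 2 ^ (mat_rank C div 2) \<le> real D" .
  then show ?thesis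
    using qb vec_corr_gram_lorentz[OF vc] unfolding gram_lorentz_behavior_def D_def by blast
qed

end
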